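(* Let $(X,T)$ be a topological dynamical system with the local marker property. Let $d\in\mathbb{N}$ be such that $mdim(X,T)<\frac{d}{36}$ and $perdim(X,T)<\frac{d}{2}$. Then the set of continuous functions $f:X\to[0,1]^d$ for which the orbit map $I_f:(X,T)\to(([0,1]^d)^{\mathbb{Z}},\mathrm{shift})$, $I_f(x)=(f(T^kx))_{k\in\mathbb{Z}}$, is an embedding is comeagre in $C(X,[0,1]^d)$.
   Context: A topological dynamical system $(X,T)$ is a compact metric space $X$ together with a homeomorphism $T:X\to X$. $P$ denotes the set of periodic points of $(X,T)$, $P_m$ the set of periodic points of period $\le m$, and $\triangle=\{(x,x):x\in X\}$. The space $C(X,[0,1]^d)$ of continuous functions carries the supremum norm topology; a set is comeagre if it is the complement of a countable union of nowhere dense sets. The map $I_f$ is an embedding if it is injective (it is automatically continuous and equivariant). Dimension: for a finite open cover $\alpha$ of a space, $ord(\alpha)=\max_{x}\sum_{U\in\alpha}1_U(x)-1$ and $D(\alpha)=\min_{\beta\succ\alpha}ord(\beta)$, the minimum over finite open covers $\beta$ refining $\alpha$; the Lebesgue covering dimension is $dim=\sup_\alpha D(\alpha)$. Mean dimension: $mdim(X,T)=\sup_{\alpha}\lim_{n\to\infty}\frac{D(\alpha^n)}{n}$, where $\alpha$ ranges over finite open covers of $X$ and $\alpha^n=\bigvee_{i=0}^{n-1}T^{-i}\alpha$. Periodic dimension: $perdim(X,T)<c$ means $\frac{dim(P_m)}{m}<c$ for every $m\in\mathbb{N}$. Local marker property: let $Z,W\subset X$ be closed with $Z\times W\subset (X\times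 X)\setminus(\triangle\cup(X\times P)\cup(P\times X))$. A subset $F\subset X$ is a local $n$-marker for $Z\times W$ if (1) $F\cap T^i(F)=\emptyset$ for $i=1,\ldots,n-1$ and (2) there is $m\in\mathbb{N}$ such that the sets $T^i(F)$, $i=0,1,\ldots,m-1$, cover $Z\cup W$. $Z\times W$ has local markers if it has an open local $n$-marker for every $n\in\mathbb{N}$. $(X,T)$ has the local marker property if $(X\times X)\setminus(\triangle\cup(X\times P)\cup(P\times X))$ can be covered by a countable collection $\{Z_i\times W_i\}_{i=1}^\infty$ of such products of closed sets, each of which has local markers. *)

theory Defs
  imports "HOL-Analysis.Analysis"
begin

definition nowhere_dense_in :: "'a topology \<Rightarrow> 'a set \<Rightarrow> bool" where
  "nowhere_dense_in Y S \<longleftrightarrow> S \<subseteq> topspace Y \<and> Y interior_of (Y closure_of S) = {}"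

definition comeagre_in :: "'a topology \<Rightarrow> 'a set \<Rightarrow> bool" where
  "comeagre_in Y S \<longleftrightarrow> S \<subseteq> topspace Y \<and>
     (\<exists>N :: nat \<Rightarrow> 'a set. (\<forall>n. nowhere_dense_in Y (N n)) \<and> topspace Y - S = (\<Union>n. N n))"

definition finite_open_cover :: "'a topology \<Rightarrow> 'a set set \<Rightarrow> bool" where
  "finite_open_cover Y \<alpha> \<longleftrightarrow> finite \<alpha> \<and> (\<forall>U\<in>\<alpha>. openin Y U) \<and> \<Union>\<alpha> = topspace Y"

definition finer_cover :: "'a set set \<Rightarrow> 'a set set \<Rightarrow> bool" where
  "finer_cover \<beta> \<alpha> \<longleftrightarrow> (\<forall>V\<in>\<beta>. \<exists>U\<in>\<alpha>. V \<subseteq> U)"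

text \<open>Over a nonempty space every cover has multiplicity at least 1 at each point, so inserting 0 has
  no effect there; over the empty space it gives order -1, hence the usual convention that the empty
  space has dimension -1.\<close>

definition cover_ord :: "'a topology \<Rightarrow> 'a set set \<Rightarrow> int" where
  "cover_ord Y \<alpha> = int (Max (insert 0 ((\<lambda>x. card {U\<in>\<alpha>. x \<in> U}) ` topspace Y))) - 1"

text \<open>The infimum is a minimum: it is taken over a nonempty set of integers that are at least -1.\<close>

definition cover_D :: "'a topology \<Rightarrow> 'a set set \<Rightarrow> int" where
  "cover_D Y \<alpha> = Inf {cover_ord Y \<beta> | \<beta>. finite_open_cover Y \<beta> \<and> finer_cover \<beta> \<alpha>}"

definition covering_dim :: "'a topology \<Rightarrow> ereal" where
  "covering_dim Y = (SUP \<alpha>\<in>{\<alpha>. finite_open_cover Y \<alpha>}. ereal (of_int (cover_D Y \<alpha>)))"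

definition tds :: "'a::metric_space set \<Rightarrow> ('a \<Rightarrow> 'a) \<Rightarrow> bool" where
  "tds X T \<longleftrightarrow> compact X \<and> (\<exists>T'. homeomorphism X X T T')"

text \<open>Only the values of T on X matter, so the inverse is taken relative to X.\<close>

definition iter_int :: "'a set \<Rightarrow> ('a \<Rightarrow> 'a) \<Rightarrow> int \<Rightarrow> 'a \<Rightarrow> 'a" where
  "iter_int X T k = (if k \<ge> 0 then T ^^ nat k else inv_into X T ^^ nat (- k))"

definition orbit_map :: "'a set \<Rightarrow> ('a \<Rightarrow> 'a) \<Rightarrow> ('a \<Rightarrow> 'b) \<Rightarrow> 'a \<Rightarrow> int \<Rightarrow> 'b" where
  "orbit_map X T f x = (\<lambda>k. f (iter_int X T k x))"

definition periodic_points :: "'a set \<Rightarrow> ('a \<Rightarrow> 'a) \<Rightarrow> 'a set" where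
  "periodic_points X T = {x\<in>X. \<exists>k\<ge>1. (T ^^ k) x = x}"

definition periodic_points_upto :: "'a set \<Rightarrow> ('a \<Rightarrow> 'a) \<Rightarrow> nat \<Rightarrow> 'a set" where
  "periodic_points_upto X T m = {x\<in>X. \<exists>k. 1 \<le> k \<and> k \<le> m \<and> (T ^^ k) x = x}"

definition perdim_less :: "'a::metric_space set \<Rightarrow> ('a \<Rightarrow> 'a) \<Rightarrow> real \<Rightarrow> bool" where
  "perdim_less X T c \<longleftrightarrow>
     (\<forall>m\<ge>1. covering_dim (top_of_set (periodic_points_upto X T m)) / ereal (real m) < ereal c)"

text \<open>The members of the n-fold join are the intersections of the preimages of U 0, ..., U (n - 1)
  under the iterates 0, ..., n - 1 of T.\<close>

definition iterated_join :: "'a set \<Rightarrow> ('a \<Rightarrow> 'a) \<Rightarrow> 'a set set \<Rightarrow> nat \<Rightarrow> 'a set set" where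
  "iterated_join X T \<alpha> n =
     {{x\<in>X. \<forall>i<n. (T ^^ i) x \<in> U i} | U :: nat \<Rightarrow> 'a set. \<forall>i<n. U i \<in> \<alpha>}"

definition mean_dim :: "'a::metric_space set \<Rightarrow> ('a \<Rightarrow> 'a) \<Rightarrow> ereal" where
  "mean_dim X T = (SUP \<alpha>\<in>{\<alpha>. finite_open_cover (top_of_set X) \<alpha>}.
     ereal (lim (\<lambda>n. of_int (cover_D (top_of_set X) (iterated_join X T \<alpha> n)) / real n)))"

definition aperiodic_pairs :: "'a set \<Rightarrow> ('a \<Rightarrow> 'a) \<Rightarrow> ('a \<times> 'a) set" where
  "aperiodic_pairs X T =
     (X \<times> X) - ({(x, x) | x. x \<in> X} \<union> X \<times> periodic_points X T \<union> periodic_points X T \<times> X)"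

definition local_marker ::
    "'a set \<Rightarrow> ('a \<Rightarrow> 'a) \<Rightarrow> nat \<Rightarrow> 'a set \<Rightarrow> 'a set \<Rightarrow> 'a set \<Rightarrow> bool" where
  "local_marker X T n Z W F \<longleftrightarrow> F \<subseteq> X \<and>
     (\<forall>i\<in>{1..<n}. F \<inter> (T ^^ i) ` F = {}) \<and>
     (\<exists>m. Z \<union> W \<subseteq> (\<Union>i<m. (T ^^ i) ` F))"

definition has_local_markers ::
    "'a::metric_space set \<Rightarrow> ('a \<Rightarrow> 'a) \<Rightarrow> 'a set \<Rightarrow> 'a set \<Rightarrow> bool" where
  "has_local_markers X T Z W \<longleftrightarrow>
     (\<forall>n. \<exists>F. openin (top_of_set X) F \<and> local_marker X T n Z W F)"

definition local_marker_property :: "'a::metric_space set \<Rightarrow> ('a \<Rightarrow> 'a) \<Rightarrow> bool" where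
  "local_marker_property X T \<longleftrightarrow> (\<exists>Z W :: nat \<Rightarrow> 'a set.
     (\<forall>i. closedin (top_of_set X) (Z i) \<and> closedin (top_of_set X) (W i) \<and>
          Z i \<times> W i \<subseteq> aperiodic_pairs X T \<and> has_local_markers X T (Z i) (W i)) \<and>
     aperiodic_pairs X T \<subseteq> (\<Union>i. Z i \<times> W i))"

definition unit_cube :: "(real ^ 'd) set" where
  "unit_cube = {v. \<forall>i. 0 \<le> v $ i \<and> v $ i \<le> 1}"

text \<open>As always with \<^const>\<open>cfunspace\<close>, the elements are the continuous maps normalised to be
  \<^const>\<open>undefined\<close> outside X, with the supremum metric.\<close>

definition cube_maps :: "'a::metric_space set \<Rightarrow> ('a \<Rightarrow> real ^ 'd) metric" where
  "cube_maps X = cfunspace (top_of_set X) (submetric euclidean_metric unit_cube)"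

end

(*
  For a compact set K of pairs, the maps f whose orbit map identifies some pair of K form a closed set,
  so it suffices to cover the off-diagonal pairs, up to consequences of equality of orbits, by
  countably many K for which separating maps are dense. To perturb f, replace blocks of consecutive
  values of f along orbits by a generic map of the nerve of a cover of small order: for generic
  vertices all coincidences of blocks forced by a number of equations exceeding the number of
  barycentric coordinates are excluded. For periodic points the order of the cover is controlled
  by the periodic dimension and blocks are one period long; away from periodic points it is
  controlled by mean dimension and the blocks are placed with the help of the markers. Genericity is
  reduced to one-parameter perturbations: if the columns B are independent, then so are A + t B for all but
  finitely many t, and explicit independent B are of Vandermonde type. The marker property also makes the set
  of aperiodic points sigma-compact, which handles pairs of a periodic and an aperiodic point.
*)
theory Submission
  imports Defs "HOL-Computational_Algebra.Polynomial"
begin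

section \<open>Generic linear independence\<close>

text \<open>A periodic and an aperiodic point, or two points of different least periods, are never
  compared by a perturbation. If \<open>x\<close> has period \<open>q\<close> and shares its orbit
  map with \<open>y\<close>, then \<open>y\<close> and \<open>(T ^^ q) y\<close> share theirs, so it
  suffices to separate points from their own iterates. For least period \<open>q\<close> only
  \<open>(T ^^ p) y\<close> with \<open>2 * p \<le> q\<close> matters, since a coincidence at
  \<open>p\<close> gives one at \<open>q - p\<close>. This leaves at least \<open>q / 2\<close>
  times at which both values lie in one block, which is why a periodic dimension below
  \<open>d / 2\<close> suffices.

  The obstacle for aperiodic pairs is that the markers give the two points no common clock, while a
  continuous map cannot cut orbits into blocks at integer times. Hence the phase is real: each value
  mixes two blocks with starting times one apart, so comparing two points involves four points of
  the nerve. Their blocks are read from offsets that have nothing to do with each other, so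
  different shifts of the same vertex have to be independent. Plain powers fail here, and the
  explicit vertices have exponents quadratic in the index.\<close>

lemma finite_singular_parameters:
  fixes p :: "'s \<Rightarrow> 's \<Rightarrow> real poly"
  assumes "finite S" "k \<ge> 1"
    and "\<And>s. s \<in> S \<Longrightarrow> degree (p s s) = k"
    and "\<And>s t. s \<in> S \<Longrightarrow> t \<in> S \<Longrightarrow> s \<noteq> t \<Longrightarrow> degree (p s t) < k"
  shows "finite {\<tau>. \<exists>c. (\<exists>s\<in>S. c s \<noteq> 0) \<and> (\<forall>s\<in>S. (\<Sum>t\<in>S. poly (p s t) \<tau> * c t) = 0)}"
  using assms
proof (induction S arbitrary: p k rule: finite_induct)
  case empty
  then show ?case by simp
next
  case (insert r S)
  \<comment> \<open>Elimination of the row and column \<open>r\<close>: \<open>q\<close> is the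
    Schur complement multiplied by the pivot \<open>p r r\<close>. Diagonal degrees become exactly
    \<open>2 * k\<close> and the others stay below, so the induction hypothesis applies with
    \<open>2 * k\<close>. Away from the finitely many roots of the pivot, a kernel vector of
    \<open>p\<close> restricts to a nonzero kernel vector of \<open>q\<close>.\<close>
  define q where "q s t = p s t * p r r - p s r * p r t" for s t
  have dr: "degree (p r r) = k"
    using insert.prems by auto
  then have nz: "p r r \<noteq> 0" using insert.prems(1) by auto
  have dq: "degree (q s s) = 2 * k" if "s \<in> S" for s
  proof -
    have sr: "s \<noteq> r" using that insert.hyps by auto
    have "degree (p s s) = k" using that insert.prems by auto
    then have "degree (p s s * p r r) = 2 * k"
      using dr nz insert.prems(1) by (subst degree_mult_eq) auto
    moreover have "degree (p s r * p r s) < 2 * k"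
    proof -
      have "degree (p s r) < k" "degree (p r s) < k" using that sr insert.prems by auto
      then show ?thesis using degree_mult_le[of "p s r" "p r s"] by linarith
    qed
    ultimately show ?thesis unfolding q_def
      by (metis degree_add_eq_left degree_minus diff_conv_add_uminus)
  qed
  have dq': "degree (q s t) < 2 * k" if "s \<in> S" "t \<in> S" "s \<noteq> t" for s t
  proof -
    have sr: "s \<noteq> r" "t \<noteq> r" using that insert.hyps by auto
    have "degree (p s t) < k" "degree (p s r) < k" "degree (p r t) < k"
      using that sr insert.prems by auto
    then have "degree (p s t * p r r) < 2 * k" "degree (p s r * p r t) < 2 * k"
      using degree_mult_le[of "p s r" "p r t"] degree_mult_le[of "p s t" "p r r"] dr by linarith+
    then show ?thesis unfolding q_def by (meson degree_diff_less)
  qed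
  let ?B = "\<lambda>S p. {\<tau>. \<exists>c. (\<exists>s\<in>S. c s \<noteq> 0) \<and> (\<forall>s\<in>S. (\<Sum>t\<in>S. poly (p s t) \<tau> * c t) = 0)}"
  have "?B (insert r S) p \<subseteq> {\<tau>. poly (p r r) \<tau> = 0} \<union> ?B S q"
  proof (rule subsetI, rule ccontr)
    fix \<tau> assume "\<tau> \<in> ?B (insert r S) p" and n: "\<tau> \<notin> {\<tau>. poly (p r r) \<tau> = 0} \<union> ?B S q"
    then obtain c where c: "\<exists>s\<in>insert r S. c s \<noteq> 0"
      and e: "\<And>s. s \<in> insert r S \<Longrightarrow> (\<Sum>t\<in>insert r S. poly (p s t) \<tau> * c t) = 0" by blast
    have nr: "poly (p r r) \<tau> \<noteq> 0" and nB: "\<tau> \<notin> ?B S q" using n by auto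
    have E: "poly (p s r) \<tau> * c r + (\<Sum>t\<in>S. poly (p s t) \<tau> * c t) = 0" if "s \<in> insert r S" for s
      using e[OF that] insert.hyps by simp
    have "(\<Sum>t\<in>S. poly (q s t) \<tau> * c t) = 0" if "s \<in> S" for s
    proof -
      have "(\<Sum>t\<in>S. poly (q s t) \<tau> * c t)
          = poly (p r r) \<tau> * (\<Sum>t\<in>S. poly (p s t) \<tau> * c t) - poly (p s r) \<tau> * (\<Sum>t\<in>S. poly (p r t) \<tau> * c t)"
        by (simp add: q_def sum_distrib_left sum_subtractf[symmetric] algebra_simps)
      moreover have "(\<Sum>t\<in>S. poly (p s t) \<tau> * c t) = - (poly (p s r) \<tau> * c r)"
        "(\<Sum>t\<in>S. poly (p r t) \<tau> * c t) = - (poly (p r r) \<tau> * c r)"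
        using E[of s] E[of r] that by auto
      ultimately show ?thesis by simp
    qed
    then have z: "c s = 0" if "s \<in> S" for s using nB that by blast
    then have "poly (p r r) \<tau> * c r = 0" using E[of r] by simp
    then have "c r = 0" using nr by simp
    then show False using c z by auto
  qed
  moreover have "finite (?B S q)"
    using insert.IH[of "2 * k" q] dq dq' insert.prems(1) by auto
  moreover have "finite {\<tau>. poly (p r r) \<tau> = 0}" using nz poly_roots_finite by blast
  ultimately show ?case by (meson finite_UnI finite_subset)
qed

text \<open>Columns are an initial segment of the naturals instead of an index type, because their
  number \<open>K\<close> depends on block lengths that are chosen inside proofs.\<close>

definition lin_indep :: "'s set \<Rightarrow> nat \<Rightarrow> ('s \<Rightarrow> nat \<Rightarrow> real) \<Rightarrow> bool" where
  "lin_indep S K a \<longleftrightarrow> (\<forall>c. (\<forall>k<K. (\<Sum>s\<in>S. c s * a s k) = 0) \<longrightarrow> (\<forall>s\<in>S. c s = 0))"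

text \<open>Pairing with the dual family \<open>l\<close> turns the vectors into a square matrix
  with \<tau> plus a constant on the diagonal and constants elsewhere. This is the previous lemma
  with \<open>k = 1\<close>, and no determinant has to be formed.\<close>

lemma finite_dependent_parameters:
  fixes a b :: "'s \<Rightarrow> nat \<Rightarrow> real"
  assumes fin: "finite S"
    and dual: "\<And>s t. s \<in> S \<Longrightarrow> t \<in> S \<Longrightarrow> (\<Sum>k<K. l s k * b t k) = (if s = t then 1 else 0)"
  shows "finite {\<tau>. \<not> lin_indep S K (\<lambda>s k. a s k + \<tau> * b s k)}"
proof -
  define p where "p s t = [: \<Sum>k<K. l s k * a t k, if s = t then 1 else 0 :]" for s t
  have "finite {\<tau>. \<exists>c. (\<exists>s\<in>S. c s \<noteq> 0) \<and> (\<forall>s\<in>S. (\<Sum>t\<in>S. poly (p s t) \<tau> * c t) = 0)}"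
    by (rule finite_singular_parameters[OF fin, of 1]) (auto simp: p_def)
  moreover have "{\<tau>. \<not> lin_indep S K (\<lambda>s k. a s k + \<tau> * b s k)} \<subseteq> \<dots>"
  proof clarify
    fix \<tau> assume "\<not> lin_indep S K (\<lambda>s k. a s k + \<tau> * b s k)"
    then obtain c where c: "\<And>k. k < K \<Longrightarrow> (\<Sum>s\<in>S. c s * (a s k + \<tau> * b s k)) = 0" "\<exists>s\<in>S. c s \<noteq> 0"
      unfolding lin_indep_def by blast
    have "(\<Sum>t\<in>S. poly (p s t) \<tau> * c t) = 0" if "s \<in> S" for s
    proof -
      have "poly (p s t) \<tau> = (\<Sum>k<K. l s k * (a t k + \<tau> * b t k))" if "t \<in> S" for t
        using dual[OF \<open>s \<in> S\<close> that]
        by (simp add: p_def distrib_left sum.distrib mult.left_commute[of _ \<tau>] sum_distrib_left[symmetric])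
      then have "(\<Sum>t\<in>S. poly (p s t) \<tau> * c t) = (\<Sum>t\<in>S. (\<Sum>k<K. l s k * (a t k + \<tau> * b t k)) * c t)" by simp
      also have "\<dots> = (\<Sum>t\<in>S. \<Sum>k<K. l s k * (c t * (a t k + \<tau> * b t k)))"
        by (simp add: sum_distrib_left sum_distrib_right mult_ac)
      also have "\<dots> = (\<Sum>k<K. \<Sum>t\<in>S. l s k * (c t * (a t k + \<tau> * b t k)))" by (rule sum.swap)
      also have "\<dots> = (\<Sum>k<K. l s k * (\<Sum>t\<in>S. c t * (a t k + \<tau> * b t k)))" by (simp add: sum_distrib_left)
      also have "\<dots> = 0" using c(1) by simp
      finally show ?thesis .
    qed
    then show "\<exists>c. (\<exists>s\<in>S. c s \<noteq> 0) \<and> (\<forall>s\<in>S. (\<Sum>t\<in>S. poly (p s t) \<tau> * c t) = 0)"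
      using c(2) by blast
  qed
  ultimately show ?thesis by (rule rev_finite_subset)
qed

section \<open>Explicit independent families and their perturbations\<close>

lemma lagrange_poly:
  fixes z :: "'s \<Rightarrow> real"
  assumes "finite S" "inj_on z S" "s \<in> S"
  obtains P where "degree P < card S" "\<And>t. t \<in> S \<Longrightarrow> poly P (z t) = (if s = t then 1 else 0)"
proof -
  define Q where "Q = (\<Prod>t\<in>S - {s}. [: - z t, 1 :])"
  have nz: "poly Q (z s) \<noteq> 0"
    using assms by (auto simp: Q_def poly_prod inj_on_def)
  have "degree Q \<le> (\<Sum>t\<in>S - {s}. degree [: - z t, 1 :])"
    unfolding Q_def by (rule degree_prod_sum_le[unfolded comp_def]) (use assms in auto)
  also have "\<dots> = card (S - {s})" by simp
  also have "\<dots> < card S" using assms by (meson card_Diff1_less)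
  finally have "degree Q < card S" .
  moreover have "poly Q (z t) = 0" if "t \<in> S" "t \<noteq> s" for t
    using that assms by (auto simp: Q_def poly_prod)
  ultimately show ?thesis
    using nz by (intro that[of "smult (inverse (poly Q (z s))) Q"]) auto
qed

lemma poly_altdef_lessThan:
  fixes P :: "real poly"
  assumes "degree P < K"
  shows "poly P x = (\<Sum>k<K. coeff P k * x ^ k)"
proof -
  have "poly P x = (\<Sum>k\<le>degree P. coeff P k * x ^ k)" by (rule poly_altdef)
  also have "\<dots> = (\<Sum>k<K. coeff P k * x ^ k)"
    using assms by (intro sum.mono_neutral_left) (auto simp: coeff_eq_0)
  finally show ?thesis .
qed

text \<open>The dual family consists of the coefficients of the Lagrange basis polynomials, divided
  by the weights. The row weight \<open>F\<close> and the column weight \<open>r\<close> are allowed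
  because the explicit vertices below become powers only after such factors are split off.\<close>

lemma vandermonde_dual:
  fixes z F :: "'s \<Rightarrow> real" and r :: "nat \<Rightarrow> real"
  assumes "finite S" "inj_on z S" "card S \<le> K" "\<And>s. s \<in> S \<Longrightarrow> F s \<noteq> 0" "\<And>k. r k \<noteq> 0"
  obtains l where "\<And>s t. s \<in> S \<Longrightarrow> t \<in> S \<Longrightarrow> (\<Sum>k<K. l s k * (F t * r k * z t ^ k)) = (if s = t then 1 else 0)"
proof -
  have "\<forall>s\<in>S. \<exists>P. degree P < card S \<and> (\<forall>t\<in>S. poly P (z t) = (if s = t then 1 else 0))"
    using lagrange_poly[OF assms(1,2)] by metis
  then obtain P where P: "\<And>s. s \<in> S \<Longrightarrow> degree (P s) < card S"
    "\<And>s t. s \<in> S \<Longrightarrow> t \<in> S \<Longrightarrow> poly (P s) (z t) = (if s = t then 1 else 0)"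
    by metis
  show ?thesis
  proof (rule that[of "\<lambda>s k. coeff (P s) k / (F s * r k)"])
    fix s t assume st: "s \<in> S" "t \<in> S"
    have "(\<Sum>k<K. coeff (P s) k / (F s * r k) * (F t * r k * z t ^ k))
        = (\<Sum>k<K. F t / F s * (coeff (P s) k * z t ^ k))"
      using assms(4,5) st by (intro sum.cong) (auto simp: field_simps)
    also have "\<dots> = F t / F s * poly (P s) (z t)"
      using P(1)[of s] st assms(3) by (subst poly_altdef_lessThan[of _ K]) (auto simp: sum_distrib_left)
    also have "\<dots> = (if s = t then 1 else 0)" using P(2) assms(4) st by auto
    finally show "(\<Sum>k<K. coeff (P s) k / (F s * r k) * (F t * r k * z t ^ k)) = (if s = t then 1 else 0)" .
  qed
qed

text \<open>\<open>V\<close> is first contracted towards \<open>1/2\<close> by the factor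
  \<open>1 - e\<close>. This moves entries by at most \<open>e / 2\<close> and leaves a margin of
  \<open>e / 2\<close> at both ends of the unit interval, into which the term in \<open>W\<close>
  fits when \<tau> is small.\<close>

lemma perturbation_in_unit_interval:
  fixes V W :: "'b \<Rightarrow> nat \<Rightarrow> real"
  assumes "finite B" "\<epsilon> > 0" "\<forall>U\<in>B. \<forall>M<R. V U M \<in> {0..1}"
  shows "\<exists>V' \<delta>. \<delta> > 0 \<and> (\<forall>\<tau> U M. 0 < \<tau> \<longrightarrow> \<tau> < \<delta> \<longrightarrow> U \<in> B \<longrightarrow> M < R \<longrightarrow>
       V' U M + \<tau> * W U M \<in> {0..1} \<and> \<bar>V' U M + \<tau> * W U M - V U M\<bar> \<le> \<epsilon>)"
proof -
  define e where "e = min \<epsilon> 1 / 2"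
  have e: "0 < e" "e \<le> \<epsilon> / 2" "e \<le> 1/2" using assms(2) by (auto simp: e_def min_def)
  define c where "c = (\<Sum>U\<in>B. \<Sum>M<R. \<bar>W U M\<bar>) + 1"
  have c: "\<bar>W U M\<bar> \<le> c" if "U \<in> B" "M < R" for U M
  proof -
    have "\<bar>W U M\<bar> \<le> (\<Sum>M<R. \<bar>W U M\<bar>)" using that by (intro member_le_sum) auto
    also have "\<dots> \<le> (\<Sum>U\<in>B. \<Sum>M<R. \<bar>W U M\<bar>)"
      using that assms(1) by (intro member_le_sum[of U B "\<lambda>U. \<Sum>M<R. \<bar>W U M\<bar>"]) (auto intro: sum_nonneg)
    finally show ?thesis by (simp add: c_def)
  qed
  have c0: "c > 0" unfolding c_def by (smt (verit) sum_nonneg abs_ge_zero)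
  show ?thesis
  proof (rule exI[of _ "\<lambda>U M. (1 - e) * V U M + e / 2"], rule exI[of _ "e / c / 2"], intro conjI allI impI)
    show "e / c / 2 > 0" using e c0 by simp
  next
    fix \<tau> U M assume h: "0 < \<tau>" "\<tau> < e / c / 2" "U \<in> B" "M < R"
    have "\<bar>\<tau> * W U M\<bar> \<le> \<tau> * c" using c[OF h(3,4)] h(1) by (simp add: abs_mult)
    also have "\<dots> \<le> e / c / 2 * c" using h c0 by (intro mult_right_mono) auto
    also have "\<dots> = e / 2" using c0 by simp
    finally have w: "\<bar>\<tau> * W U M\<bar> \<le> e / 2" .
    have V: "0 \<le> V U M" "V U M \<le> 1" using assms(3) h by auto
    then have "0 \<le> e * V U M" "e * V U M \<le> e" "0 \<le> (1 - e) * V U M" "(1 - e) * V U M \<le> 1 - e"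
      using e by (auto simp: mult_left_le)
    moreover have "(1 - e) * V U M = V U M - e * V U M" by (simp add: algebra_simps)
    ultimately show "(1 - e) * V U M + e / 2 + \<tau> * W U M \<in> {0..1}" "\<bar>(1 - e) * V U M + e / 2 + \<tau> * W U M - V U M\<bar> \<le> \<epsilon>"
      using w e unfolding atLeastAtMost_iff abs_le_iff by linarith+
  qed
qed

lemma finite_bad_choose:
  fixes \<delta> :: real
  assumes "\<delta> > 0" "finite F"
  obtains \<tau> where "0 < \<tau>" "\<tau> < \<delta>" "\<tau> \<notin> F"
proof -
  have "infinite {0<..<\<delta>}" using assms by simp
  then have "\<not> {0<..<\<delta>} \<subseteq> F" using finite_subset[OF _ assms(2)] by (rule contrapos_nn)
  then obtain \<tau> where "\<tau> \<in> {0<..<\<delta>}" "\<tau> \<notin> F" by (meson subsetI)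
  then show ?thesis using that[of \<tau>] by simp
qed

text \<open>Along the line \<open>V1 + \<tau> * W\<close> each of the finitely many requirements
  fails for finitely many \<tau> only, so one small \<tau> meets them all. The functional
  \<open>A\<close> covers the three uses: differences of shifted entries, differences from a
  reference vertex, and shifted entries.\<close>

lemma generic_vectors:
  fixes V W :: "'b \<Rightarrow> nat \<Rightarrow> real" and A :: "'i \<Rightarrow> 's \<Rightarrow> nat \<Rightarrow> ('b \<Rightarrow> nat \<Rightarrow> real) \<Rightarrow> real"
  assumes "finite B" "\<epsilon> > 0" "\<forall>U\<in>B. \<forall>M<R. V U M \<in> {0..1}"
    and lin: "\<And>i s k X Y (\<tau> :: real). A i s k (\<lambda>U M. X U M + \<tau> * Y U M) = A i s k X + \<tau> * A i s k Y"
    and finI: "finite I"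
    and finS: "\<And>i. i \<in> I \<Longrightarrow> finite (S i)"
    and dual: "\<And>i. i \<in> I \<Longrightarrow> \<exists>l. \<forall>s\<in>S i. \<forall>t\<in>S i. (\<Sum>k<K. l s k * A i t k W) = (if s = t then 1 else 0)"
  shows "\<exists>V'. (\<forall>U\<in>B. \<forall>M<R. V' U M \<in> {0..1} \<and> \<bar>V' U M - V U M\<bar> \<le> \<epsilon>) \<and>
    (\<forall>i\<in>I. lin_indep (S i) K (\<lambda>s k. A i s k V'))"
proof -
  obtain V1 \<delta> where d: "\<delta> > 0" and V1: "\<forall>\<tau> U M. 0 < \<tau> \<longrightarrow> \<tau> < \<delta> \<longrightarrow> U \<in> B \<longrightarrow> M < R \<longrightarrow>
       V1 U M + \<tau> * W U M \<in> {0..1} \<and> \<bar>V1 U M + \<tau> * W U M - V U M\<bar> \<le> \<epsilon>"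
    using perturbation_in_unit_interval[OF assms(1-3), where W = W] by blast
  have "finite (\<Union>i\<in>I. {\<tau>. \<not> lin_indep (S i) K (\<lambda>s k. A i s k V1 + \<tau> * A i s k W)})"
  proof (intro finite_UN_I finI)
    fix i assume i: "i \<in> I"
    obtain l where l: "\<forall>s\<in>S i. \<forall>t\<in>S i. (\<Sum>k<K. l s k * A i t k W) = (if s = t then 1 else 0)" using dual[OF i] ..
    show "finite {\<tau>. \<not> lin_indep (S i) K (\<lambda>s k. A i s k V1 + \<tau> * A i s k W)}"
      by (rule finite_dependent_parameters[OF finS[OF i], where l = l and b = "\<lambda>t k. A i t k W" and a = "\<lambda>s k. A i s k V1"])
        (rule l[rule_format])
  qed
  then obtain \<tau> where \<tau>: "0 < \<tau>" "\<tau> < \<delta>"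
    "\<tau> \<notin> (\<Union>i\<in>I. {\<tau>. \<not> lin_indep (S i) K (\<lambda>s k. A i s k V1 + \<tau> * A i s k W)})"
    by (rule finite_bad_choose[OF d])
  show ?thesis
  proof (rule exI[of _ "\<lambda>U M. V1 U M + \<tau> * W U M"], rule conjI)
    show "\<forall>U\<in>B. \<forall>M<R. V1 U M + \<tau> * W U M \<in> {0..1} \<and> \<bar>V1 U M + \<tau> * W U M - V U M\<bar> \<le> \<epsilon>"
      using V1 \<tau>(1,2) by blast
    show "\<forall>i\<in>I. lin_indep (S i) K (\<lambda>s k. A i s k (\<lambda>U M. V1 U M + \<tau> * W U M))"
      unfolding lin using \<tau>(3) by blast
  qed
qed


text \<open>For \<open>W U M = z U ^ M\<close> the difference is
  \<open>(1 - z U ^ h) * z U ^ k\<close>, a weighted Vandermonde row. This serves to separate a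
  point from its own iterate: \<open>h\<close> is then the number of coordinates in \<open>p\<close>
  time steps.\<close>

lemma generic_shift_differences:
  fixes V :: "'b \<Rightarrow> nat \<Rightarrow> real"
  assumes "finite B" "\<epsilon> > 0" "\<forall>U\<in>B. \<forall>M<R. V U M \<in> {0..1}" and h: "h > 0"
  shows "\<exists>V'. (\<forall>U\<in>B. \<forall>M<R. V' U M \<in> {0..1} \<and> \<bar>V' U M - V U M\<bar> \<le> \<epsilon>) \<and>
    (\<forall>S\<subseteq>B. card S \<le> K \<longrightarrow> lin_indep S K (\<lambda>U k. V' U k - V' U (k + h)))"
proof -
  obtain idx :: "'b \<Rightarrow> nat" where idx: "inj_on idx B"
    using finite_imp_inj_to_nat_seg[OF assms(1)] by blast
  \<comment> \<open>The offset 2 makes every node larger than 1, so that the weight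
    \<open>1 - z U ^ h\<close> does not vanish.\<close>
  define z where "z U = real (idx U + 2)" for U
  define W where "W U M = z U ^ M" for U and M :: nat
  have d: "\<exists>l. \<forall>s\<in>S. \<forall>t\<in>S. (\<Sum>k<K. l s k * (W t k - W t (k + h))) = (if s = t then 1 else 0)"
    if "S \<in> {S. S \<subseteq> B \<and> card S \<le> K}" for S
  proof -
    have S: "S \<subseteq> B" "card S \<le> K" "finite S" using that finite_subset[OF _ assms(1)] by blast+
    have "z s ^ h > 1" for s by (rule one_less_power) (use h in \<open>auto simp: z_def\<close>)
    then have "1 - z s ^ h \<noteq> 0" for s by (metis eq_iff_diff_eq_0 less_irrefl)
    moreover have "inj_on z S" using idx S by (auto simp: inj_on_def z_def)
    ultimately obtain l where l: "\<And>s t. s \<in> S \<Longrightarrow> t \<in> S \<Longrightarrow>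
        (\<Sum>k<K. l s k * ((1 - z t ^ h) * 1 * z t ^ k)) = (if s = t then 1 else 0)"
      using vandermonde_dual[of S z K "\<lambda>t. 1 - z t ^ h" "\<lambda>_. 1"] S by auto
    have e: "(1 - z t ^ h) * 1 * z t ^ k = W t k - W t (k + h)" for t k
      by (simp add: W_def power_add algebra_simps)
    show ?thesis using l[unfolded e] by (intro exI[of _ l] ballI)
  qed
  have fI: "finite {S. S \<subseteq> B \<and> card S \<le> K}" using assms(1) by auto
  have fS: "finite S" if "S \<in> {S. S \<subseteq> B \<and> card S \<le> K}" for S using that finite_subset[OF _ assms(1)] by blast
  define A where "A = (\<lambda>(_ :: 'b set) U k (V :: 'b \<Rightarrow> nat \<Rightarrow> real). V U k - V U (k + h) :: real)"
  have lin: "A i s k (\<lambda>U M. X U M + \<tau> * Y U M) = A i s k X + \<tau> * A i s k Y" for i s k X Y \<tau>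
    by (simp only: A_def add_diff_add right_diff_distrib)
  have d': "\<exists>l. \<forall>s\<in>i. \<forall>t\<in>i. (\<Sum>k<K. l s k * A i t k W) = (if s = t then 1 else 0)" if "i \<in> {S. S \<subseteq> B \<and> card S \<le> K}" for i
    using d[OF that] unfolding A_def .
  show ?thesis
    using generic_vectors[where W = W and A = A, OF assms(1,2) assms(3) lin fI fS d']
    by (simp only: A_def Ball_def mem_Collect_eq imp_conjL)
qed

text \<open>General affine position: up to \<open>K + 1\<close> vertices are affinely independent in
  dimension \<open>K\<close>. Exponents start at 1, so the missing column is the constant one; in
  the difference of the values of a Lagrange polynomial at \<open>z t\<close> and \<open>z r\<close>
  the constant coefficient cancels, and the other \<open>K\<close> coefficients form the
  dual.\<close>

lemma generic_affine_position:
  fixes V :: "'b \<Rightarrow> nat \<Rightarrow> real"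
  assumes "finite B" "\<epsilon> > 0" "\<forall>U\<in>B. \<forall>M<R. V U M \<in> {0..1}"
  shows "\<exists>V'. (\<forall>U\<in>B. \<forall>M<R. V' U M \<in> {0..1} \<and> \<bar>V' U M - V U M\<bar> \<le> \<epsilon>) \<and>
    (\<forall>S\<subseteq>B. \<forall>r\<in>S. card S \<le> K + 1 \<longrightarrow> lin_indep (S - {r}) K (\<lambda>U k. V' U k - V' r k))"
proof -
  obtain idx :: "'b \<Rightarrow> nat" where idx: "inj_on idx B"
    using finite_imp_inj_to_nat_seg[OF assms(1)] by blast
  define z where "z U = real (idx U)" for U
  define W where "W U M = z U ^ (M + 1)" for U and M :: nat
  define I where "I = {(S, r). S \<subseteq> B \<and> card S \<le> K + 1 \<and> r \<in> S}"
  have d: "\<exists>l. \<forall>s\<in>fst i - {snd i}. \<forall>t\<in>fst i - {snd i}.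
      (\<Sum>k<K. l s k * (W t k - W (snd i) k)) = (if s = t then 1 else 0)"
    if "i \<in> I" for i
  proof -
    obtain S r where i: "i = (S, r)" by fastforce
    have S: "S \<subseteq> B" "card S \<le> K + 1" "finite S" "r \<in> S"
      using that i finite_subset[OF _ assms(1)] unfolding I_def by blast+
    have inj: "inj_on z S" using idx S by (auto simp: inj_on_def z_def)
    have "\<forall>s\<in>S. \<exists>P. degree P < card S \<and> (\<forall>t\<in>S. poly P (z t) = (if s = t then 1 else 0))"
      using lagrange_poly[OF S(3) inj] by metis
    then obtain P where P: "\<And>s. s \<in> S \<Longrightarrow> degree (P s) < card S"
      "\<And>s t. s \<in> S \<Longrightarrow> t \<in> S \<Longrightarrow> poly (P s) (z t) = (if s = t then 1 else 0)"
      by metis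
    show ?thesis unfolding i fst_conv snd_conv
    proof (intro exI[of _ "\<lambda>s k. coeff (P s) (k + 1)"] ballI)
      fix s t assume st: "s \<in> S - {r}" "t \<in> S - {r}"
      have dP: "degree (P s) < Suc K" using P(1)[of s] st S by auto
      have e: "poly (P s) x = coeff (P s) 0 + (\<Sum>k<K. coeff (P s) (k + 1) * x ^ (k + 1))" for x
        unfolding poly_altdef_lessThan[OF dP] by (subst sum.lessThan_Suc_shift) simp
      have "(\<Sum>k<K. coeff (P s) (k + 1) * (W t k - W r k)) = poly (P s) (z t) - poly (P s) (z r)"
        unfolding e by (simp add: W_def sum_subtractf right_diff_distrib)
      then show "(\<Sum>k<K. coeff (P s) (k + 1) * (W t k - W r k)) = (if s = t then 1 else 0)"
        using P(2) st S by auto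
    qed
  qed
  have fI: "finite I"
    by (rule finite_subset[of _ "Pow B \<times> B"]) (use assms(1) in \<open>auto simp: I_def\<close>)
  have fS: "finite (fst i - {snd i})" if "i \<in> I" for i
    using that finite_subset[OF _ assms(1)] unfolding I_def by auto
  define A where "A = (\<lambda>(i :: 'b set \<times> 'b) U k (V :: 'b \<Rightarrow> nat \<Rightarrow> real). V U k - V (snd i) k :: real)"
  have lin: "A i s k (\<lambda>U M. X U M + \<tau> * Y U M) = A i s k X + \<tau> * A i s k Y" for i s k X Y \<tau>
    by (simp only: A_def add_diff_add right_diff_distrib)
  have d': "\<exists>l. \<forall>s\<in>fst i - {snd i}. \<forall>t\<in>fst i - {snd i}. (\<Sum>k<K. l s k * A i t k W) = (if s = t then 1 else 0)" if "i \<in> I" for i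
    using d[OF that] unfolding A_def .
  have "\<exists>V'. (\<forall>U\<in>B. \<forall>M<R. V' U M \<in> {0..1} \<and> \<bar>V' U M - V U M\<bar> \<le> \<epsilon>) \<and>
    (\<forall>i\<in>I. lin_indep (fst i - {snd i}) K (\<lambda>s k. A i s k V'))"
    by (rule generic_vectors[where W = W and A = A, OF assms(1,2) assms(3) lin fI fS d'])
  then obtain V' where V: "(\<forall>U\<in>B. \<forall>M<R. V' U M \<in> {0..1} \<and> \<bar>V' U M - V U M\<bar> \<le> \<epsilon>) \<and>
    (\<forall>i\<in>I. lin_indep (fst i - {snd i}) K (\<lambda>s k. A i s k V'))" by (rule exE)
  have V': "\<And>U M. U \<in> B \<Longrightarrow> M < R \<Longrightarrow> V' U M \<in> {0..1} \<and> \<bar>V' U M - V U M\<bar> \<le> \<epsilon>"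
    "\<And>i. i \<in> I \<Longrightarrow> lin_indep (fst i - {snd i}) K (\<lambda>s k. A i s k V')"
    using V[THEN conjunct1] by simp (rule V[THEN conjunct2, THEN bspec])
  show ?thesis
  proof (rule exI[of _ V'], intro conjI allI ballI impI)
    fix S r assume "S \<subseteq> B" "r \<in> S" "card S \<le> K + 1"
    then have "(S, r) \<in> I" by (simp add: I_def)
    from V'(2)[OF this] show "lin_indep (S - {r}) K (\<lambda>U k. V' U k - V' r k)" unfolding A_def by simp
  qed (use V[THEN conjunct1] in simp_all)
qed

text \<open>Rows are indexed by an offset and a vertex, so the same vertex may occur at several
  offsets. With plain powers as entries, the shifts of one vertex would be proportional; the square
  in the exponent gives every offset its own ratio.\<close>

lemma generic_shifts:
  fixes V :: "'b \<Rightarrow> nat \<Rightarrow> real"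
  assumes "finite B" "\<epsilon> > 0" "\<forall>U\<in>B. \<forall>M<R. V U M \<in> {0..1}" and h: "h > 0"
  shows "\<exists>V'. (\<forall>U\<in>B. \<forall>M<R. V' U M \<in> {0..1} \<and> \<bar>V' U M - V U M\<bar> \<le> \<epsilon>) \<and>
    (\<forall>S\<subseteq>{..<n} \<times> B. card S \<le> K \<longrightarrow> lin_indep S K (\<lambda>s k. V' (snd s) (h * fst s + k)))"
proof -
  obtain idx :: "'b \<Rightarrow> nat" where idx: "inj_on idx B"
    using finite_imp_inj_to_nat_seg[OF assms(1)] by blast
  \<comment> \<open>Expanding the exponent at \<open>h * fst s + k\<close> yields a row weight
    \<open>F s\<close>, a column weight \<open>2 ^ (k\<^sup>2)\<close> and the power
    \<open>z s ^ k\<close>. Up to the factor \<open>2 * h\<close>, the exponent of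
    \<open>z s\<close> is the offset plus \<open>n\<close> times the vertex number; offsets are
    below \<open>n\<close>, so these are digits in base \<open>n\<close> and the nodes are
    distinct.\<close>
  define W where "W U M = (2::real) ^ (M\<^sup>2 + 2 * (h * n) * M * idx U)" for U and M :: nat
  define z where "z s = (2::real) ^ (2 * (h * fst s) + 2 * (h * n) * idx (snd s))" for s
  define F where "F s = (2::real) ^ ((h * fst s)\<^sup>2 + 2 * (h * n) * (h * fst s) * idx (snd s))" for s
  define I where "I = {S. S \<subseteq> {..<n} \<times> B \<and> card S \<le> K}"
  have fI: "finite I"
    by (rule finite_subset[of _ "Pow ({..<n} \<times> B)"]) (use assms(1) in \<open>auto simp: I_def\<close>)
  have fS: "finite S" if "S \<in> I" for S
    using that finite_subset[of S "{..<n} \<times> B"] assms(1) unfolding I_def by blast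
  have W: "W (snd s) (h * fst s + k) = F s * 2 ^ (k\<^sup>2) * z s ^ k" for s k
  proof -
    have "(h * fst s + k)\<^sup>2 + 2 * (h * n) * (h * fst s + k) * idx (snd s)
        = ((h * fst s)\<^sup>2 + 2 * (h * n) * (h * fst s) * idx (snd s)) + k\<^sup>2 + (2 * (h * fst s) + 2 * (h * n) * idx (snd s)) * k"
      by (simp add: power2_eq_square algebra_simps)
    then show ?thesis by (simp only: W_def F_def z_def power_add power_mult)
  qed
  have inj: "inj_on z ({..<n} \<times> B)"
  proof (rule inj_onI)
    fix s t assume st: "s \<in> {..<n} \<times> B" "t \<in> {..<n} \<times> B" and e: "z s = z t"
    obtain a U where s: "s = (a, U)" by fastforce
    obtain b U' where t: "t = (b, U')" by fastforce
    have ab: "a < n" "b < n" "U \<in> B" "U' \<in> B" using st s t by auto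
    have "2 * (h * a) + 2 * (h * n) * idx U = 2 * (h * b) + 2 * (h * n) * idx U'"
      using e unfolding z_def s t fst_conv snd_conv by (subst (asm) power_inject_exp) auto
    then have "h * (a + n * idx U) = h * (b + n * idx U')" by (simp add: distrib_left)
    then have "a + n * idx U = b + n * idx U'"
      using h by simp
    then have "(a + n * idx U) mod n = (b + n * idx U') mod n" "(a + n * idx U) div n = (b + n * idx U') div n"
      by auto
    then have "a = b" "idx U = idx U'" using ab by auto
    then show "s = t" using idx ab s t by (auto dest: inj_onD)
  qed
  have d: "\<exists>l. \<forall>s\<in>S. \<forall>t\<in>S. (\<Sum>k<K. l s k * W (snd t) (h * fst t + k)) = (if s = t then 1 else 0)"
    if "S \<in> I" for S
  proof -
    have S: "inj_on z S" "card S \<le> K" "finite S"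
      using that fS inj_on_subset[OF inj] unfolding I_def by blast+
    obtain l where "\<And>s t. s \<in> S \<Longrightarrow> t \<in> S \<Longrightarrow>
        (\<Sum>k<K. l s k * (F t * 2 ^ (k\<^sup>2) * z t ^ k)) = (if s = t then 1 else 0)"
      by (rule vandermonde_dual[OF S(3) S(1) S(2), of F "\<lambda>k. 2 ^ (k\<^sup>2)"]) (auto simp: F_def)
    then show ?thesis unfolding W by (intro exI[of _ l] ballI)
  qed
  define A where "A = (\<lambda>(_ :: (nat \<times> 'b) set) s k (V :: 'b \<Rightarrow> nat \<Rightarrow> real). V (snd s) (h * fst s + k))"
  have lin: "A i s k (\<lambda>U M. X U M + \<tau> * Y U M) = A i s k X + \<tau> * A i s k Y" for i s k X Y \<tau>
    unfolding A_def by (rule refl)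
  have d': "\<exists>l. \<forall>s\<in>i. \<forall>t\<in>i. (\<Sum>k<K. l s k * A i t k W) = (if s = t then 1 else 0)" if "i \<in> I" for i
    using d[OF that] unfolding A_def .
  show ?thesis
    using generic_vectors[where W = W and A = A, OF assms(1,2) assms(3) lin fI fS d']
    by (simp only: A_def I_def Ball_def mem_Collect_eq imp_conjL)
qed

section \<open>Order of covers and dimension\<close>

lemma cover_ord_le_iff:
  assumes "finite \<beta>"
  shows "cover_ord Y \<beta> \<le> int k - 1 \<longleftrightarrow> (\<forall>x\<in>topspace Y. card {U\<in>\<beta>. x \<in> U} \<le> k)"
proof -
  have "finite ((\<lambda>x. card {U\<in>\<beta>. x \<in> U}) ` topspace Y)"
    by (rule finite_subset[of _ "{..card \<beta>}"]) (auto intro!: card_mono assms)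
  then have "Max (insert 0 ((\<lambda>x. card {U\<in>\<beta>. x \<in> U}) ` topspace Y)) \<le> k
      \<longleftrightarrow> (\<forall>x\<in>topspace Y. card {U\<in>\<beta>. x \<in> U} \<le> k)"
    by (subst Max_le_iff) auto
  then show ?thesis unfolding cover_ord_def by linarith
qed

lemma cover_ord_eq: "\<exists>k. cover_ord Y \<beta> = int k - 1"
  by (auto simp: cover_ord_def)

lemma cover_D_attained:
  assumes "finite_open_cover Y \<alpha>"
  obtains \<beta> where "finite_open_cover Y \<beta>" "finer_cover \<beta> \<alpha>" "cover_ord Y \<beta> = cover_D Y \<alpha>"
    "\<And>\<gamma>. finite_open_cover Y \<gamma> \<Longrightarrow> finer_cover \<gamma> \<alpha> \<Longrightarrow> cover_D Y \<alpha> \<le> cover_ord Y \<gamma>"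
proof -
  let ?P = "\<lambda>\<beta>. finite_open_cover Y \<beta> \<and> finer_cover \<beta> \<alpha>"
  have "?P \<alpha>" using assms by (auto simp: finer_cover_def)
  \<comment> \<open>Orders are at least -1; shifted by 1 they are naturals and have a least
    value.\<close>
  then obtain \<beta> where b: "?P \<beta>" "\<And>\<gamma>. ?P \<gamma> \<Longrightarrow> nat (cover_ord Y \<beta> + 1) \<le> nat (cover_ord Y \<gamma> + 1)"
    using ex_has_least_nat[of ?P \<alpha> "\<lambda>\<beta>. nat (cover_ord Y \<beta> + 1)"] by blast
  have le: "cover_ord Y \<beta> \<le> cover_ord Y \<gamma>" if "?P \<gamma>" for \<gamma>
    using b(2)[OF that] cover_ord_eq[of Y \<gamma>] cover_ord_eq[of Y \<beta>] by auto
  have "cover_D Y \<alpha> = cover_ord Y \<beta>"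
    unfolding cover_D_def by (rule cInf_eq_minimum) (use b le in auto)
  then show ?thesis using that[of \<beta>] b le by auto
qed

text \<open>All later estimates count the members through a point, so the order is traded for a
  multiplicity \<open>k\<close>, which is one larger.\<close>

lemma cover_D_refinement:
  assumes "finite_open_cover Y \<alpha>"
  obtains \<beta> k where "finite_open_cover Y \<beta>" "finer_cover \<beta> \<alpha>" "cover_D Y \<alpha> = int k - 1"
    "\<And>x. x \<in> topspace Y \<Longrightarrow> card {U\<in>\<beta>. x \<in> U} \<le> k"
proof -
  obtain \<beta> where b: "finite_open_cover Y \<beta>" "finer_cover \<beta> \<alpha>" "cover_ord Y \<beta> = cover_D Y \<alpha>"
    using cover_D_attained[OF assms] by blast
  obtain k where "cover_ord Y \<beta> = int k - 1" using cover_ord_eq by blast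
  then show ?thesis
    using that[of \<beta> k] b cover_ord_le_iff[of \<beta> Y k] by (auto simp: finite_open_cover_def)
qed

lemma cover_D_le:
  assumes "finite_open_cover Y \<alpha>" "finite_open_cover Y \<gamma>" "finer_cover \<gamma> \<alpha>"
    "\<And>x. x \<in> topspace Y \<Longrightarrow> card {U\<in>\<gamma>. x \<in> U} \<le> k"
  shows "cover_D Y \<alpha> \<le> int k - 1"
  using cover_D_attained[OF assms(1)] cover_ord_le_iff[of \<gamma> Y k] assms(2-)
  by (metis finite_open_cover_def order_trans)

lemma cover_D_nonneg:
  assumes "finite_open_cover Y \<alpha>" "topspace Y \<noteq> {}"
  shows "cover_D Y \<alpha> \<ge> 0"
proof -
  obtain \<beta> k where b: "finite_open_cover Y \<beta>" "cover_D Y \<alpha> = int k - 1"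
    "\<And>x. x \<in> topspace Y \<Longrightarrow> card {U\<in>\<beta>. x \<in> U} \<le> k"
    using cover_D_refinement[OF assms(1)] by metis
  obtain x where x: "x \<in> topspace Y" using assms(2) by blast
  then have "{U\<in>\<beta>. x \<in> U} \<noteq> {}" "finite {U\<in>\<beta>. x \<in> U}" using b(1) by (auto simp: finite_open_cover_def)
  then have "card {U\<in>\<beta>. x \<in> U} \<noteq> 0" by (metis card_0_eq)
  then show ?thesis using b(2) b(3)[OF x] by linarith
qed

section \<open>Partitions of unity and refinements of joins\<close>

lemma partition_of_unity_cover:
  fixes X :: "'a::metric_space set"
  assumes X: "closed X" and \<beta>: "finite_open_cover (top_of_set X) \<beta>"
  shows "\<exists>\<psi> :: 'a set \<Rightarrow> 'a \<Rightarrow> real. (\<forall>U\<in>\<beta>. continuous_on X (\<psi> U)) \<and>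
     (\<forall>U\<in>\<beta>. \<forall>x\<in>X. 0 \<le> \<psi> U x \<and> (0 < \<psi> U x \<longrightarrow> x \<in> U)) \<and> (\<forall>x\<in>X. (\<Sum>U\<in>\<beta>. \<psi> U x) = 1)"
proof -
  \<comment> \<open>The distance to the empty set is 0 by convention, so the member
    \<open>U = X\<close> has to be given a positive value by hand.\<close>
  define r where "r U x = (if U = X then 1 else infdist x (X - U))" for U x
  have fin: "finite \<beta>" and op: "\<And>U. U \<in> \<beta> \<Longrightarrow> openin (top_of_set X) U" and un: "\<Union>\<beta> = X"
    using \<beta> by (auto simp: finite_open_cover_def)
  have r0: "r U x \<ge> 0" for U x by (simp add: r_def infdist_nonneg)
  have rpos: "0 < r U x \<longleftrightarrow> x \<in> U" if "U \<in> \<beta>" "x \<in> X" for U x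
  proof (cases "U = X")
    case False
    have sub: "U \<subseteq> X" using un that by auto
    have "closed (X - U)"
      using X op[OF that(1)] by (metis closedin_closed_trans closedin_diff closedin_topspace topspace_euclidean_subtopology)
    moreover have "X - U \<noteq> {}" using False sub by auto
    ultimately have "x \<in> X - U \<longleftrightarrow> infdist x (X - U) = 0" by (rule in_closed_iff_infdist_zero)
    then show ?thesis using that False infdist_nonneg[of x "X - U"] by (auto simp: r_def)
  qed (use that in \<open>simp add: r_def\<close>)
  have rc: "continuous_on X (r U)" for U
    unfolding r_def by (cases "U = X") (auto intro!: continuous_intros)
  have s: "(\<Sum>U\<in>\<beta>. r U x) > 0" if x: "x \<in> X" for x
  proof -
    obtain U where U: "U \<in> \<beta>" "x \<in> U" using un x by blast
    have "r U x \<le> (\<Sum>U\<in>\<beta>. r U x)" using U fin r0 by (intro member_le_sum) auto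
    then show ?thesis using rpos[OF U(1) x] U by auto
  qed
  show ?thesis
  proof (intro exI[of _ "\<lambda>U x. r U x / (\<Sum>V\<in>\<beta>. r V x)"] conjI ballI)
    fix U assume U: "U \<in> \<beta>"
    show "continuous_on X (\<lambda>x. r U x / (\<Sum>V\<in>\<beta>. r V x))"
      using s by (intro continuous_intros rc) (metis less_irrefl)
    fix x assume x: "x \<in> X"
    show "0 \<le> r U x / (\<Sum>V\<in>\<beta>. r V x)" using s[OF x] r0 by auto
    show "0 < r U x / (\<Sum>V\<in>\<beta>. r V x) \<longrightarrow> x \<in> U" using s[OF x] rpos[OF U x] by (auto simp: zero_less_divide_iff)
  next
    fix x assume x: "x \<in> X"
    have "(\<Sum>U\<in>\<beta>. r U x / (\<Sum>V\<in>\<beta>. r V x)) = (\<Sum>U\<in>\<beta>. r U x) / (\<Sum>V\<in>\<beta>. r V x)"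
      by (rule sum_divide_distrib[symmetric])
    then show "(\<Sum>U\<in>\<beta>. r U x / (\<Sum>V\<in>\<beta>. r V x)) = 1" using s[OF x] by (metis divide_self less_irrefl)
  qed
qed

text \<open>An overlap is determined by its left end, since the intervals of each subdivision do not
  overlap among themselves. Every left end is the left end of a nondegenerate interval of
  \<open>F\<close> or of \<open>G\<close>, and 0 is one for both; this common breakpoint is the 1
  that is saved.\<close>

lemma card_interval_overlaps:
  fixes F G :: "nat \<Rightarrow> real"
  assumes F: "\<And>i. F i \<le> F (Suc i)" "F 0 = 0" and G: "\<And>j. G j \<le> G (Suc j)" "G 0 = 0"
    and Fa: "F a > 0" and Gb: "G b > 0"
  defines "P \<equiv> {(i, j). i < a \<and> j < b \<and> max (F i) (G j) < min (F (Suc i)) (G (Suc j))}"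
  shows "card P + 1 \<le> card {i. i < a \<and> F i < F (Suc i)} + card {j. j < b \<and> G j < G (Suc j)}"
    and "P \<noteq> {}"
proof -
  have mF: "F i \<le> F j" if "i \<le> j" for i j using lift_Suc_mono_le[of F, OF F(1) that] .
  have mG: "G i \<le> G j" if "i \<le> j" for i j using lift_Suc_mono_le[of G, OF G(1) that] .
  have first: "\<exists>i. i < c \<and> H i = 0 \<and> 0 < H (Suc i)" if H: "H c > 0" "H 0 = 0" "\<And>i. H i \<ge> 0"
    for H :: "nat \<Rightarrow> real" and c
  proof -
    define i where "i = (LEAST i. H i > 0)"
    have "H i > 0" unfolding i_def using H(1) by (rule LeastI)
    moreover have "i \<le> c" unfolding i_def using H(1) by (rule Least_le)
    moreover obtain k where k: "i = Suc k" using \<open>H i > 0\<close> H(2) by (cases i) auto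
    moreover have "\<not> H k > 0" using k not_less_Least[of k "\<lambda>i. H i > 0"] unfolding i_def[symmetric] by auto
    ultimately show ?thesis using H(3)[of k] by (intro exI[of _ k]) auto
  qed
  obtain i0 where i0: "i0 < a" "F i0 = 0" "0 < F (Suc i0)" using first[of F a] Fa F(2) mF[of 0] by auto
  obtain j0 where j0: "j0 < b" "G j0 = 0" "0 < G (Suc j0)" using first[of G b] Gb G(2) mG[of 0] by auto
  have "(i0, j0) \<in> P" using i0 j0 by (auto simp: P_def)
  then show "P \<noteq> {}" by blast
  define I where "I = {i. i < a \<and> F i < F (Suc i)}"
  define J where "J = {j. j < b \<and> G j < G (Suc j)}"
  have inj: "inj_on (\<lambda>(i, j). max (F i) (G j)) P"
  proof (rule inj_onI, clarify)
    fix i j i' j' assume "(i, j) \<in> P" "(i', j') \<in> P" and e: "max (F i) (G j) = max (F i') (G j')"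
    then have *: "F i \<le> max (F i) (G j)" "max (F i) (G j) < F (Suc i)" "F i' \<le> max (F i) (G j)" "max (F i) (G j) < F (Suc i')"
      "G j \<le> max (F i) (G j)" "max (F i) (G j) < G (Suc j)" "G j' \<le> max (F i) (G j)" "max (F i) (G j) < G (Suc j')"
      by (auto simp: P_def)
    have "i = i'"
      using * mF[of "Suc i" i'] mF[of "Suc i'" i] by (cases i i' rule: linorder_cases) auto
    moreover have "j = j'"
      using * mG[of "Suc j" j'] mG[of "Suc j'" j] by (cases j j' rule: linorder_cases) auto
    ultimately show "i = i' \<and> j = j'" by simp
  qed
  have fin: "finite (F ` I)" "finite (G ` J)" "finite I" "finite J" by (auto simp: I_def J_def)
  have "card P = card ((\<lambda>(i, j). max (F i) (G j)) ` P)" using card_image[OF inj] by simp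
  also have "\<dots> \<le> card (F ` I \<union> G ` J)"
    by (rule card_mono) (use fin in \<open>auto simp: P_def I_def J_def max_def\<close>)
  finally have 1: "card P \<le> card (F ` I \<union> G ` J)" .
  have "0 \<in> F ` I \<inter> G ` J" using i0 j0 by (force simp: I_def J_def image_iff)
  then have "card (F ` I \<inter> G ` J) \<noteq> 0" using fin by (metis card_0_eq empty_iff finite_Int)
  moreover have "card (F ` I) + card (G ` J) = card (F ` I \<union> G ` J) + card (F ` I \<inter> G ` J)"
    using card_Un_Int[OF fin(1,2)] .
  moreover have "card (F ` I) \<le> card I" "card (G ` J) \<le> card J" using card_image_le fin by auto
  ultimately show "card P + 1 \<le> card {i. i < a \<and> F i < F (Suc i)} + card {j. j < b \<and> G j < G (Suc j)}"
    using 1 unfolding I_def J_def by linarith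
qed

text \<open>Dimensions add, although multiplicities of joins multiply: partition the unit interval by the
  partial sums of each of the two partitions of unity; the overlaps of the two subdivisions
  give a partition indexed by pairs, with only as many nonempty pieces as there are breakpoints.\<close>

lemma join_cover_multiplicity:
  fixes X :: "'a::metric_space set"
  assumes X: "closed X" and \<beta>: "finite_open_cover (top_of_set X) \<beta>" and \<gamma>: "finite_open_cover (top_of_set X) \<gamma>"
    and p: "\<forall>x\<in>X. card {U\<in>\<beta>. x \<in> U} \<le> p" and q: "\<forall>x\<in>X. card {U\<in>\<gamma>. x \<in> U} \<le> q"
  shows "\<exists>\<delta>. finite_open_cover (top_of_set X) \<delta> \<and> (\<forall>W\<in>\<delta>. \<exists>U\<in>\<beta>. \<exists>V\<in>\<gamma>. W \<subseteq> U \<inter> V) \<and>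
    (\<forall>x\<in>X. card {W\<in>\<delta>. x \<in> W} + 1 \<le> p + q)"
proof -
  have fin: "finite \<beta>" "finite \<gamma>" using \<beta> \<gamma> by (auto simp: finite_open_cover_def)
  obtain \<psi> :: "'a set \<Rightarrow> 'a \<Rightarrow> real" where \<psi>: "\<forall>U\<in>\<beta>. continuous_on X (\<psi> U)"
     "\<forall>U\<in>\<beta>. \<forall>x\<in>X. 0 \<le> \<psi> U x \<and> (0 < \<psi> U x \<longrightarrow> x \<in> U)" "\<forall>x\<in>X. (\<Sum>U\<in>\<beta>. \<psi> U x) = 1"
    using partition_of_unity_cover[OF X \<beta>] by blast
  obtain \<xi> :: "'a set \<Rightarrow> 'a \<Rightarrow> real" where \<xi>: "\<forall>U\<in>\<gamma>. continuous_on X (\<xi> U)"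
     "\<forall>U\<in>\<gamma>. \<forall>x\<in>X. 0 \<le> \<xi> U x \<and> (0 < \<xi> U x \<longrightarrow> x \<in> U)" "\<forall>x\<in>X. (\<Sum>U\<in>\<gamma>. \<xi> U x) = 1"
    using partition_of_unity_cover[OF X \<gamma>] by blast
  obtain e where e: "bij_betw e {..<card \<beta>} \<beta>"
    using ex_bij_betw_nat_finite[OF fin(1)] by (auto simp: atLeast0LessThan)
  obtain e' where e': "bij_betw e' {..<card \<gamma>} \<gamma>"
    using ex_bij_betw_nat_finite[OF fin(2)] by (auto simp: atLeast0LessThan)
  define a where "a = card \<beta>"
  define b where "b = card \<gamma>"
  \<comment> \<open>Beyond index \<open>a\<close> the enumeration \<open>e\<close> need not hit
    \<beta>, where the sign of \<psi> is unknown; the 0 there keeps \<open>F x\<close> monotone on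
    all naturals.\<close>
  define F where "F x i = (\<Sum>k<i. if k < a then \<psi> (e k) x else 0)" for x i
  define G where "G x i = (\<Sum>k<i. if k < b then \<xi> (e' k) x else 0)" for x i
  \<comment> \<open>The overlap of the \<open>i\<close>-th interval of \<open>F x\<close> with the
    \<open>j\<close>-th of \<open>G x\<close>. Their lengths are \<open>\<psi> (e i) x\<close> and
    \<open>\<xi> (e' j) x\<close>, so a nonempty overlap puts \<open>x\<close> into both members,
    and the strict inequality makes the set open.\<close>
  define W where "W i j = {x\<in>X. max (F x i) (G x j) < min (F x (Suc i)) (G x (Suc j))}" for i j
  have ein: "e k \<in> \<beta>" if "k < a" for k using e that by (auto simp: bij_betw_def a_def)
  have ein': "e' k \<in> \<gamma>" if "k < b" for k using e' that by (auto simp: bij_betw_def b_def)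
  have cF: "continuous_on X (\<lambda>x. F x i)" for i
  proof -
    have "continuous_on X (\<lambda>x. if k < a then \<psi> (e k) x else 0)" for k
      using \<psi>(1) ein by (cases "k < a") auto
    then show ?thesis unfolding F_def by (intro continuous_on_sum)
  qed
  have cG: "continuous_on X (\<lambda>x. G x i)" for i
  proof -
    have "continuous_on X (\<lambda>x. if k < b then \<xi> (e' k) x else 0)" for k
      using \<xi>(1) ein' by (cases "k < b") auto
    then show ?thesis unfolding G_def by (intro continuous_on_sum)
  qed
  have oW: "openin (top_of_set X) (W i j)" for i j
  proof -
    have "continuous_on X (\<lambda>x. min (F x (Suc i)) (G x (Suc j)) - max (F x i) (G x j))"
      by (intro continuous_intros cF cG)
    then have "openin (top_of_set X) (X \<inter> (\<lambda>x. min (F x (Suc i)) (G x (Suc j)) - max (F x i) (G x j)) -` {0<..})"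
      by (rule continuous_openin_preimage_gen) simp
    moreover have "X \<inter> (\<lambda>x. min (F x (Suc i)) (G x (Suc j)) - max (F x i) (G x j)) -` {0<..} = W i j"
      by (auto simp: W_def)
    ultimately show ?thesis by simp
  qed
  have Wsub: "W i j \<subseteq> e i \<inter> e' j" if ij: "i < a" "j < b" for i j
  proof
    fix x assume x: "x \<in> W i j"
    then have xX: "x \<in> X" "F x i < F x (Suc i)" "G x j < G x (Suc j)" by (auto simp: W_def)
    then have "\<psi> (e i) x > 0" "\<xi> (e' j) x > 0" using ij by (auto simp: F_def G_def)
    then show "x \<in> e i \<inter> e' j" using \<psi>(2) \<xi>(2) ein ein' ij xX by blast
  qed
  define P where "P x = {(i, j). i < a \<and> j < b \<and> max (F x i) (G x j) < min (F x (Suc i)) (G x (Suc j))}" for x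
  have P: "card (P x) + 1 \<le> p + q \<and> P x \<noteq> {}" if x: "x \<in> X" for x
  proof -
    have Fa: "F x a = 1"
      unfolding F_def using \<psi>(3) x sum.reindex_bij_betw[OF e, of "\<lambda>U. \<psi> U x"] by (simp add: a_def)
    have Gb: "G x b = 1"
      unfolding G_def using \<xi>(3) x sum.reindex_bij_betw[OF e', of "\<lambda>U. \<xi> U x"] by (simp add: b_def)
    have mF: "F x i \<le> F x (Suc i)" for i using \<psi>(2) ein x by (auto simp: F_def)
    have mG: "G x i \<le> G x (Suc i)" for i using \<xi>(2) ein' x by (auto simp: G_def)
    have 0: "F x 0 = 0" "G x 0 = 0" by (auto simp: F_def G_def)
    note L = card_interval_overlaps[of "F x" "G x" a b, OF mF 0(1) mG 0(2)]
    have "card {i. i < a \<and> F x i < F x (Suc i)} = card (e ` {i. i < a \<and> F x i < F x (Suc i)})"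
      using e by (intro card_image[symmetric]) (auto simp: bij_betw_def a_def inj_on_def)
    also have "\<dots> \<le> card {U\<in>\<beta>. x \<in> U}"
      by (rule card_mono) (use fin ein \<psi>(2) x in \<open>auto simp: F_def\<close>)
    finally have 1: "card {i. i < a \<and> F x i < F x (Suc i)} \<le> p" using bspec[OF p x] by simp
    have "card {i. i < b \<and> G x i < G x (Suc i)} = card (e' ` {i. i < b \<and> G x i < G x (Suc i)})"
      using e' by (intro card_image[symmetric]) (auto simp: bij_betw_def b_def inj_on_def)
    also have "\<dots> \<le> card {U\<in>\<gamma>. x \<in> U}"
      by (rule card_mono) (use fin ein' \<xi>(2) x in \<open>auto simp: G_def\<close>)
    finally have 2: "card {i. i < b \<and> G x i < G x (Suc i)} \<le> q" using bspec[OF q x] by simp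
    show ?thesis using L Fa Gb 1 2 unfolding P_def by force
  qed
  define \<delta> where "\<delta> = (\<lambda>(i, j). W i j) ` ({..<a} \<times> {..<b})"
  show ?thesis
  proof (intro exI[of _ \<delta>] conjI ballI)
    have "\<Union>\<delta> = X"
    proof
      show "X \<subseteq> \<Union>\<delta>"
      proof
        fix x assume x: "x \<in> X"
        then obtain i j where "(i, j) \<in> P x" using P by fastforce
        then show "x \<in> \<Union>\<delta>" using x unfolding \<delta>_def P_def W_def by blast
      qed
    qed (auto simp: \<delta>_def W_def)
    then show "finite_open_cover (top_of_set X) \<delta>"
      using oW by (auto simp: finite_open_cover_def \<delta>_def)
    show "\<exists>U\<in>\<beta>. \<exists>V\<in>\<gamma>. w \<subseteq> U \<inter> V" if w: "w \<in> \<delta>" for w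
    proof -
      obtain i j where "i < a" "j < b" "w = W i j" using w by (auto simp: \<delta>_def)
      then show ?thesis using Wsub[of i j] ein[of i] ein'[of j] by blast
    qed
    fix x assume x: "x \<in> X"
    have "finite (P x)" by (rule finite_subset[of _ "{..<a} \<times> {..<b}"]) (auto simp: P_def)
    moreover have "{w\<in>\<delta>. x \<in> w} \<subseteq> (\<lambda>(i, j). W i j) ` P x" by (auto simp: \<delta>_def W_def P_def)
    ultimately have "card {w\<in>\<delta>. x \<in> w} \<le> card (P x)" by (rule surj_card_le)
    then show "card {w\<in>\<delta>. x \<in> w} + 1 \<le> p + q" using P[OF x] by linarith
  qed
qed

section \<open>Mean dimension\<close>

text \<open>Fekete's lemma, with the infimum of the quotients as limit. \<open>mean_dim\<close> is
  defined through \<open>lim\<close>, from which nothing can be concluded without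
  convergence.\<close>

lemma fekete_convergent:
  fixes a :: "nat \<Rightarrow> real"
  assumes sub: "\<And>m n. a (m + n) \<le> a m + a n" and pos: "\<And>n. a n \<ge> 0"
  shows "convergent (\<lambda>n. a n / real n)"
proof -
  define l where "l = (INF n\<in>{1..}. a n / real n)"
  have bdd: "bdd_below ((\<lambda>n. a n / real n) ` {1..})"
    by (rule bdd_belowI[of _ 0]) (use pos in auto)
  have lle: "l \<le> a n / real n" if "n \<ge> 1" for n
    unfolding l_def by (rule cINF_lower[OF bdd]) (use that in auto)
  have mult: "a (q * m) \<le> real q * a m" if "q \<ge> 1" for q m
    using that
  proof (induction q rule: dec_induct)
    case (step q)
    have "a (Suc q * m) \<le> a m + a (q * m)" using sub[of m "q * m"] by simp
    then show ?case using step by (simp add: algebra_simps)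
  qed simp
  have "(\<lambda>n. a n / real n) \<longlonglongrightarrow> l"
  proof (rule LIMSEQ_I)
    fix e :: real assume e: "e > 0"
    have "\<exists>x\<in>(\<lambda>n. a n / real n) ` {1..}. x < l + e / 2"
      by (rule cInf_lessD) (use e in \<open>auto simp: l_def\<close>)
    then obtain m where m: "m \<ge> 1" "a m / real m < l + e / 2" by auto
    define C where "C = (\<Sum>r<m. a r) + a m"
    have C: "a r \<le> C" if "r < m" for r
      using member_le_sum[of r "{..<m}" a] that pos by (auto simp: C_def intro: add_increasing2)
    have C0: "C \<ge> 0" using pos by (auto simp: C_def intro!: add_nonneg_nonneg sum_nonneg)
    obtain N :: nat where N: "real N > 2 * C / e" using reals_Archimedean2 by blast
    have "norm (a n / real n - l) < e" if n: "n \<ge> N + m + 1" for n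
    proof -
      define q where "q = n div m"
      have q: "q \<ge> 1" using n m by (simp add: q_def div_greater_zero_iff Suc_le_eq)
      have nq: "n = q * m + n mod m" by (simp add: q_def)
      have "a n \<le> a (q * m) + a (n mod m)" using sub[of "q * m" "n mod m"] nq by simp
      also have "\<dots> \<le> real q * a m + C" using mult[OF q, of m] C[of "n mod m"] m by (intro add_mono) auto
      also have "real q * a m = real (q * m) * (a m / real m)" using m by simp
      also have "\<dots> \<le> real n * (a m / real m)" using pos[of m] nq by (intro mult_right_mono of_nat_mono divide_nonneg_nonneg) (metis le_add1, auto)
      finally have "a n \<le> real n * (a m / real m) + C" by simp
      then have "a n / real n \<le> a m / real m + C / real n" using n by (simp add: field_simps)
      moreover have "C / real n < e / 2"
      proof -
        have "2 * C < e * real N" using N e by (simp add: field_simps)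
        also have "\<dots> \<le> e * real n" using n e by simp
        finally show ?thesis using n by (simp add: field_simps)
      qed
      ultimately have "a n / real n < l + e" using m by linarith
      moreover have "l \<le> a n / real n" using lle n by simp
      ultimately show ?thesis by simp
    qed
    then show "\<exists>no. \<forall>n\<ge>no. norm (a n / real n - l) < e" by blast
  qed
  then show ?thesis by (auto simp: convergent_def)
qed

section \<open>Joins of covers along orbits\<close>

lemma tds_iterate:
  assumes "tds X T"
  shows "continuous_on X (T ^^ n)" "x \<in> X \<Longrightarrow> (T ^^ n) x \<in> X"
proof -
  have T: "continuous_on X T" "T ` X = X" using assms by (auto simp: tds_def homeomorphism_def)
  show in_X: "x \<in> X \<Longrightarrow> (T ^^ n) x \<in> X" for x n by (induction n) (use T in auto)
  show "continuous_on X (T ^^ n)"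
  proof (induction n)
    case (Suc n)
    have "continuous_on X (T \<circ> (T ^^ n))"
      by (rule continuous_on_compose[OF Suc]) (use T in_X in \<open>auto intro: continuous_on_subset\<close>)
    then show ?case by simp
  qed simp
qed

lemma preimage_finite_open_cover:
  assumes g: "continuous_on X g" "g ` X \<subseteq> X" and \<gamma>: "finite_open_cover (top_of_set X) \<gamma>"
    and q: "\<forall>x\<in>X. card {U\<in>\<gamma>. x \<in> U} \<le> q"
  shows "finite_open_cover (top_of_set X) ((\<lambda>V. X \<inter> g -` V) ` \<gamma>)"
    and "\<forall>x\<in>X. card {W \<in> (\<lambda>V. X \<inter> g -` V) ` \<gamma>. x \<in> W} \<le> q"
proof -
  have fin: "finite \<gamma>" and op: "\<And>U. U \<in> \<gamma> \<Longrightarrow> openin (top_of_set X) U" and un: "\<Union>\<gamma> = X"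
    using \<gamma> by (auto simp: finite_open_cover_def)
  have "openin (top_of_set X) (X \<inter> g -` V)" if "V \<in> \<gamma>" for V
    using continuous_openin_preimage[OF g(1) _ op[OF that]] g(2) by blast
  moreover have "\<Union>((\<lambda>V. X \<inter> g -` V) ` \<gamma>) = X" using g(2) un by blast
  ultimately show "finite_open_cover (top_of_set X) ((\<lambda>V. X \<inter> g -` V) ` \<gamma>)"
    using fin by (auto simp: finite_open_cover_def)
  show "\<forall>x\<in>X. card {W \<in> (\<lambda>V. X \<inter> g -` V) ` \<gamma>. x \<in> W} \<le> q"
  proof
    fix x assume x: "x \<in> X"
    have "card {W \<in> (\<lambda>V. X \<inter> g -` V) ` \<gamma>. x \<in> W} \<le> card {U\<in>\<gamma>. g x \<in> U}"
      by (rule surj_card_le[where f = "\<lambda>V. X \<inter> g -` V"]) (use fin in auto)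
    also have "\<dots> \<le> q" using q g(2) x by blast
    finally show "card {W \<in> (\<lambda>V. X \<inter> g -` V) ` \<gamma>. x \<in> W} \<le> q" .
  qed
qed

lemma iterated_join_finite_open_cover:
  assumes T: "tds X T" and \<alpha>: "finite_open_cover (top_of_set X) \<alpha>"
  shows "finite_open_cover (top_of_set X) (iterated_join X T \<alpha> n)"
proof -
  have fin: "finite \<alpha>" and op: "\<And>U. U \<in> \<alpha> \<Longrightarrow> openin (top_of_set X) U" and un: "\<Union>\<alpha> = X"
    using \<alpha> by (auto simp: finite_open_cover_def)
  have "iterated_join X T \<alpha> n \<subseteq> (\<lambda>U. {x\<in>X. \<forall>i<n. (T ^^ i) x \<in> U i}) ` (PiE {..<n} (\<lambda>_. \<alpha>))"
  proof
    fix W assume "W \<in> iterated_join X T \<alpha> n"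
    then obtain U where U: "W = {x\<in>X. \<forall>i<n. (T ^^ i) x \<in> U i}" "\<forall>i<n. U i \<in> \<alpha>"
      by (auto simp: iterated_join_def)
    then have "W = {x\<in>X. \<forall>i<n. (T ^^ i) x \<in> restrict U {..<n} i}" "restrict U {..<n} \<in> PiE {..<n} (\<lambda>_. \<alpha>)"
      by auto
    then show "W \<in> (\<lambda>U. {x\<in>X. \<forall>i<n. (T ^^ i) x \<in> U i}) ` (PiE {..<n} (\<lambda>_. \<alpha>))" by blast
  qed
  then have 1: "finite (iterated_join X T \<alpha> n)"
    by (rule finite_subset) (intro finite_imageI finite_PiE fin finite_lessThan)
  have 2: "openin (top_of_set X) W" if "W \<in> iterated_join X T \<alpha> n" for W
  proof -
    have "\<exists>U. W = {x\<in>X. \<forall>i<n. (T ^^ i) x \<in> U i} \<and> (\<forall>i<n. U i \<in> \<alpha>)"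
      using that unfolding iterated_join_def by blast
    then obtain U where U: "W = {x\<in>X. \<forall>i<n. (T ^^ i) x \<in> U i}" "\<forall>i<n. U i \<in> \<alpha>" by blast
    have "openin (top_of_set X) {x\<in>X. \<forall>i<k. (T ^^ i) x \<in> U i}" if "k \<le> n" for k
      using that
    proof (induction k)
      case (Suc k)
      have "openin (top_of_set X) (X \<inter> (T ^^ k) -` U k)"
      proof (rule continuous_openin_preimage[OF tds_iterate(1)[OF T, of k]])
        show "(T ^^ k) \<in> X \<rightarrow> X" using tds_iterate(2)[OF T] by blast
        show "openin (top_of_set X) (U k)" using op U(2) Suc.prems by simp
      qed
      moreover have "{x\<in>X. \<forall>i<Suc k. (T ^^ i) x \<in> U i} = {x\<in>X. \<forall>i<k. (T ^^ i) x \<in> U i} \<inter> (X \<inter> (T ^^ k) -` U k)"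
        by (auto simp: less_Suc_eq)
      moreover have "openin (top_of_set X) {x\<in>X. \<forall>i<k. (T ^^ i) x \<in> U i}" using Suc by simp
      ultimately show ?case by (simp add: openin_Int)
    next
      case 0
      then show ?case using openin_topspace[of "top_of_set X"] by simp
    qed
    then show ?thesis using U(1) by blast
  qed
  have 3: "x \<in> \<Union>(iterated_join X T \<alpha> n)" if x: "x \<in> X" for x
  proof -
    have "\<forall>i. \<exists>U\<in>\<alpha>. (T ^^ i) x \<in> U" using tds_iterate(2)[OF T x] un by blast
    then obtain U where "\<And>i. U i \<in> \<alpha>" "\<And>i. (T ^^ i) x \<in> U i" by metis
    then show ?thesis using x unfolding iterated_join_def by blast
  qed
  have "\<Union>(iterated_join X T \<alpha> n) = X" using 3 by (auto simp: iterated_join_def)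
  then show ?thesis using 1 2 by (auto simp: finite_open_cover_def)
qed

text \<open>Optimal refinements of multiplicities \<open>p\<close> and \<open>q\<close>, the second
  pulled back by \<open>T ^^ m\<close>, have a common refinement of multiplicity
  \<open>p + q - 1\<close>. Its order \<open>p + q - 2\<close> is the sum of the orders
  \<open>p - 1\<close> and \<open>q - 1\<close>.\<close>

lemma iterated_join_subadditive:
  assumes T: "tds X T" and X: "X \<noteq> {}" and \<alpha>: "finite_open_cover (top_of_set X) \<alpha>"
  shows "cover_D (top_of_set X) (iterated_join X T \<alpha> (m + n))
    \<le> cover_D (top_of_set X) (iterated_join X T \<alpha> m) + cover_D (top_of_set X) (iterated_join X T \<alpha> n)"
proof -
  have cl: "closed X" using T by (auto simp: tds_def compact_imp_closed)
  note ij = iterated_join_finite_open_cover[OF T \<alpha>]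
  obtain \<beta> p where \<beta>: "finite_open_cover (top_of_set X) \<beta>" "finer_cover \<beta> (iterated_join X T \<alpha> m)"
    "cover_D (top_of_set X) (iterated_join X T \<alpha> m) = int p - 1" and p: "\<And>x. x \<in> X \<Longrightarrow> card {U\<in>\<beta>. x \<in> U} \<le> p"
    by (rule cover_D_refinement[OF ij[of m], unfolded topspace_euclidean_subtopology], rule that)
  obtain \<gamma> q where \<gamma>: "finite_open_cover (top_of_set X) \<gamma>" "finer_cover \<gamma> (iterated_join X T \<alpha> n)"
    "cover_D (top_of_set X) (iterated_join X T \<alpha> n) = int q - 1" and q: "\<And>x. x \<in> X \<Longrightarrow> card {U\<in>\<gamma>. x \<in> U} \<le> q"
    by (rule cover_D_refinement[OF ij[of n], unfolded topspace_euclidean_subtopology], rule that)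
  have g: "continuous_on X (T ^^ m)" "(T ^^ m) ` X \<subseteq> X" using tds_iterate[OF T] by auto
  define \<gamma>' where "\<gamma>' = (\<lambda>V. X \<inter> (T ^^ m) -` V) ` \<gamma>"
  note pre = preimage_finite_open_cover[OF g \<gamma>(1) ballI[OF q], folded \<gamma>'_def]
  have "\<exists>\<delta>. finite_open_cover (top_of_set X) \<delta> \<and> (\<forall>W\<in>\<delta>. \<exists>U\<in>\<beta>. \<exists>V\<in>\<gamma>'. W \<subseteq> U \<inter> V) \<and>
    (\<forall>x\<in>X. card {W\<in>\<delta>. x \<in> W} + 1 \<le> p + q)"
    by (rule join_cover_multiplicity[OF cl \<beta>(1) pre(1) ballI[OF p] pre(2)])
  then obtain \<delta> where \<delta>: "finite_open_cover (top_of_set X) \<delta>" "\<forall>W\<in>\<delta>. \<exists>U\<in>\<beta>. \<exists>V\<in>\<gamma>'. W \<subseteq> U \<inter> V"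
    "\<forall>x\<in>X. card {W\<in>\<delta>. x \<in> W} + 1 \<le> p + q"
    by auto
  have "finer_cover \<delta> (iterated_join X T \<alpha> (m + n))"
    unfolding finer_cover_def
  proof
    fix W assume "W \<in> \<delta>"
    then obtain U V' where UV': "U \<in> \<beta>" "V' \<in> \<gamma>'" "W \<subseteq> U \<inter> V'" using \<delta>(2) by blast
    then obtain V where V: "V \<in> \<gamma>" "V' = X \<inter> (T ^^ m) -` V" by (auto simp: \<gamma>'_def)
    have UV: "U \<in> \<beta>" "V \<in> \<gamma>" "W \<subseteq> U" "W \<subseteq> X \<inter> (T ^^ m) -` V" using UV' V by auto
    obtain A' where A': "A' \<in> iterated_join X T \<alpha> m" "U \<subseteq> A'"
      using \<beta>(2) UV(1) unfolding finer_cover_def by blast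
    obtain A where A: "\<forall>i<m. A i \<in> \<alpha>" "A' = {x\<in>X. \<forall>i<m. (T ^^ i) x \<in> A i}"
      using A'(1) by (auto simp: iterated_join_def)
    obtain B' where B': "B' \<in> iterated_join X T \<alpha> n" "V \<subseteq> B'"
      using \<gamma>(2) UV(2) unfolding finer_cover_def by blast
    obtain B where B: "\<forall>i<n. B i \<in> \<alpha>" "B' = {x\<in>X. \<forall>i<n. (T ^^ i) x \<in> B i}"
      using B'(1) by (auto simp: iterated_join_def)
    define C where "C i = (if i < m then A i else B (i - m))" for i
    have "\<forall>i<m + n. C i \<in> \<alpha>" using A(1) B(1) by (auto simp: C_def)
    moreover have "W \<subseteq> {x\<in>X. \<forall>i<m + n. (T ^^ i) x \<in> C i}"
    proof (intro subsetI CollectI conjI allI impI)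
      fix x i assume x: "x \<in> W" and i: "i < m + n"
      show "(T ^^ i) x \<in> C i"
      proof (cases "i < m")
        case True
        then show ?thesis using x UV(3) A'(2) A(2) by (auto simp: C_def)
      next
        case False
        then have "(T ^^ i) x = (T ^^ (i - m)) ((T ^^ m) x)" by (metis comp_apply funpow_add le_add_diff_inverse2 not_less)
        moreover have "(T ^^ m) x \<in> V" "i - m < n" using x UV(4) False i by auto
        ultimately show ?thesis using B'(2) B(2) False by (auto simp: C_def)
      qed
    qed (use UV(4) in auto)
    moreover have "{x\<in>X. \<forall>i<m + n. (T ^^ i) x \<in> C i} \<in> iterated_join X T \<alpha> (m + n)"
      using \<open>\<forall>i<m + n. C i \<in> \<alpha>\<close> unfolding iterated_join_def by (intro CollectI exI[of _ C] conjI refl)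
    ultimately show "\<exists>U\<in>iterated_join X T \<alpha> (m + n). W \<subseteq> U" by blast
  qed
  moreover have "\<And>x. x \<in> X \<Longrightarrow> card {W\<in>\<delta>. x \<in> W} \<le> p + q - 1" using \<delta>(3) by fastforce
  ultimately have "cover_D (top_of_set X) (iterated_join X T \<alpha> (m + n)) \<le> int (p + q - 1) - 1"
    using cover_D_le[OF ij \<delta>(1)] by simp
  \<comment> \<open>This guards the natural subtraction. Over the empty space all three values would
    be -1 and subadditivity would fail.\<close>
  moreover have "p + q \<ge> 1" using X \<delta>(3) by fastforce
  ultimately show ?thesis using \<beta>(3) \<gamma>(3) by linarith
qed

text \<open>The slope \<rho> is strictly below \<open>c\<close>, halfway from the limit. The linear
  gap between the two slopes later absorbs the additive 1 and the bounded excess of block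
  lengths.\<close>

lemma mean_dim_less_cover:
  assumes T: "tds X T" and X: "X \<noteq> {}" and c: "mean_dim X T < ereal c"
    and \<alpha>: "finite_open_cover (top_of_set X) \<alpha>"
  shows "\<exists>\<rho><c. \<forall>\<^sub>F n in sequentially. \<exists>\<beta>. finite_open_cover (top_of_set X) \<beta> \<and>
    finer_cover \<beta> (iterated_join X T \<alpha> n) \<and> (\<forall>x\<in>X. real (card {U\<in>\<beta>. x \<in> U}) \<le> \<rho> * real n + 1)"
proof -
  define a where "a n = real_of_int (cover_D (top_of_set X) (iterated_join X T \<alpha> n))" for n
  note ij = iterated_join_finite_open_cover[OF T \<alpha>]
  have "convergent (\<lambda>n. a n / real n)"
  proof (rule fekete_convergent)
    show "a (m + n) \<le> a m + a n" for m n
      using iterated_join_subadditive[OF T X \<alpha>, of m n] unfolding a_def by linarith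
    show "a n \<ge> 0" for n
      using cover_D_nonneg[OF ij[of n]] X unfolding a_def by simp
  qed
  then have lim: "(\<lambda>n. a n / real n) \<longlonglongrightarrow> lim (\<lambda>n. a n / real n)" by (simp add: convergent_LIMSEQ_iff)
  have "ereal (lim (\<lambda>n. a n / real n)) \<le> mean_dim X T"
    unfolding mean_dim_def a_def by (rule SUP_upper) (use \<alpha> in simp)
  then have l: "lim (\<lambda>n. a n / real n) < c" using c by (metis ereal_less_eq(3) le_less_trans not_le)
  define \<rho> where "\<rho> = (lim (\<lambda>n. a n / real n) + c) / 2"
  have "\<forall>\<^sub>F n in sequentially. a n / real n < \<rho>" using lim l by (intro order_tendstoD) (auto simp: \<rho>_def)
  then have "\<forall>\<^sub>F n in sequentially. \<exists>\<beta>. finite_open_cover (top_of_set X) \<beta> \<and>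
    finer_cover \<beta> (iterated_join X T \<alpha> n) \<and> (\<forall>x\<in>X. real (card {U\<in>\<beta>. x \<in> U}) \<le> \<rho> * real n + 1)"
    using eventually_gt_at_top[of 0]
  proof eventually_elim
    case (elim n)
    obtain \<beta> k where \<beta>: "finite_open_cover (top_of_set X) \<beta>" "finer_cover \<beta> (iterated_join X T \<alpha> n)"
      "cover_D (top_of_set X) (iterated_join X T \<alpha> n) = int k - 1" "\<And>x. x \<in> X \<Longrightarrow> card {U\<in>\<beta>. x \<in> U} \<le> k"
      by (rule cover_D_refinement[OF ij[of n], unfolded topspace_euclidean_subtopology], rule that)
    have k: "real k - 1 < \<rho> * real n" using elim \<beta>(3) by (simp add: a_def field_simps)
    have "real (card {U\<in>\<beta>. x \<in> U}) \<le> \<rho> * real n + 1" if "x \<in> X" for x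
    proof -
      have "real (card {U\<in>\<beta>. x \<in> U}) \<le> real k" using \<beta>(4)[OF that] by simp
      then show ?thesis using k by linarith
    qed
    then show ?case using \<beta>(1,2) by (intro exI[of _ \<beta>] conjI ballI)
  qed
  moreover have "\<rho> < c" using l by (simp add: \<rho>_def)
  ultimately show ?thesis by (intro exI[of _ \<rho>] conjI)
qed

section \<open>Orbit maps and Baire category\<close>

lemma iter_int_0: "iter_int X T 0 x = x"
  by (simp add: iter_int_def)

lemma iter_int_nat: "iter_int X T (int n) = T ^^ n"
  by (simp add: iter_int_def)

context
  fixes X :: "'a::metric_space set" and T :: "'a \<Rightarrow> 'a"
  assumes T: "tds X T"
begin

lemma tds_bij: "bij_betw T X X"
  using T by (auto simp: tds_def homeomorphism_def bij_betw_def intro: inj_on_inverseI)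

lemma tds_inv_into:
  assumes "x \<in> X"
  shows "inv_into X T x \<in> X" "T (inv_into X T x) = x" "inv_into X T (T x) = x" "T x \<in> X"
  using tds_bij assms by (auto simp: bij_betw_def inv_into_into f_inv_into_f)

lemma inv_into_funpow_in: "x \<in> X \<Longrightarrow> (inv_into X T ^^ n) x \<in> X"
  by (induction n) (auto simp: tds_inv_into)

lemma iter_int_in: "x \<in> X \<Longrightarrow> iter_int X T k x \<in> X"
  by (simp add: iter_int_def tds_iterate[OF T] inv_into_funpow_in)

lemma iter_int_Suc:
  assumes "x \<in> X"
  shows "iter_int X T (k + 1) x = T (iter_int X T k x)"
proof (cases "k \<ge> 0")
  case True
  then have "nat (k + 1) = Suc (nat k)" by simp
  then show ?thesis using True by (simp add: iter_int_def)
next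
  case False
  then obtain n where n: "k = - int (Suc n)" by (metis int_cases not_le of_nat_0_le_iff)
  have "T (iter_int X T k x) = (inv_into X T ^^ n) x"
    using n tds_inv_into(2)[OF inv_into_funpow_in[OF assms]] by (simp add: iter_int_def nat_add_distrib)
  moreover have "iter_int X T (k + 1) x = (inv_into X T ^^ n) x"
    using n by (cases n) (auto simp: iter_int_def nat_add_distrib)
  ultimately show ?thesis by simp
qed

lemma iter_int_add:
  assumes x: "x \<in> X"
  shows "iter_int X T (j + k) x = iter_int X T j (iter_int X T k x)"
proof (induction j rule: int_induct[of _ 0])
  case base
  then show ?case by (simp add: iter_int_0)
next
  case (step1 i)
  have "iter_int X T (i + 1 + k) x = T (iter_int X T (i + k) x)"
    using iter_int_Suc[OF x, of "i + k"] by (simp add: ac_simps)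
  also have "\<dots> = T (iter_int X T i (iter_int X T k x))" using step1 by simp
  also have "\<dots> = iter_int X T (i + 1) (iter_int X T k x)"
    using iter_int_Suc[OF iter_int_in[OF x]] by simp
  finally show ?case .
next
  case (step2 i)
  have "T (iter_int X T (i - 1 + k) x) = iter_int X T (i + k) x"
    using iter_int_Suc[OF x, of "i - 1 + k"] by (simp add: ac_simps)
  also have "\<dots> = T (iter_int X T (i - 1) (iter_int X T k x))"
    using step2 iter_int_Suc[OF iter_int_in[OF x, of k], of "i - 1"] by simp
  finally have "T (iter_int X T (i - 1 + k) x) = T (iter_int X T (i - 1) (iter_int X T k x))" .
  then show ?case
    using tds_bij iter_int_in[OF x] iter_int_in[OF iter_int_in[OF x]] by (auto simp: bij_betw_def dest: inj_onD)
qed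

lemma continuous_on_iter_int: "continuous_on X (iter_int X T k)"
proof -
  obtain S where S: "homeomorphism X X T S" using T by (auto simp: tds_def)
  have "tds X S" using T S by (auto simp: tds_def dest: homeomorphism_symD)
  \<comment> \<open>Nothing is known about \<open>inv_into X T\<close> off \<open>X\<close>;
    continuity on \<open>X\<close> is transferred from a true inverse \<open>S\<close> by agreement
    on \<open>X\<close>.\<close>
  have Sx: "S x = inv_into X T x" if "x \<in> X" for x
    using S that tds_bij by (metis bij_betw_def homeomorphism_def imageI inv_into_f_f)
  have "(S ^^ n) x = (inv_into X T ^^ n) x \<and> (S ^^ n) x \<in> X" if "x \<in> X" for n x
    by (induction n) (use that Sx tds_inv_into in auto)
  then have "continuous_on X (inv_into X T ^^ n)" for n
    using continuous_on_cong[of X X "S ^^ n" "inv_into X T ^^ n"] tds_iterate(1)[OF \<open>tds X S\<close>] by auto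
  then show ?thesis using tds_iterate(1)[OF T] by (simp add: iter_int_def)
qed

end

section \<open>Baire category in the space of maps to the cube\<close>

lemma mspace_cube_maps:
  fixes f :: "'a::metric_space \<Rightarrow> real ^ 'd"
  assumes "compact X"
  shows "f \<in> mspace (cube_maps X) \<longleftrightarrow> f \<in> extensional X \<and> continuous_on X f \<and> f ` X \<subseteq> unit_cube"
proof -
  have mt: "mtopology_of (submetric euclidean_metric (unit_cube :: (real ^ 'd) set)) = top_of_set unit_cube"
    by (simp add: mtopology_of_submetric)
  have "compact (f ` X)" if "continuous_on X f" using that assms by (rule compact_continuous_image)
  then have b: "bounded (f ` X)" if "continuous_on X f" using that compact_imp_bounded by blast
  show ?thesis
  proof
    assume "f \<in> mspace (cube_maps X)"
    then show "f \<in> extensional X \<and> continuous_on X f \<and> f ` X \<subseteq> unit_cube"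
      unfolding cube_maps_def mspace_cfunspace mt by (auto simp: continuous_map_in_subtopology)
  next
    assume f: "f \<in> extensional X \<and> continuous_on X f \<and> f ` X \<subseteq> unit_cube"
    interpret M: Metric_space "unit_cube :: (real ^ 'd) set" dist by (simp add: Met_TC.subspace)
    have "M.mbounded (f ` X)"
    proof (cases "X = {}")
      case False
      then obtain x where x: "x \<in> X" by blast
      obtain c where "\<forall>y\<in>f ` X. dist (f x) y \<le> c" using b f bounded_any_center[of "f ` X" "f x"] by auto
      then have "f ` X \<subseteq> M.mcball (f x) c" using f x by (auto simp: image_subset_iff)
      then show ?thesis unfolding M.mbounded_def by blast
    qed simp
    then show "f \<in> mspace (cube_maps X)"
      unfolding cube_maps_def mspace_cfunspace mt using f by (auto simp: continuous_map_in_subtopology)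
  qed
qed

lemma mdist_cube_maps_le:
  fixes f g :: "'a::metric_space \<Rightarrow> real ^ 'd"
  assumes "X \<noteq> {}" "f \<in> mspace (cube_maps X)" "g \<in> mspace (cube_maps X)"
  shows "mdist (cube_maps X) f g \<le> e \<longleftrightarrow> (\<forall>x\<in>X. dist (f x) (g x) \<le> e)"
proof -
  have "f \<in> mspace (funspace X (submetric euclidean_metric unit_cube))"
    "g \<in> mspace (funspace X (submetric euclidean_metric unit_cube))"
    using assms by (auto simp: cube_maps_def cfunspace_def)
  from funspace_mdist_le[OF this assms(1), of e] show ?thesis
    by (simp add: cube_maps_def cfunspace_def)
qed

lemma nowhere_dense_in_cube_maps:
  fixes B :: "('a::metric_space \<Rightarrow> real ^ 'd) set"
  assumes X: "X \<noteq> {}" and B: "B \<subseteq> mspace (cube_maps X)"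
    and cl: "\<forall>f\<in>mspace (cube_maps X) - B. \<exists>e>0. \<forall>g\<in>mspace (cube_maps X). (\<forall>x\<in>X. dist (f x) (g x) \<le> e) \<longrightarrow> g \<notin> B"
    and de: "\<forall>f\<in>mspace (cube_maps X). \<forall>e>0. \<exists>g\<in>mspace (cube_maps X) - B. \<forall>x\<in>X. dist (f x) (g x) \<le> e"
  shows "nowhere_dense_in (mtopology_of (cube_maps X)) B"
proof -
  interpret M: Metric_space "mspace (cube_maps X :: ('a \<Rightarrow> real ^ 'd) metric)" "mdist (cube_maps X)"
    by simp
  have top: "mtopology_of (cube_maps X :: ('a \<Rightarrow> real ^ 'd) metric) = M.mtopology"
    by (simp add: mtopology_of_def)
  have "openin M.mtopology (mspace (cube_maps X) - B)"
    unfolding M.openin_mtopology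
  proof (intro conjI allI impI)
    fix f assume f: "f \<in> mspace (cube_maps X) - B"
    then obtain e where e: "e > 0" "\<forall>g\<in>mspace (cube_maps X). (\<forall>x\<in>X. dist (f x) (g x) \<le> e) \<longrightarrow> g \<notin> B"
      using cl by blast
    have "M.mball f e \<subseteq> mspace (cube_maps X) - B"
    proof
      fix g assume g: "g \<in> M.mball f e"
      then have "mdist (cube_maps X) f g \<le> e" "g \<in> mspace (cube_maps X)" by auto
      then show "g \<in> mspace (cube_maps X) - B"
        using e(2) mdist_cube_maps_le[OF X, of f g e] f by auto
    qed
    then show "\<exists>r>0. M.mball f r \<subseteq> mspace (cube_maps X) - B" using e(1) by blast
  qed auto
  then have "closedin M.mtopology B" using B by (simp add: closedin_def)
  then have 1: "M.mtopology closure_of B = B" by (simp add: closure_of_closedin)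
  have "M.mtopology interior_of B = {}"
  proof (rule ccontr)
    assume "M.mtopology interior_of B \<noteq> {}"
    then obtain f where f: "f \<in> M.mtopology interior_of B" by blast
    have "openin M.mtopology (M.mtopology interior_of B)" by simp
    then obtain r where r: "r > 0" "M.mball f r \<subseteq> M.mtopology interior_of B"
      using f unfolding M.openin_mtopology by blast
    have fM: "f \<in> mspace (cube_maps X)" using f B interior_of_subset[of M.mtopology B] by blast
    obtain g where g: "g \<in> mspace (cube_maps X) - B" "\<forall>x\<in>X. dist (f x) (g x) \<le> r / 2"
      using de fM r(1) by (meson half_gt_zero)
    have "mdist (cube_maps X) f g \<le> r / 2" using mdist_cube_maps_le[OF X fM, of g "r / 2"] g by blast
    then have "g \<in> M.mball f r" using r fM g by auto
    then show False using r(2) interior_of_subset[of M.mtopology B] g(1) by blast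
  qed
  then show ?thesis using B 1 by (simp add: nowhere_dense_in_def top)
qed

lemma nowhere_dense_in_subset:
  assumes "nowhere_dense_in Y A" "B \<subseteq> A"
  shows "nowhere_dense_in Y B"
proof -
  have "Y interior_of (Y closure_of B) \<subseteq> Y interior_of (Y closure_of A)"
    using assms(2) by (intro interior_of_mono closure_of_mono)
  then show ?thesis using assms by (auto simp: nowhere_dense_in_def)
qed

definition separates_pairs :: "'a set \<Rightarrow> ('a \<Rightarrow> 'a) \<Rightarrow> ('a \<times> 'a) set \<Rightarrow> ('a \<Rightarrow> 'b) \<Rightarrow> bool" where
  "separates_pairs X T K f \<longleftrightarrow> (\<forall>(x, y)\<in>K. orbit_map X T f x \<noteq> orbit_map X T f y)"

text \<open>The \<open>itself\<close> argument carries the type \<open>'d\<close>, which would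
  otherwise not occur among the parameters. The map \<open>g\<close> is not normalised outside
  \<open>X\<close>, and closeness is coordinatewise, which suits the constructions; both are
  converted to the metric of \<open>cube_maps\<close> in one place.\<close>

definition densely_separable :: "'d::finite itself \<Rightarrow> 'a::metric_space set \<Rightarrow> ('a \<Rightarrow> 'a) \<Rightarrow> ('a \<times> 'a) set \<Rightarrow> bool" where
  "densely_separable _ X T K \<longleftrightarrow> K \<subseteq> X \<times> X \<and> compact K \<and>
     (\<forall>f :: 'a \<Rightarrow> real ^ 'd. \<forall>e>0. continuous_on X f \<longrightarrow> f ` X \<subseteq> unit_cube \<longrightarrow>
       (\<exists>g. continuous_on X g \<and> g ` X \<subseteq> unit_cube \<and> (\<forall>x\<in>X. \<forall>i. \<bar>g x $ i - f x $ i\<bar> \<le> e) \<and> separates_pairs X T K g))"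

text \<open>Closedness is a limit argument: if maps tending uniformly to \<open>f\<close> fail to
  separate some pairs in \<open>K\<close>, a subsequence of the pairs converges in the compact set
  \<open>K\<close>, and \<open>f\<close> has equal orbits at the limit pair. Density of the
  complement is the defining property of \<open>densely_separable\<close>.\<close>

lemma non_separating_nowhere_dense:
  fixes X :: "'a::metric_space set"
  assumes T: "tds X T" and X: "X \<noteq> {}" and K: "densely_separable TYPE('d::finite) X T K"
  shows "nowhere_dense_in (mtopology_of (cube_maps X))
    {f \<in> mspace (cube_maps X :: ('a \<Rightarrow> real ^ 'd) metric). \<not> separates_pairs X T K f}"
proof (rule nowhere_dense_in_cube_maps[OF X])
  have cX: "compact X" using T by (simp add: tds_def)
  have Ksub: "K \<subseteq> X \<times> X" and cK: "compact K" using K by (auto simp: densely_separable_def)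
  let ?M = "mspace (cube_maps X :: ('a \<Rightarrow> real ^ 'd) metric)"
  let ?B = "{f \<in> ?M. \<not> separates_pairs X T K f}"
  show "?B \<subseteq> ?M" by blast
  show "\<forall>f\<in>?M - ?B. \<exists>e>0. \<forall>g\<in>?M. (\<forall>x\<in>X. dist (f x) (g x) \<le> e) \<longrightarrow> g \<notin> ?B"
  proof (rule ballI, rule ccontr)
    fix f assume f: "f \<in> ?M - ?B"
    assume neg: "\<not> (\<exists>e>0. \<forall>g\<in>?M. (\<forall>x\<in>X. dist (f x) (g x) \<le> e) \<longrightarrow> g \<notin> ?B)"
    have fc: "continuous_on X f" using f mspace_cube_maps[OF cX] by blast
    have "\<exists>p g. p \<in> K \<and> (\<forall>x\<in>X. dist (f x) (g x) \<le> inverse (real (Suc n))) \<and> orbit_map X T g (fst p) = orbit_map X T g (snd p)" for n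
    proof -
      have "inverse (real (Suc n)) > 0" by simp
      then obtain g where "g \<in> ?B" "\<forall>x\<in>X. dist (f x) (g x) \<le> inverse (real (Suc n))" using neg by blast
      then show ?thesis unfolding separates_pairs_def by fastforce
    qed
    then obtain p g where p: "\<And>n. p n \<in> K" and g: "\<And>n. \<forall>x\<in>X. dist (f x) (g n x) \<le> inverse (real (Suc n))"
      and eq: "\<And>n. orbit_map X T (g n) (fst (p n)) = orbit_map X T (g n) (snd (p n))" by metis
    obtain q r where q: "q \<in> K" "strict_mono r" "(p \<circ> r) \<longlonglongrightarrow> q"
      using cK p unfolding compact_def by meson
    have "f (iter_int X T k (fst q)) = f (iter_int X T k (snd q))" for k
    proof -
      define h where "h = (\<lambda>z. f (iter_int X T k z))"
      have hc: "continuous_on X h" unfolding h_def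
        by (rule continuous_on_compose2[OF fc continuous_on_iter_int[OF T]]) (use iter_int_in[OF T] in auto)
      have inX: "fst (p n) \<in> X" "snd (p n) \<in> X" for n using p[of n] Ksub by auto
      have qX: "fst q \<in> X" "snd q \<in> X" using q(1) Ksub by auto
      have l1: "(\<lambda>n. h (fst (p (r n)))) \<longlonglongrightarrow> h (fst q)"
        by (rule continuous_on_tendsto_compose[OF hc]) (use q(3) inX qX in \<open>auto simp: o_def intro!: tendsto_fst always_eventually\<close>)
      have l2: "(\<lambda>n. h (snd (p (r n)))) \<longlonglongrightarrow> h (snd q)"
        by (rule continuous_on_tendsto_compose[OF hc]) (use q(3) inX qX in \<open>auto simp: o_def intro!: tendsto_snd always_eventually\<close>)
      have "dist (h (fst (p (r n)))) (h (snd (p (r n)))) \<le> 2 * inverse (real (Suc (r n)))" for n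
      proof -
        have "dist (h (fst (p (r n)))) (g (r n) (iter_int X T k (fst (p (r n))))) \<le> inverse (real (Suc (r n)))"
          unfolding h_def using g[of "r n"] iter_int_in[OF T inX(1)] by blast
        moreover have "dist (h (snd (p (r n)))) (g (r n) (iter_int X T k (snd (p (r n))))) \<le> inverse (real (Suc (r n)))"
          unfolding h_def using g[of "r n"] iter_int_in[OF T inX(2)] by blast
        moreover have "g (r n) (iter_int X T k (fst (p (r n)))) = g (r n) (iter_int X T k (snd (p (r n))))"
          using fun_cong[OF eq[of "r n"], of k] by (simp add: orbit_map_def)
        ultimately show ?thesis
          using dist_triangle2[of "h (fst (p (r n)))" "h (snd (p (r n)))" "g (r n) (iter_int X T k (snd (p (r n))))"] by simp
      qed
      moreover have "(\<lambda>n. 2 * inverse (real (Suc (r n)))) \<longlonglongrightarrow> 2 * 0"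
        using LIMSEQ_subseq_LIMSEQ[OF LIMSEQ_inverse_real_of_nat q(2)] by (intro tendsto_mult_left) (simp add: o_def)
      ultimately have "dist (h (fst q)) (h (snd q)) \<le> 2 * 0"
        by (intro LIMSEQ_le[OF tendsto_dist[OF l1 l2]] exI allI impI)
      then show ?thesis by (simp add: h_def)
    qed
    then have "orbit_map X T f (fst q) = orbit_map X T f (snd q)" by (simp add: orbit_map_def)
    then have "\<not> separates_pairs X T K f" using q(1) by (auto simp: separates_pairs_def split_beta)
    then show False using f by blast
  qed
  show "\<forall>f\<in>?M. \<forall>e>0. \<exists>g\<in>?M - ?B. \<forall>x\<in>X. dist (f x) (g x) \<le> e"
  proof (intro ballI allI impI)
    fix f :: "'a \<Rightarrow> real ^ 'd" and e :: real assume f: "f \<in> ?M" and e: "e > 0"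
    have "continuous_on X f" "f ` X \<subseteq> unit_cube" using f mspace_cube_maps[OF cX] by blast+
    \<comment> \<open>The Euclidean norm is bounded by the sum of the \<open>CARD('d)\<close>
      coordinates, hence the division.\<close>
    moreover have "e / real CARD('d) > 0" using e by simp
    ultimately obtain g :: "'a \<Rightarrow> real ^ 'd" where g: "continuous_on X g" "g ` X \<subseteq> unit_cube"
      "\<forall>x\<in>X. \<forall>i. \<bar>g x $ i - f x $ i\<bar> \<le> e / real CARD('d)" "separates_pairs X T K g"
      using K unfolding densely_separable_def by blast
    \<comment> \<open>Points of the function space are \<open>undefined\<close> outside
      \<open>X\<close>; orbits stay in \<open>X\<close>, so restricting does not change orbit
      maps.\<close>
    define g' where "g' = restrict g X"
    have gM: "g' \<in> ?M"
      unfolding mspace_cube_maps[OF cX] g'_def using g by (auto simp: image_subset_iff)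
    have om: "orbit_map X T g' x = orbit_map X T g x" if "x \<in> X" for x
      using that iter_int_in[OF T] by (auto simp: orbit_map_def g'_def)
    have "separates_pairs X T K g'"
      unfolding separates_pairs_def
    proof
      fix p assume p: "p \<in> K"
      obtain a b where ab: "p = (a, b)" by (cases p)
      then have "a \<in> X" "b \<in> X" "orbit_map X T g a \<noteq> orbit_map X T g b"
        using p Ksub g(4) by (auto simp: separates_pairs_def)
      then show "case p of (x, y) \<Rightarrow> orbit_map X T g' x \<noteq> orbit_map X T g' y" using om ab by simp
    qed
    moreover have "dist (f x) (g' x) \<le> e" if x: "x \<in> X" for x
    proof -
      have "dist (f x) (g' x) = norm (g x - f x)" using x by (simp add: g'_def dist_norm norm_minus_commute)
      also have "\<dots> \<le> (\<Sum>i\<in>UNIV. \<bar>(g x - f x) $ i\<bar>)" by (rule norm_le_l1_cart)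
      also have "\<dots> \<le> (\<Sum>i\<in>(UNIV :: 'd set). e / real CARD('d))" using g(3) x by (intro sum_mono) auto
      also have "\<dots> = e" by simp
      finally show ?thesis .
    qed
    ultimately show "\<exists>g\<in>?M - ?B. \<forall>x\<in>X. dist (f x) (g x) \<le> e"
      using gM by (intro bexI[of _ g'] ballI) simp_all
  qed
qed

lemma comeagre_in_cube_maps:
  fixes X :: "'a::metric_space set"
  assumes T: "tds X T" and X: "X \<noteq> {}" and c: "countable \<K>"
    and K: "\<forall>K\<in>\<K>. densely_separable TYPE('d::finite) X T K"
    and inj: "\<forall>f :: 'a \<Rightarrow> real ^ 'd. (\<forall>K\<in>\<K>. separates_pairs X T K f) \<longrightarrow> inj_on (orbit_map X T f) X"
  shows "comeagre_in (mtopology_of (cube_maps X))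
    {f \<in> mspace (cube_maps X :: ('a \<Rightarrow> real ^ 'd) metric). inj_on (orbit_map X T f) X}"
proof -
  let ?M = "mspace (cube_maps X :: ('a \<Rightarrow> real ^ 'd) metric)"
  let ?S = "{f \<in> ?M. inj_on (orbit_map X T f) X}"
  \<comment> \<open>The set {} is added because \<open>from_nat_into\<close> enumerates only
    nonempty sets; it is separated by every map.\<close>
  define E where "E = from_nat_into (insert {} \<K>)"
  have rE: "range E = insert {} \<K>" unfolding E_def using c by (intro range_from_nat_into) auto
  have E: "densely_separable TYPE('d) X T (E n)" for n
  proof -
    have "densely_separable TYPE('d) X T {}"
      by (auto simp: densely_separable_def separates_pairs_def intro!: exI)
    moreover have "E n \<in> insert {} \<K>" using rE by (metis rangeI)
    ultimately show ?thesis using bspec[OF K, of "E n"] by (elim insertE) simp_all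
  qed
  \<comment> \<open>Comeagre is defined through an equality of the complement with a union, so each
    bad set is cut down to non-injective maps. Subsets of nowhere dense sets remain nowhere
    dense.\<close>
  define N where "N n = (?M - ?S) \<inter> {f \<in> ?M. \<not> separates_pairs X T (E n) f}" for n
  have nd: "\<forall>n. nowhere_dense_in (mtopology_of (cube_maps X)) (N n)"
  proof
    show "nowhere_dense_in (mtopology_of (cube_maps X)) (N n)" for n
      unfolding N_def by (rule nowhere_dense_in_subset[OF non_separating_nowhere_dense[OF T X E[of n]] Int_lower2])
  qed
  have "?M - ?S \<subseteq> (\<Union>n. N n)"
  proof
    fix f assume f: "f \<in> ?M - ?S"
    have "\<not> (\<forall>K\<in>\<K>. separates_pairs X T K f)"
      using spec[OF inj, of f] f by auto
    then obtain K where K: "K \<in> \<K>" "\<not> separates_pairs X T K f" by blast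
    have "K \<in> range E" using K(1) unfolding rE by simp
    then obtain n where "K = E n" by (rule rangeE)
    then show "f \<in> (\<Union>n. N n)" using f K(2) by (intro UN_I[of n]) (simp_all add: N_def)
  qed
  moreover have "N n \<subseteq> ?M - ?S" for n unfolding N_def by (rule Int_lower1)
  ultimately have "?M - ?S = (\<Union>n. N n)" by (intro equalityI UN_least)
  then show ?thesis using nd unfolding comeagre_in_def by (intro conjI exI[of _ N]) auto
qed

section \<open>Generic maps of nerves\<close>

lemma coordinate_index_less: "to_nat_on (UNIV :: 'd::finite set) i < CARD('d)"
  using bij_betw_apply[OF to_nat_on_finite[of "UNIV :: 'd set"]] by simp

lemma flat_index_less:
  assumes "j < n"
  shows "CARD('d::finite) * j + to_nat_on (UNIV :: 'd set) i < n * CARD('d)"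
proof -
  have "CARD('d) * j + to_nat_on (UNIV :: 'd set) i < CARD('d) * Suc j"
    using coordinate_index_less[of i] by simp
  also have "\<dots> \<le> CARD('d) * n" using assms by (intro mult_le_mono2) simp
  finally show ?thesis by (simp add: mult.commute)
qed

lemma flat_index_cases:
  assumes "k < n * CARD('d::finite)"
  obtains j and i :: "'d::finite" where "j < n" "k = CARD('d) * j + to_nat_on (UNIV :: 'd set) i"
proof -
  have "k mod CARD('d) \<in> {..<card (UNIV :: 'd set)}" by simp
  then obtain i :: 'd where "to_nat_on (UNIV :: 'd set) i = k mod CARD('d)"
    using to_nat_on_finite[of "UNIV :: 'd set"] unfolding bij_betw_def by (metis finite imageE)
  moreover have "k div CARD('d) < n" using assms by (simp add: less_mult_imp_div_less)
  ultimately show ?thesis using that[of "k div CARD('d)" i] by simp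
qed

text \<open>The canonical map to the nerve with barycentric coordinates \<open>\<psi> U z\<close>,
  followed by the affine map with vertices \<open>V U\<close>. A vertex stores a block of vectors as
  one list of reals, with time \<open>j\<close> and coordinate \<open>i\<close> merged into one
  index; thus a shift by \<open>p\<close> times is a shift by \<open>p * CARD('d)\<close>, and
  genericity counts scalar equations.\<close>

definition nerve_map :: "('b \<Rightarrow> 'a \<Rightarrow> real) \<Rightarrow> 'b set \<Rightarrow> ('b \<Rightarrow> nat \<Rightarrow> real) \<Rightarrow> 'a \<Rightarrow> nat \<Rightarrow> real ^ 'd::finite" where
  "nerve_map \<psi> \<beta> V z j = (\<chi> i. \<Sum>U\<in>\<beta>. \<psi> U z * V U (CARD('d) * j + to_nat_on (UNIV :: 'd set) i))"

definition partition_subordinate :: "'a::metric_space set \<Rightarrow> 'a set set \<Rightarrow> ('a set \<Rightarrow> 'a \<Rightarrow> real) \<Rightarrow> bool" where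
  "partition_subordinate Y \<beta> \<psi> \<longleftrightarrow> finite \<beta> \<and> (\<forall>U\<in>\<beta>. continuous_on Y (\<psi> U)) \<and>
     (\<forall>U\<in>\<beta>. \<forall>x\<in>Y. 0 \<le> \<psi> U x \<and> (0 < \<psi> U x \<longrightarrow> x \<in> U)) \<and> (\<forall>x\<in>Y. (\<Sum>U\<in>\<beta>. \<psi> U x) = 1)"

lemma partition_subordinate_exists:
  assumes "closed Y" "finite_open_cover (top_of_set Y) \<beta>"
  shows "\<exists>\<psi>. partition_subordinate Y \<beta> \<psi>"
proof -
  have "finite \<beta>" using assms(2) by (simp add: finite_open_cover_def)
  then show ?thesis using partition_of_unity_cover[OF assms] unfolding partition_subordinate_def by simp
qed

lemma convex_combination_bounds:
  fixes c a :: "'b \<Rightarrow> real"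
  assumes "finite \<beta>" "\<forall>U\<in>\<beta>. 0 \<le> c U \<and> (0 < c U \<longrightarrow> l \<le> a U \<and> a U \<le> u)" "(\<Sum>U\<in>\<beta>. c U) = 1"
  shows "l \<le> (\<Sum>U\<in>\<beta>. c U * a U)" "(\<Sum>U\<in>\<beta>. c U * a U) \<le> u"
proof -
  have t: "c U * l \<le> c U * a U \<and> c U * a U \<le> c U * u" if "U \<in> \<beta>" for U
  proof (cases "c U = 0")
    case False
    then have "0 < c U" using assms(2) that by force
    then show ?thesis using assms(2) that by simp
  qed simp
  have "(\<Sum>U\<in>\<beta>. c U * l) \<le> (\<Sum>U\<in>\<beta>. c U * a U)" "(\<Sum>U\<in>\<beta>. c U * a U) \<le> (\<Sum>U\<in>\<beta>. c U * u)"
    using t by (auto intro: sum_mono)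
  then show "l \<le> (\<Sum>U\<in>\<beta>. c U * a U)" "(\<Sum>U\<in>\<beta>. c U * a U) \<le> u"
    using assms(3) by (simp_all add: sum_distrib_right[symmetric])
qed

lemma nerve_map_nth:
  "(nerve_map \<psi> \<beta> V z j :: real ^ 'd::finite) $ i = (\<Sum>U\<in>\<beta>. \<psi> U z * V U (CARD('d) * j + to_nat_on (UNIV :: 'd set) i))"
  by (simp add: nerve_map_def)

lemma continuous_on_nerve_map:
  assumes "partition_subordinate Y \<beta> \<psi>"
  shows "continuous_on Y (\<lambda>z. nerve_map \<psi> \<beta> V z j :: real ^ 'd::finite)"
  unfolding nerve_map_def
  using assms by (intro continuous_on_vec_lambda continuous_on_sum continuous_on_mult_right)
    (simp add: partition_subordinate_def)

lemma nerve_map_in_unit_cube: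
  assumes p: "partition_subordinate Y \<beta> \<psi>" and V: "\<forall>U\<in>\<beta>. \<forall>M<n * CARD('d::finite). V U M \<in> {0..1}"
    and z: "z \<in> Y" and j: "j < n"
  shows "(nerve_map \<psi> \<beta> V z j :: real ^ 'd) \<in> unit_cube"
proof -
  have "0 \<le> (nerve_map \<psi> \<beta> V z j :: real ^ 'd) $ i \<and> (nerve_map \<psi> \<beta> V z j :: real ^ 'd) $ i \<le> 1" for i
    unfolding nerve_map_nth
    using p z V flat_index_less[OF j, of i] by (intro conjI convex_combination_bounds) (auto simp: partition_subordinate_def)
  then show ?thesis by (simp add: unit_cube_def)
qed

lemma nerve_map_close:
  assumes p: "partition_subordinate Y \<beta> \<psi>" and z: "z \<in> Y"
    and V: "\<forall>U\<in>\<beta>. z \<in> U \<longrightarrow> \<bar>V U (CARD('d::finite) * j + to_nat_on (UNIV :: 'd set) i) - y\<bar> \<le> e"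
  shows "\<bar>(nerve_map \<psi> \<beta> V z j :: real ^ 'd) $ i - y\<bar> \<le> e"
proof -
  define a where "a U = V U (CARD('d::finite) * j + to_nat_on (UNIV :: 'd set) i)" for U
  have *: "finite \<beta>" "(\<Sum>U\<in>\<beta>. \<psi> U z) = 1" "\<forall>U\<in>\<beta>. 0 \<le> \<psi> U z \<and> (0 < \<psi> U z \<longrightarrow> y - e \<le> a U \<and> a U \<le> y + e)"
    using p z V unfolding partition_subordinate_def a_def by (simp_all add: abs_le_iff) (smt (verit))
  have "y - e \<le> (\<Sum>U\<in>\<beta>. \<psi> U z * a U)" "(\<Sum>U\<in>\<beta>. \<psi> U z * a U) \<le> y + e"
    by (rule convex_combination_bounds[OF *(1) *(3) *(2)])+
  then show ?thesis unfolding nerve_map_nth a_def by (simp add: abs_le_iff)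
qed

section \<open>Prescribing values on disjoint towers\<close>

lemma vertex_values:
  fixes F :: "nat \<Rightarrow> 'a \<Rightarrow> real ^ 'd::finite"
  assumes F: "\<forall>U\<in>\<beta>. \<forall>z\<in>U. \<forall>j<n. F j z \<in> unit_cube"
    and osc: "\<forall>U\<in>\<beta>. \<forall>z\<in>U. \<forall>z'\<in>U. \<forall>j<n. \<forall>i. \<bar>F j z $ i - F j z' $ i\<bar> \<le> e"
  shows "\<exists>V. (\<forall>U\<in>\<beta>. \<forall>M<n * CARD('d). V U M \<in> {0..1}) \<and>
    (\<forall>U\<in>\<beta>. \<forall>z\<in>U. \<forall>j<n. \<forall>i. \<bar>V U (CARD('d) * j + to_nat_on (UNIV :: 'd set) i) - F j z $ i\<bar> \<le> e)"
proof -
  define pt where "pt U = (SOME z. z \<in> U)" for U :: "'a set"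
  have pt: "pt U \<in> U" if "U \<noteq> {}" for U using that unfolding pt_def by (simp add: some_in_eq)
  \<comment> \<open>A member takes the values of \<open>F\<close> at a chosen point of it. An empty
    member has no point; the value 0 keeps its vertex in the unit interval.\<close>
  define V where "V U M = (if U = {} then 0 else
      F (M div CARD('d)) (pt U) $ from_nat_into (UNIV :: 'd set) (M mod CARD('d)))" for U M
  have V1: "V U (CARD('d) * j + to_nat_on (UNIV :: 'd set) i) = F j (pt U) $ i" if "U \<noteq> {}" for U j i
    using that coordinate_index_less[of i] by (simp add: V_def from_nat_into_to_nat_on)
  show ?thesis
  proof (intro exI[of _ V] conjI ballI allI impI)
    fix U M assume U: "U \<in> \<beta>" and M: "M < n * CARD('d)"
    have "M div CARD('d) < n" using M by (simp add: less_mult_imp_div_less)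
    then show "V U M \<in> {0..1}"
      using F U pt[of U] by (auto simp: V_def unit_cube_def)
  next
    fix U z j i assume "U \<in> \<beta>" "z \<in> U" "j < n"
    moreover from this have "U \<noteq> {}" by blast
    ultimately show "\<bar>V U (CARD('d) * j + to_nat_on (UNIV :: 'd set) i) - F j z $ i\<bar> \<le> e"
      using osc pt[of U] by (simp add: V1)
  qed
qed

text \<open>The levels of the tower are compact and disjoint, so the prescribed blocks glue to a
  continuous map \<open>h\<close> on their union. Tietze's theorem is applied to the coordinates of
  \<open>h - f\<close>, not of \<open>h\<close>, because this keeps the extension within
  \<open>e\<close> of \<open>f\<close>.\<close>

lemma extend_from_tower:
  fixes f :: "'a::metric_space \<Rightarrow> real ^ 'd::finite"
  assumes T: "tds X T" and C: "compact C" "C \<subseteq> X"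
    and disj: "\<forall>i<n. \<forall>j<n. i \<noteq> j \<longrightarrow> (T ^^ i) ` C \<inter> (T ^^ j) ` C = {}"
    and f: "continuous_on X f" "f ` X \<subseteq> unit_cube"
    and G: "\<forall>j<n. continuous_on C (\<lambda>z. G z j)" "\<forall>z\<in>C. \<forall>j<n. G z j \<in> unit_cube"
    and close: "\<forall>z\<in>C. \<forall>j<n. \<forall>i. \<bar>G z j $ i - f ((T ^^ j) z) $ i\<bar> \<le> e" and e: "e \<ge> 0"
  shows "\<exists>g. continuous_on X g \<and> g ` X \<subseteq> unit_cube \<and> (\<forall>x\<in>X. \<forall>i. \<bar>g x $ i - f x $ i\<bar> \<le> e) \<and>
    (\<forall>z\<in>C. \<forall>j<n. g ((T ^^ j) z) = G z j)"
proof -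
  define A where "A = (\<Union>j\<in>{..<n}. (T ^^ j) ` C)"
  \<comment> \<open>\<open>LEAST\<close> is only a way to name the level: below \<open>n\<close> it
    is unique by disjointness.\<close>
  define idx where "idx x = (LEAST j. x \<in> (T ^^ j) ` C)" for x
  define h where "h x = G (iter_int X T (- int (idx x)) x) (idx x)" for x
  have inv: "iter_int X T (- int j) ((T ^^ j) z) = z" if "z \<in> X" for z j
    using iter_int_add[OF T that, of "- int j" "int j"] by (simp add: iter_int_nat iter_int_0)
  have idx: "idx ((T ^^ j) z) = j" if z: "z \<in> C" and j: "j < n" for z j
  proof -
    have 1: "(T ^^ j) z \<in> (T ^^ idx ((T ^^ j) z)) ` C"
      unfolding idx_def by (rule LeastI[of _ j]) (use z in blast)
    have 2: "idx ((T ^^ j) z) \<le> j"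
      unfolding idx_def by (rule Least_le) (use z in blast)
    show ?thesis
    proof (rule ccontr)
      assume "idx ((T ^^ j) z) \<noteq> j"
      then have "(T ^^ idx ((T ^^ j) z)) ` C \<inter> (T ^^ j) ` C = {}" using disj j 2 by simp
      then show False using 1 z by blast
    qed
  qed
  have h: "h ((T ^^ j) z) = G z j" if "z \<in> C" "j < n" for z j
    using that C(2) inv[of z j] by (simp add: h_def idx subset_iff)
  have cj: "compact ((T ^^ j) ` C)" for j
    using C tds_iterate(1)[OF T] by (intro compact_continuous_image) (auto intro: continuous_on_subset)
  have Asub: "A \<subseteq> X" using C(2) tds_iterate(2)[OF T] by (auto simp: A_def)
  have clA: "closed A" unfolding A_def using cj by (intro closed_UN) (auto simp: compact_imp_closed)
  have "continuous_on ((T ^^ j) ` C) h" if j: "j < n" for j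
  proof -
    have sub: "(T ^^ j) ` C \<subseteq> X" using C(2) tds_iterate(2)[OF T] by auto
    have "continuous_on ((T ^^ j) ` C) (\<lambda>x. G (iter_int X T (- int j) x) j)"
    proof (rule continuous_on_compose2[OF G(1)[rule_format, OF j]])
      show "continuous_on ((T ^^ j) ` C) (iter_int X T (- int j))"
        using continuous_on_iter_int[OF T] sub by (rule continuous_on_subset)
      show "iter_int X T (- int j) ` (T ^^ j) ` C \<subseteq> C" using inv C(2) by (auto simp: subset_iff)
    qed
    moreover have "h x = G (iter_int X T (- int j) x) j" if "x \<in> (T ^^ j) ` C" for x
      using that h j inv C(2) by (auto simp: subset_iff)
    ultimately show ?thesis by (simp cong: continuous_on_cong)
  qed
  then have hc: "continuous_on A h" unfolding A_def
    by (intro continuous_on_closed_Union) (use cj in \<open>auto simp: compact_imp_closed\<close>)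
  have hclose: "\<bar>h x $ i - f x $ i\<bar> \<le> e" "h x \<in> unit_cube" if "x \<in> A" for x i
  proof -
    obtain z j where zj: "z \<in> C" "j < n" "x = (T ^^ j) z" using \<open>x \<in> A\<close> by (auto simp: A_def)
    show "\<bar>h x $ i - f x $ i\<bar> \<le> e" "h x \<in> unit_cube"
      using close G(2) zj h[OF zj(1,2)] by simp_all
  qed
  have nrm: "normal_space (top_of_set X)"
    by (intro metrizable_imp_normal_space metrizable_space_subtopology metrizable_space_euclidean)
  have "\<exists>r. continuous_on X r \<and> (\<forall>x\<in>A. r x = h x $ i - f x $ i) \<and> (\<forall>x\<in>X. \<bar>r x\<bar> \<le> e)" for i
  proof -
    have "closedin (top_of_set X) A" using clA Asub by (simp add: closed_subset)
    moreover have "continuous_map (subtopology (top_of_set X) A) euclideanreal (\<lambda>x. h x $ i - f x $ i)"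
    proof -
      have "continuous_on A (\<lambda>x. h x $ i - f x $ i)"
        using hc continuous_on_subset[OF f(1) Asub] by (intro continuous_intros)
      then show ?thesis using Asub by (simp add: subtopology_subtopology Int_absorb1)
    qed
    moreover have "(\<lambda>x. h x $ i - f x $ i) ` A \<subseteq> {-e..e}"
    proof (rule image_subsetI)
      fix x assume "x \<in> A"
      then show "h x $ i - f x $ i \<in> {-e..e}" using hclose(1)[of x i] by (simp add: abs_le_iff)
    qed
    ultimately obtain r where "continuous_map (top_of_set X) euclideanreal r"
      "\<And>x. x \<in> A \<Longrightarrow> r x = h x $ i - f x $ i" "r ` topspace (top_of_set X) \<subseteq> {-e..e}"
      by (rule Tietze_extension_closed_real_interval[OF nrm]) (use e in auto)
    then show ?thesis by (intro exI[of _ r]) (auto simp: abs_le_iff image_subset_iff)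
  qed
  then obtain r where r: "\<And>i. continuous_on X (r i)" "\<And>i x. x \<in> A \<Longrightarrow> r i x = h x $ i - f x $ i"
    "\<And>i x. x \<in> X \<Longrightarrow> \<bar>r i x\<bar> \<le> e" by metis
  \<comment> \<open>Truncation to the unit interval does not increase the distance to
    \<open>f\<close>, whose coordinates lie there, and changes nothing on \<open>A\<close>, where
    the prescribed values lie in the cube.\<close>
  define g where "g x = (\<chi> i. min 1 (max 0 (f x $ i + r i x)))" for x
  have f01: "0 \<le> f x $ i" "f x $ i \<le> 1" if "x \<in> X" for x i
    using f(2) that by (auto simp: unit_cube_def image_subset_iff)
  show ?thesis
  proof (intro exI[of _ g] conjI ballI allI impI)
    show "continuous_on X g" unfolding g_def by (intro continuous_intros f(1) r(1))
    show "g ` X \<subseteq> unit_cube" by (auto simp: g_def unit_cube_def)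
  next
    fix x i assume x: "x \<in> X"
    show "\<bar>g x $ i - f x $ i\<bar> \<le> e"
      using r(3)[OF x, of i] f01[OF x, of i] unfolding g_def vec_lambda_beta by linarith
  next
    fix z j assume z: "z \<in> C" "j < n"
    then have A: "(T ^^ j) z \<in> A" by (auto simp: A_def)
    have "g ((T ^^ j) z) = h ((T ^^ j) z)"
      using hclose(2)[OF A] by (simp add: g_def r(2)[OF A] vec_eq_iff unit_cube_def)
    then show "g ((T ^^ j) z) = G z j" using h z by simp
  qed
qed


lemma sum_over_support:
  fixes \<psi> :: "'a::metric_space set \<Rightarrow> 'a \<Rightarrow> real"
  assumes p: "partition_subordinate Y \<beta> \<psi>" and z: "z \<in> Y" and S: "S \<subseteq> \<beta>" "\<forall>U\<in>\<beta>. z \<in> U \<longrightarrow> U \<in> S"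
  shows "(\<Sum>U\<in>\<beta>. \<psi> U z * a U) = (\<Sum>U\<in>S. \<psi> U z * a U)"
proof (rule sum.mono_neutral_right)
  show "\<forall>U\<in>\<beta> - S. \<psi> U z * a U = 0"
  proof
    fix U assume U: "U \<in> \<beta> - S"
    then have "0 \<le> \<psi> U z" "\<not> 0 < \<psi> U z" using p z S(2) by (auto simp: partition_subordinate_def)
    then show "\<psi> U z * a U = 0" by simp
  qed
qed (use p S in \<open>simp_all add: partition_subordinate_def\<close>)

lemma partition_positive:
  assumes p: "partition_subordinate Y \<beta> \<psi>" and z: "z \<in> Y"
  shows "\<exists>U\<in>\<beta>. 0 < \<psi> U z"
proof (rule ccontr)
  assume "\<not> (\<exists>U\<in>\<beta>. 0 < \<psi> U z)"
  then have "\<forall>U\<in>\<beta>. \<psi> U z = 0" using p z unfolding partition_subordinate_def by force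
  then have "(\<Sum>U\<in>\<beta>. \<psi> U z) = 0" by simp
  then show False using p z by (simp add: partition_subordinate_def)
qed

text \<open>The part common to the two kinds of genericity, which \<open>Q\<close> abstracts. The
  cover and its partition of unity live on \<open>Y\<close>, where the dimension is controlled,
  while the tower has the smaller base \<open>C\<close>. The error is \<open>e\<close> for passing
  to vertices and \<open>e\<close> for moving them.\<close>

lemma nerve_map_tower_extension:
  fixes f :: "'a::metric_space \<Rightarrow> real ^ 'd::finite"
  assumes T: "tds X T" and C: "compact C" "C \<subseteq> Y" and Y: "closed Y" "Y \<subseteq> X"
    and disj: "\<forall>i<n. \<forall>j<n. i \<noteq> j \<longrightarrow> (T ^^ i) ` C \<inter> (T ^^ j) ` C = {}"
    and f: "continuous_on X f" "f ` X \<subseteq> unit_cube" and e: "e > 0"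
    and \<beta>: "finite_open_cover (top_of_set Y) \<beta>"
    and osc: "\<forall>U\<in>\<beta>. \<forall>z\<in>U. \<forall>z'\<in>U. \<forall>j<n. \<forall>i. \<bar>f ((T ^^ j) z) $ i - f ((T ^^ j) z') $ i\<bar> \<le> e"
    and generic: "\<And>V0. \<forall>U\<in>\<beta>. \<forall>M<n * CARD('d). V0 U M \<in> {0..1} \<Longrightarrow>
      \<exists>V. (\<forall>U\<in>\<beta>. \<forall>M<n * CARD('d). V U M \<in> {0..1} \<and> \<bar>V U M - V0 U M\<bar> \<le> e) \<and> Q V"
  shows "\<exists>g \<psi> V. partition_subordinate Y \<beta> \<psi> \<and> Q V \<and>
    continuous_on X g \<and> g ` X \<subseteq> unit_cube \<and> (\<forall>x\<in>X. \<forall>i. \<bar>g x $ i - f x $ i\<bar> \<le> 2 * e) \<and>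
    (\<forall>z\<in>C. \<forall>j<n. g ((T ^^ j) z) = nerve_map \<psi> \<beta> V z j)"
proof -
  obtain \<psi> where \<psi>: "partition_subordinate Y \<beta> \<psi>" using partition_subordinate_exists[OF Y(1) \<beta>] by blast
  have subY: "\<And>U. U \<in> \<beta> \<Longrightarrow> U \<subseteq> Y" using \<beta> by (auto simp: finite_open_cover_def)
  let ?D = "CARD('d)"
  define F where "F j z = f ((T ^^ j) z)" for j z
  have Fc: "\<forall>U\<in>\<beta>. \<forall>z\<in>U. \<forall>j<n. F j z \<in> unit_cube"
    using f(2) subY Y(2) tds_iterate(2)[OF T] unfolding F_def by (simp add: image_subset_iff subset_iff)
  obtain V0 where V0: "\<forall>U\<in>\<beta>. \<forall>M<n * ?D. V0 U M \<in> {0..1}"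
    "\<forall>U\<in>\<beta>. \<forall>z\<in>U. \<forall>j<n. \<forall>i. \<bar>V0 U (?D * j + to_nat_on (UNIV :: 'd set) i) - F j z $ i\<bar> \<le> e"
    using vertex_values[OF Fc osc[folded F_def]] by blast
  obtain V where V: "\<forall>U\<in>\<beta>. \<forall>M<n * ?D. V U M \<in> {0..1} \<and> \<bar>V U M - V0 U M\<bar> \<le> e" "Q V"
    using generic[OF V0(1)] by blast
  have Vc: "\<bar>V U (?D * j + to_nat_on (UNIV :: 'd set) i) - F j z $ i\<bar> \<le> 2 * e"
    if U: "U \<in> \<beta>" and z: "z \<in> U" and j: "j < n" for U z j i
  proof -
    let ?m = "?D * j + to_nat_on (UNIV :: 'd set) i"
    have "\<bar>V U ?m - V0 U ?m\<bar> \<le> e" using V(1) U flat_index_less[OF j, of i] by blast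
    moreover have "\<bar>V0 U ?m - F j z $ i\<bar> \<le> e" using V0(2) U z j by blast
    ultimately show ?thesis by linarith
  qed
  define G where "G z j = (nerve_map \<psi> \<beta> V z j :: real ^ 'd)" for z j
  have "\<exists>g. continuous_on X g \<and> g ` X \<subseteq> unit_cube \<and> (\<forall>x\<in>X. \<forall>i. \<bar>g x $ i - f x $ i\<bar> \<le> 2 * e) \<and>
    (\<forall>z\<in>C. \<forall>j<n. g ((T ^^ j) z) = G z j)"
  proof (rule extend_from_tower[OF T C(1) _ disj f])
    show "C \<subseteq> X" using C(2) Y(2) by blast
    show "\<forall>j<n. continuous_on C (\<lambda>z. G z j)"
      unfolding G_def using continuous_on_subset[OF continuous_on_nerve_map[OF \<psi>] C(2)] by blast
    show "\<forall>z\<in>C. \<forall>j<n. G z j \<in> unit_cube"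
    proof (intro ballI allI impI)
      fix z j assume "z \<in> C" "j < n"
      then show "G z j \<in> unit_cube"
        unfolding G_def using V(1) C(2) by (intro nerve_map_in_unit_cube[OF \<psi>]) blast+
    qed
    show "\<forall>z\<in>C. \<forall>j<n. \<forall>i. \<bar>G z j $ i - f ((T ^^ j) z) $ i\<bar> \<le> 2 * e"
    proof (intro ballI allI impI)
      fix z j i assume "z \<in> C" "j < n"
      then show "\<bar>G z j $ i - f ((T ^^ j) z) $ i\<bar> \<le> 2 * e"
        unfolding G_def F_def[symmetric] using Vc C(2) by (intro nerve_map_close[OF \<psi>]) blast+
    qed
    show "0 \<le> 2 * e" using e by simp
  qed
  then show ?thesis unfolding G_def using \<psi> V(2) by blast
qed

text \<open>A coincidence of \<open>z\<close> with its \<open>p\<close>-th iterate over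
  \<open>n - p\<close> times is a system of \<open>(n - p) * CARD('d)\<close> homogeneous equations
  for the barycentric coordinates of \<open>z\<close>. At most that many are nonzero, so genericity
  forces all of them to vanish, although they sum to 1.\<close>

lemma generic_aperiodic_extension:
  fixes f :: "'a::metric_space \<Rightarrow> real ^ 'd::finite"
  assumes T: "tds X T" and C: "compact C" "C \<subseteq> Y" and Y: "closed Y" "Y \<subseteq> X"
    and disj: "\<forall>i<n. \<forall>j<n. i \<noteq> j \<longrightarrow> (T ^^ i) ` C \<inter> (T ^^ j) ` C = {}"
    and f: "continuous_on X f" "f ` X \<subseteq> unit_cube" and e: "e > 0"
    and \<beta>: "finite_open_cover (top_of_set Y) \<beta>"
    and mult: "\<forall>x\<in>Y. card {U\<in>\<beta>. x \<in> U} \<le> (n - p) * CARD('d)" and p: "0 < p" "p \<le> n"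
    and osc: "\<forall>U\<in>\<beta>. \<forall>z\<in>U. \<forall>z'\<in>U. \<forall>j<n. \<forall>i. \<bar>f ((T ^^ j) z) $ i - f ((T ^^ j) z') $ i\<bar> \<le> e"
  shows "\<exists>g. continuous_on X g \<and> g ` X \<subseteq> unit_cube \<and> (\<forall>x\<in>X. \<forall>i. \<bar>g x $ i - f x $ i\<bar> \<le> 2 * e) \<and>
    (\<forall>z\<in>C. \<exists>j<n - p. g ((T ^^ j) z) \<noteq> g ((T ^^ (j + p)) z))"
proof -
  let ?D = "CARD('d)"
  let ?Q = "\<lambda>V. \<forall>S\<subseteq>\<beta>. card S \<le> (n - p) * ?D \<longrightarrow> lin_indep S ((n - p) * ?D) (\<lambda>U k. V U k - V U (k + p * ?D))"
  have fin: "finite \<beta>" using \<beta> by (simp add: finite_open_cover_def)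
  have "\<exists>g \<psi> V. partition_subordinate Y \<beta> \<psi> \<and> ?Q V \<and>
    continuous_on X g \<and> g ` X \<subseteq> unit_cube \<and> (\<forall>x\<in>X. \<forall>i. \<bar>g x $ i - f x $ i\<bar> \<le> 2 * e) \<and>
    (\<forall>z\<in>C. \<forall>j<n. g ((T ^^ j) z) = nerve_map \<psi> \<beta> V z j)"
    by (rule nerve_map_tower_extension[where Q = ?Q, OF T C Y disj f e \<beta> osc]) (rule generic_shift_differences[OF fin e], assumption, simp add: p(1))
  then obtain g \<psi> V where \<psi>: "partition_subordinate Y \<beta> \<psi>" and V: "?Q V"
    and g: "continuous_on X g" "g ` X \<subseteq> unit_cube" "\<forall>x\<in>X. \<forall>i. \<bar>g x $ i - f x $ i\<bar> \<le> 2 * e"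
      "\<forall>z\<in>C. \<forall>j<n. g ((T ^^ j) z) = nerve_map \<psi> \<beta> V z j"
    by (elim exE conjE) (rule that)
  define G where "G z j = (nerve_map \<psi> \<beta> V z j :: real ^ 'd)" for z j
  note g(4)[folded G_def]
  note g = g(1-3) this
  have "\<exists>j<n - p. g ((T ^^ j) z) \<noteq> g ((T ^^ (j + p)) z)" if z: "z \<in> C" for z
  proof (rule ccontr)
    assume neg: "\<not> ?thesis"
    have zY: "z \<in> Y" using z C(2) by blast
    have GG: "G z j = G z (j + p)" if j: "j < n - p" for j
    proof -
      have "g ((T ^^ j) z) = g ((T ^^ (j + p)) z)" using neg j by blast
      moreover have "j < n" "j + p < n" using j by auto
      ultimately show ?thesis using g(4) z by simp
    qed
    define S where "S = {U\<in>\<beta>. z \<in> U}"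
    have S: "S \<subseteq> \<beta>" "\<forall>U\<in>\<beta>. z \<in> U \<longrightarrow> U \<in> S" by (auto simp: S_def)
    have cS: "card S \<le> (n - p) * ?D" using mult zY by (simp add: S_def)
    have "(\<Sum>U\<in>S. \<psi> U z * (V U k - V U (k + p * ?D))) = 0" if k: "k < (n - p) * ?D" for k
    proof -
      obtain j and i :: 'd where ji: "j < n - p" "k = ?D * j + to_nat_on (UNIV :: 'd set) i"
        by (rule flat_index_cases[OF k])
      have "G z j $ i = G z (j + p) $ i" using GG[OF ji(1)] by simp
      moreover have "?D * (j + p) + to_nat_on (UNIV :: 'd set) i = k + p * ?D" using ji(2) by (simp add: algebra_simps)
      ultimately have "(\<Sum>U\<in>\<beta>. \<psi> U z * V U k) = (\<Sum>U\<in>\<beta>. \<psi> U z * V U (k + p * ?D))"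
        unfolding G_def nerve_map_nth by (simp add: ji(2))
      then have "(\<Sum>U\<in>S. \<psi> U z * V U k) = (\<Sum>U\<in>S. \<psi> U z * V U (k + p * ?D))"
        unfolding sum_over_support[OF \<psi> zY S] .
      then show ?thesis by (simp add: right_diff_distrib sum_subtractf)
    qed
    moreover have "lin_indep S ((n - p) * ?D) (\<lambda>U k. V U k - V U (k + p * ?D))" using V S(1) cS by blast
    ultimately have 0: "\<forall>U\<in>S. \<psi> U z = 0"
      unfolding lin_indep_def by (elim allE[of _ "\<lambda>U. \<psi> U z"]) blast
    obtain U where "U \<in> \<beta>" "0 < \<psi> U z" using partition_positive[OF \<psi> zY] by blast
    moreover from this have "U \<in> S" using \<psi> zY by (simp add: S_def partition_subordinate_def)
    ultimately show False using 0 by force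
  qed
  then show ?thesis using g(1-3) by blast
qed

text \<open>The differences \<open>c U = \<psi> U z - \<psi> U w\<close> sum to 0 and annihilate the
  vertices. At most \<open>n * CARD('d) + 1\<close> members are involved, so affine independence
  gives \<open>c = 0\<close>. But a member with \<open>\<psi> U z > 0\<close> contains
  \<open>z\<close>, hence not \<open>w\<close>, and has \<open>c U > 0\<close>.\<close>

lemma generic_injective_extension:
  fixes f :: "'a::metric_space \<Rightarrow> real ^ 'd::finite"
  assumes T: "tds X T" and C: "compact C" "C \<subseteq> Y" and Y: "closed Y" "Y \<subseteq> X"
    and disj: "\<forall>i<n. \<forall>j<n. i \<noteq> j \<longrightarrow> (T ^^ i) ` C \<inter> (T ^^ j) ` C = {}"
    and f: "continuous_on X f" "f ` X \<subseteq> unit_cube" and e: "e > 0"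
    and \<beta>: "finite_open_cover (top_of_set Y) \<beta>"
    and mult: "\<forall>x\<in>Y. 2 * card {U\<in>\<beta>. x \<in> U} \<le> n * CARD('d) + 1"
    and osc: "\<forall>U\<in>\<beta>. \<forall>z\<in>U. \<forall>z'\<in>U. \<forall>j<n. \<forall>i. \<bar>f ((T ^^ j) z) $ i - f ((T ^^ j) z') $ i\<bar> \<le> e"
  shows "\<exists>g. continuous_on X g \<and> g ` X \<subseteq> unit_cube \<and> (\<forall>x\<in>X. \<forall>i. \<bar>g x $ i - f x $ i\<bar> \<le> 2 * e) \<and>
    (\<forall>z\<in>C. \<forall>w\<in>C. (\<forall>U\<in>\<beta>. \<not> (z \<in> U \<and> w \<in> U)) \<longrightarrow> (\<exists>j<n. g ((T ^^ j) z) \<noteq> g ((T ^^ j) w)))"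
proof -
  let ?D = "CARD('d)"
  let ?Q = "\<lambda>V. \<forall>S\<subseteq>\<beta>. \<forall>r\<in>S. card S \<le> n * ?D + 1 \<longrightarrow> lin_indep (S - {r}) (n * ?D) (\<lambda>U k. V U k - V r k)"
  have fin: "finite \<beta>" using \<beta> by (simp add: finite_open_cover_def)
  have "\<exists>g \<psi> V. partition_subordinate Y \<beta> \<psi> \<and> ?Q V \<and>
    continuous_on X g \<and> g ` X \<subseteq> unit_cube \<and> (\<forall>x\<in>X. \<forall>i. \<bar>g x $ i - f x $ i\<bar> \<le> 2 * e) \<and>
    (\<forall>z\<in>C. \<forall>j<n. g ((T ^^ j) z) = nerve_map \<psi> \<beta> V z j)"
    by (rule nerve_map_tower_extension[where Q = ?Q, OF T C Y disj f e \<beta> osc]) (rule generic_affine_position[OF fin e])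
  then obtain g \<psi> V where \<psi>: "partition_subordinate Y \<beta> \<psi>" and V: "?Q V"
    and g: "continuous_on X g" "g ` X \<subseteq> unit_cube" "\<forall>x\<in>X. \<forall>i. \<bar>g x $ i - f x $ i\<bar> \<le> 2 * e"
      "\<forall>z\<in>C. \<forall>j<n. g ((T ^^ j) z) = nerve_map \<psi> \<beta> V z j"
    by (elim exE conjE) (rule that)
  define G where "G z j = (nerve_map \<psi> \<beta> V z j :: real ^ 'd)" for z j
  note g(4)[folded G_def]
  note g = g(1-3) this
  have "\<exists>j<n. g ((T ^^ j) z) \<noteq> g ((T ^^ j) w)"
    if z: "z \<in> C" and w: "w \<in> C" and zw: "\<forall>U\<in>\<beta>. \<not> (z \<in> U \<and> w \<in> U)" for z w
  proof (rule ccontr)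
    assume neg: "\<not> ?thesis"
    have zY: "z \<in> Y" "w \<in> Y" using z w C(2) by blast+
    have GG: "G z j = G w j" if j: "j < n" for j
    proof -
      have "g ((T ^^ j) z) = g ((T ^^ j) w)" using neg j by blast
      then show ?thesis using g(4) z w j by simp
    qed
    define S where "S = {U\<in>\<beta>. z \<in> U} \<union> {U\<in>\<beta>. w \<in> U}"
    have S: "S \<subseteq> \<beta>" "\<forall>U\<in>\<beta>. z \<in> U \<longrightarrow> U \<in> S" "\<forall>U\<in>\<beta>. w \<in> U \<longrightarrow> U \<in> S" by (auto simp: S_def)
    have "card S \<le> card {U\<in>\<beta>. z \<in> U} + card {U\<in>\<beta>. w \<in> U}" unfolding S_def by (rule card_Un_le)
    moreover have "2 * card {U\<in>\<beta>. z \<in> U} \<le> n * ?D + 1" "2 * card {U\<in>\<beta>. w \<in> U} \<le> n * ?D + 1"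
      using mult zY by blast+
    ultimately have cS: "card S \<le> n * ?D + 1" by linarith
    define c where "c U = \<psi> U z - \<psi> U w" for U
    have finS: "finite S" using S(1) fin by (rule finite_subset)
    have 1: "(\<Sum>U\<in>S. c U * a U) = (\<Sum>U\<in>\<beta>. \<psi> U z * a U) - (\<Sum>U\<in>\<beta>. \<psi> U w * a U)" for a
      unfolding sum_over_support[OF \<psi> zY(1) S(1,2)] sum_over_support[OF \<psi> zY(2) S(1,3)]
      by (simp add: c_def left_diff_distrib sum_subtractf)
    have c0: "(\<Sum>U\<in>S. c U) = 0"
      using 1[of "\<lambda>_. 1"] \<psi> zY by (simp add: partition_subordinate_def)
    have cV: "(\<Sum>U\<in>S. c U * V U k) = 0" if k: "k < n * ?D" for k
    proof -
      obtain j and i :: 'd where ji: "j < n" "k = ?D * j + to_nat_on (UNIV :: 'd set) i"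
        by (rule flat_index_cases[OF k])
      have "G z j $ i = G w j $ i" using GG[OF ji(1)] by simp
      then show ?thesis unfolding 1 G_def nerve_map_nth by (simp add: ji(2))
    qed
    obtain U where U: "U \<in> \<beta>" "0 < \<psi> U z" using partition_positive[OF \<psi> zY(1)] by blast
    then have zU: "z \<in> U" using \<psi> zY by (simp add: partition_subordinate_def)
    then have US: "U \<in> S" using U by (simp add: S_def)
    have "w \<notin> U" using zw U(1) zU by blast
    then have "\<psi> U w = 0" using \<psi> zY(2) U(1) unfolding partition_subordinate_def by force
    then have cU: "c U > 0" using U by (simp add: c_def)
    \<comment> \<open>The reference vertex must differ from \<open>U\<close> for independence to say
      something about \<open>c U\<close>.\<close>
    have "\<exists>r\<in>S. r \<noteq> U"
    proof (rule ccontr)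
      assume "\<not> ?thesis"
      then have "S = {U}" using US by blast
      then show False using c0 cU by simp
    qed
    then obtain r where r: "r \<in> S" "r \<noteq> U" by blast
    have "(\<Sum>u\<in>S - {r}. c u * (V u k - V r k)) = 0" if k: "k < n * ?D" for k
    proof -
      have "(\<Sum>u\<in>S - {r}. c u * (V u k - V r k)) = (\<Sum>u\<in>S. c u * (V u k - V r k))"
        using finS r(1) by (simp add: sum.remove)
      also have "\<dots> = (\<Sum>u\<in>S. c u * V u k) - (\<Sum>u\<in>S. c u) * V r k"
        by (simp add: right_diff_distrib sum_subtractf sum_distrib_right)
      finally show ?thesis using cV[OF k] c0 by simp
    qed
    moreover have "lin_indep (S - {r}) (n * ?D) (\<lambda>U k. V U k - V r k)" using V S(1) r(1) cS by blast
    ultimately have "\<forall>u\<in>S - {r}. c u = 0" unfolding lin_indep_def by (elim allE[of _ c]) blast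
    then show False using US r(2) cU by force
  qed
  then show ?thesis using g(1-3) by blast
qed

section \<open>Marked aperiodic points\<close>

lemma uniform_modulus:
  fixes F :: "nat \<Rightarrow> 'a::metric_space \<Rightarrow> 'b::metric_space"
  assumes Y: "compact Y" and F: "\<forall>j<n. continuous_on Y (F j)" and e: "e > 0"
  shows "\<exists>\<delta>>0. \<forall>z\<in>Y. \<forall>z'\<in>Y. dist z z' < \<delta> \<longrightarrow> (\<forall>j<n. dist (F j z) (F j z') < e)"
  using F
proof (induction n)
  case 0
  then show ?case by (intro exI[of _ 1]) simp
next
  case (Suc n)
  then obtain \<delta> where d: "\<delta> > 0" "\<forall>z\<in>Y. \<forall>z'\<in>Y. dist z z' < \<delta> \<longrightarrow> (\<forall>j<n. dist (F j z) (F j z') < e)" by auto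
  have "uniformly_continuous_on Y (F n)" using Suc.prems Y by (intro compact_uniformly_continuous) auto
  then obtain \<delta>' where d': "\<delta>' > 0" "\<forall>z\<in>Y. \<forall>z'\<in>Y. dist z' z < \<delta>' \<longrightarrow> dist (F n z') (F n z) < e"
    using e unfolding uniformly_continuous_on_def by meson
  show ?case
    by (rule exI[of _ "min \<delta> \<delta>'"]) (use d d' in \<open>auto simp: less_Suc_eq dist_commute\<close>)
qed

lemma fine_open_cover:
  fixes F :: "nat \<Rightarrow> 'a::metric_space \<Rightarrow> 'b::metric_space"
  assumes Y: "compact Y" and F: "\<forall>j<n. continuous_on Y (F j)" and e: "e > 0" and r: "r > 0"
  shows "\<exists>\<alpha>. finite_open_cover (top_of_set Y) \<alpha> \<and>
    (\<forall>U\<in>\<alpha>. \<forall>z\<in>U. \<forall>z'\<in>U. dist z z' < r \<and> (\<forall>j<n. dist (F j z) (F j z') < e))"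
proof -
  obtain \<delta> where d: "\<delta> > 0" "\<forall>z\<in>Y. \<forall>z'\<in>Y. dist z z' < \<delta> \<longrightarrow> (\<forall>j<n. dist (F j z) (F j z') < e)"
    using uniform_modulus[OF Y F e] by blast
  define s where "s = min \<delta> r / 2"
  have s: "s > 0" "2 * s \<le> \<delta>" "2 * s \<le> r" using d r by (auto simp: s_def)
  obtain k where k: "finite k" "Y \<subseteq> (\<Union>x\<in>k. ball x s)" using Y s(1) unfolding compact_eq_totally_bounded by blast
  have near: "dist z z' < 2 * s" if "z \<in> ball x s" "z' \<in> ball x s" for x z z'
    using that dist_triangle2[of z z' x] by (simp add: dist_commute)
  show ?thesis
  proof (intro exI[of _ "(\<lambda>x. Y \<inter> ball x s) ` k"] conjI ballI)
    show "finite_open_cover (top_of_set Y) ((\<lambda>x. Y \<inter> ball x s) ` k)"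
      using k by (auto simp: finite_open_cover_def openin_open_Int)
    fix U z z' assume "U \<in> (\<lambda>x. Y \<inter> ball x s) ` k" "z \<in> U" "z' \<in> U"
    then have zz: "z \<in> Y" "z' \<in> Y" "dist z z' < 2 * s" using near by auto
    then show "dist z z' < r" using s by simp
    show "\<forall>j<n. dist (F j z) (F j z') < e" using zz s d(2) by simp
  qed
qed

lemma fine_compact_cover:
  fixes F :: "nat \<Rightarrow> 'a::metric_space \<Rightarrow> 'b::metric_space"
  assumes Y: "compact Y" and F: "\<forall>j<n. continuous_on Y (F j)" and e: "e > 0"
  shows "\<exists>\<C>. finite \<C> \<and> \<Union>\<C> = Y \<and>
    (\<forall>C\<in>\<C>. compact C \<and> (\<forall>z\<in>C. \<forall>z'\<in>C. \<forall>j<n. dist (F j z) (F j z') < e))"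
proof -
  obtain \<delta> where d: "\<delta> > 0" "\<forall>z\<in>Y. \<forall>z'\<in>Y. dist z z' < \<delta> \<longrightarrow> (\<forall>j<n. dist (F j z) (F j z') < e)"
    using uniform_modulus[OF Y F e] by blast
  define s where "s = \<delta> / 3"
  have s: "s > 0" "2 * s < \<delta>" using d by (auto simp: s_def)
  obtain k where k: "finite k" "Y \<subseteq> (\<Union>x\<in>k. ball x s)" using Y s(1) unfolding compact_eq_totally_bounded by blast
  have near: "dist z z' \<le> 2 * s" if "z \<in> cball x s" "z' \<in> cball x s" for x z z'
    using that dist_triangle2[of z z' x] by (simp add: dist_commute)
  show ?thesis
  proof (intro exI[of _ "(\<lambda>x. Y \<inter> cball x s) ` k"] conjI ballI)
    show "finite ((\<lambda>x. Y \<inter> cball x s) ` k)" using k by simp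
    show "\<Union>((\<lambda>x. Y \<inter> cball x s) ` k) = Y" using k(2) by force
    fix C assume C: "C \<in> (\<lambda>x. Y \<inter> cball x s) ` k"
    then show "compact C" using Y by (auto intro: compact_Int_closed)
    fix z z' assume "z \<in> C" "z' \<in> C"
    then have zz: "z \<in> Y" "z' \<in> Y" "dist z z' \<le> 2 * s" using C near by auto
    then show "\<forall>j<n. dist (F j z) (F j z') < e" using s d(2) by simp
  qed
qed

lemma vec_nth_dist_le: "\<bar>(x :: real ^ 'd::finite) $ i - y $ i\<bar> \<le> dist x y"
  using component_le_norm_cart[of "x - y" i] by (simp add: dist_norm)

text \<open>Every point of \<open>Z\<close> has visited the open set \<open>F\<close> fewer than
  \<open>m\<close> steps ago, but possibly only near its boundary. By compactness some visit is at a
  uniform depth, and rescaling makes such a visit full, with value 1. This yields a compact base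
  \<open>\<phi> = 1\<close> inside \<open>F\<close> and a continuous weight for the phase.\<close>

lemma marker_function:
  assumes T: "tds X T" and F: "openin (top_of_set X) F" and Z: "compact Z" "Z \<subseteq> (\<Union>i<m. (T ^^ i) ` F)"
  shows "\<exists>\<phi> :: 'a::metric_space \<Rightarrow> real. continuous_on X \<phi> \<and> (\<forall>w\<in>X. 0 \<le> \<phi> w \<and> \<phi> w \<le> 1 \<and> (\<phi> w > 0 \<longrightarrow> w \<in> F)) \<and>
    (\<forall>z\<in>Z. \<exists>i<m. \<phi> (iter_int X T (- int i) z) = 1)"
proof -
  have FX: "F \<subseteq> X" using F openin_imp_subset by blast
  have inv: "iter_int X T (- int j) ((T ^^ j) z) = z" if "z \<in> X" for z j
    using iter_int_add[OF T that, of "- int j" "int j"] by (simp add: iter_int_nat iter_int_0)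
  have ZF: "\<exists>i<m. iter_int X T (- int i) z \<in> F" if z: "z \<in> Z" for z
  proof -
    obtain i w where iw: "i < m" "w \<in> F" "z = (T ^^ i) w" using Z(2) z by auto
    then have "iter_int X T (- int i) z = w" using inv[of w i] FX by auto
    then show ?thesis using iw by blast
  qed
  have ZX: "Z \<subseteq> X"
  proof
    fix z assume "z \<in> Z"
    then obtain i w where iw: "w \<in> F" "z = (T ^^ i) w" using Z(2) by auto
    then show "z \<in> X" using tds_iterate(2)[OF T, of w i] FX by blast
  qed
  show ?thesis
  \<comment> \<open>For \<open>F = X\<close> the complement is empty and the distance to it would be
    0; for empty \<open>Z\<close> there is no minimum to take.\<close>
  proof (cases "F = X \<or> Z = {}")
    case True
    then show ?thesis
    proof
      assume "F = X"
      then show ?thesis using ZF by (intro exI[of _ "\<lambda>_. 1"]) auto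
    qed (intro exI[of _ "\<lambda>_. 0"], simp)
  next
    case False
    then have ne: "X - F \<noteq> {}" "Z \<noteq> {}" using FX by auto
    have "closed X" using T by (auto simp: tds_def compact_imp_closed)
    then have cl: "closed (X - F)"
      using F by (metis closedin_closed_trans closedin_diff closedin_topspace topspace_euclidean_subtopology)
    define u where "u w = infdist w (X - F)" for w
    have u0: "u w \<ge> 0" for w by (simp add: u_def infdist_nonneg)
    have upos: "u w > 0 \<longleftrightarrow> w \<in> F" if "w \<in> X" for w
      using in_closed_iff_infdist_zero[OF cl ne(1), of w] that u0[of w] unfolding u_def by auto
    have uc: "continuous_on X u" unfolding u_def by (intro continuous_intros)
    define v where "v z = (\<Sum>i<m. u (iter_int X T (- int i) z))" for z
    have "continuous_on X v" unfolding v_def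
      by (intro continuous_on_sum continuous_on_compose2[OF uc continuous_on_iter_int[OF T]])
        (auto simp: iter_int_in[OF T])
    then have "continuous_on Z v" using ZX by (rule continuous_on_subset)
    then obtain z0 where z0: "z0 \<in> Z" "\<forall>z\<in>Z. v z0 \<le> v z" using continuous_attains_inf[OF Z(1) ne(2)] by blast
    obtain i0 where i0: "i0 < m" "iter_int X T (- int i0) z0 \<in> F" using ZF[OF z0(1)] by blast
    have "0 < u (iter_int X T (- int i0) z0)" using upos i0(2) FX by blast
    also have "\<dots> \<le> v z0" unfolding v_def using i0(1) u0 by (intro member_le_sum) auto
    finally have v0: "v z0 > 0" .
    \<comment> \<open>The average of the \<open>m\<close> depths at the minimising point: for every
      point of \<open>Z\<close> at least one depth is no smaller.\<close>
    define \<mu> where "\<mu> = v z0 / real m"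
    have m: "real m > 0" using i0 by simp
    have \<mu>: "\<mu> > 0" using v0 m by (simp add: \<mu>_def)
    show ?thesis
    proof (intro exI[of _ "\<lambda>w. min 1 (u w / \<mu>)"] conjI ballI)
      show "continuous_on X (\<lambda>w. min 1 (u w / \<mu>))"
        using \<mu> by (intro continuous_intros uc) auto
    next
      fix w assume w: "w \<in> X"
      show "0 \<le> min 1 (u w / \<mu>)" using u0 \<mu> by simp
      show "min 1 (u w / \<mu>) \<le> 1" by simp
      show "min 1 (u w / \<mu>) > 0 \<longrightarrow> w \<in> F" using upos[OF w] \<mu> by (simp add: zero_less_divide_iff)
    next
      fix z assume z: "z \<in> Z"
      have "\<exists>i<m. u (iter_int X T (- int i) z) \<ge> \<mu>"
      proof (rule ccontr)
        assume "\<not> ?thesis"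
        then have "v z < (\<Sum>i<m. \<mu>)" unfolding v_def using i0(1) by (intro sum_strict_mono) auto
        then show False using z0(2) z m by (simp add: \<mu>_def) (metis not_le)
      qed
      then obtain i where "i < m" "u (iter_int X T (- int i) z) \<ge> \<mu>" by blast
      then show "\<exists>i<m. min 1 (u (iter_int X T (- int i) z) / \<mu>) = 1" using \<mu> by (intro exI[of _ i]) simp
    qed
  qed
qed

lemma iterates_inj:
  assumes T: "tds X T" and "x \<in> X" "y \<in> X" "(T ^^ i) x = (T ^^ i) y"
  shows "x = y"
proof -
  have "iter_int X T (- int i) ((T ^^ i) z) = z" if "z \<in> X" for z
    using iter_int_add[OF T that, of "- int i" "int i"] by (simp add: iter_int_nat iter_int_0)
  then show ?thesis using assms by metis
qed

lemma tower_disjoint: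
  assumes T: "tds X T" and C: "C \<subseteq> X" and d: "\<forall>l\<in>{1..<n}. \<forall>z\<in>C. (T ^^ l) z \<notin> C"
  shows "\<forall>i<n. \<forall>j<n. i \<noteq> j \<longrightarrow> (T ^^ i) ` C \<inter> (T ^^ j) ` C = {}"
proof -
  have *: "(T ^^ i) ` C \<inter> (T ^^ j) ` C = {}" if ij: "i < j" "j < n" for i j
  proof (rule ccontr)
    assume "(T ^^ i) ` C \<inter> (T ^^ j) ` C \<noteq> {}"
    then obtain z w where zw: "z \<in> C" "w \<in> C" "(T ^^ i) z = (T ^^ j) w" by blast
    have "(T ^^ j) w = (T ^^ i) ((T ^^ (j - i)) w)"
      using ij funpow_add[of i "j - i" T] by simp
    then have "z = (T ^^ (j - i)) w"
      using iterates_inj[OF T, of z "(T ^^ (j - i)) w" i] zw C tds_iterate(2)[OF T, of w] by auto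
    moreover have "j - i \<in> {1..<n}" using ij by auto
    ultimately show False using d zw by blast
  qed
  show ?thesis
  proof (intro allI impI)
    fix i j assume "i < n" "j < n" "i \<noteq> j"
    then show "(T ^^ i) ` C \<inter> (T ^^ j) ` C = {}"
      using *[of i j] *[of j i] by (cases "i < j") (simp_all add: Int_commute)
  qed
qed

lemma orbit_map_iterate:
  assumes T: "tds X T" and x: "x \<in> X"
  shows "orbit_map X T f ((T ^^ p) x) k = orbit_map X T f x (k + int p)"
  using iter_int_add[OF T x, of k "int p"] by (simp add: orbit_map_def iter_int_nat)

lemma iterate_graph_compact:
  assumes T: "tds X T" and C: "compact C" "C \<subseteq> X"
  shows "(\<lambda>y. (y, (T ^^ p) y)) ` C \<subseteq> X \<times> X" "compact ((\<lambda>y. (y, (T ^^ p) y)) ` C)"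
proof -
  show "(\<lambda>y. (y, (T ^^ p) y)) ` C \<subseteq> X \<times> X" using C tds_iterate(2)[OF T] by auto
  have "continuous_on C (T ^^ p)" using tds_iterate(1)[OF T] C(2) by (rule continuous_on_subset)
  then have "continuous_on C (\<lambda>y. (y, (T ^^ p) y))" by (intro continuous_on_Pair continuous_on_id)
  then show "compact ((\<lambda>y. (y, (T ^^ p) y)) ` C)" using C(1) by (rule compact_continuous_image)
qed

text \<open>A difference seen along the orbit of some earlier point \<open>z\<close> suffices,
  because orbit maps record all integer times: it appears at time \<open>j - i\<close> of
  \<open>y\<close>.\<close>

lemma separates_iterate_graph:
  assumes T: "tds X T" and C: "C \<subseteq> X"
    and g: "\<forall>y\<in>C. \<exists>z\<in>X. \<exists>i. y = (T ^^ i) z \<and> (\<exists>j. g ((T ^^ j) z) \<noteq> g ((T ^^ (j + p)) z))"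
  shows "separates_pairs X T ((\<lambda>y. (y, (T ^^ p) y)) ` C) g"
proof -
  have "orbit_map X T g y \<noteq> orbit_map X T g ((T ^^ p) y)" if y: "y \<in> C" for y
  proof
    assume eq: "orbit_map X T g y = orbit_map X T g ((T ^^ p) y)"
    obtain z i j where z: "z \<in> X" "y = (T ^^ i) z" "g ((T ^^ j) z) \<noteq> g ((T ^^ (j + p)) z)" using g y by blast
    have "orbit_map X T g y (int j - int i) = g ((T ^^ j) z)"
      unfolding z(2) orbit_map_iterate[OF T z(1)] by (simp add: orbit_map_def iter_int_nat)
    moreover have "orbit_map X T g ((T ^^ p) y) (int j - int i) = g ((T ^^ (j + p)) z)"
    proof -
      have "y \<in> X" using y C by blast
      then have "orbit_map X T g ((T ^^ p) y) (int j - int i) = orbit_map X T g y (int j - int i + int p)"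
        by (rule orbit_map_iterate[OF T])
      also have "\<dots> = orbit_map X T g z (int (j + p))"
        unfolding z(2) orbit_map_iterate[OF T z(1)] by (simp add: algebra_simps)
      finally show ?thesis by (simp only: orbit_map_def iter_int_nat)
    qed
    ultimately show False using eq z(3) by metis
  qed
  then show ?thesis by (auto simp: separates_pairs_def)
qed

lemma join_oscillation:
  assumes \<alpha>: "\<forall>U\<in>\<alpha>. \<forall>z\<in>U. \<forall>z'\<in>U. dist (f z) (f z') < e"
    and \<beta>: "finer_cover \<beta> (iterated_join X T \<alpha> n)" and U: "U \<in> \<beta>" "z \<in> U" "z' \<in> U" and j: "j < n"
  shows "dist (f ((T ^^ j) z)) (f ((T ^^ j) z')) < e"
proof -
  obtain A' where A': "A' \<in> iterated_join X T \<alpha> n" "U \<subseteq> A'"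
    using \<beta> U(1) unfolding finer_cover_def by blast
  obtain A where A: "\<forall>i<n. A i \<in> \<alpha>" "A' = {x\<in>X. \<forall>i<n. (T ^^ i) x \<in> A i}"
    using A'(1) by (auto simp: iterated_join_def)
  have "(T ^^ j) z \<in> A j" "(T ^^ j) z' \<in> A j" "A j \<in> \<alpha>" using A A'(2) U j by auto
  then show ?thesis using \<alpha> by blast
qed

text \<open>The base \<open>\<phi> = 1\<close> carries a tower of height \<open>n\<close>, and each
  point of \<open>Z\<close> lies on a forward orbit from this base. Aperiodic points are thereby
  separated from their iterates.\<close>

lemma densely_separable_marked:
  assumes T: "tds X T" and X: "X \<noteq> {}" and md: "mean_dim X T < ereal (real CARD('d::finite) / 36)"
    and Z: "closedin (top_of_set X) Z" and mk: "has_local_markers X T Z W" and p: "p > 0"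
  shows "densely_separable TYPE('d) X T ((\<lambda>y. (y, (T ^^ p) y)) ` Z)"
proof -
  have cX: "compact X" using T by (simp add: tds_def)
  have ZX: "Z \<subseteq> X" "compact Z" using Z cX closedin_imp_subset closedin_compact by blast+
  show ?thesis unfolding densely_separable_def
  proof (intro conjI allI impI iterate_graph_compact[OF T ZX(2,1)])
    fix f :: "'a \<Rightarrow> real ^ 'd" and e :: real
    assume e: "e > 0" and f: "continuous_on X f" "f ` X \<subseteq> unit_cube"
    obtain \<alpha> where \<alpha>: "finite_open_cover (top_of_set X) \<alpha>" "\<forall>U\<in>\<alpha>. \<forall>z\<in>U. \<forall>z'\<in>U. dist (f z) (f z') < e / 2"
      using fine_open_cover[OF cX, of 1 "\<lambda>_. f" "e / 2" 1] f(1) e by auto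
    obtain \<rho> where \<rho>: "\<rho> < real CARD('d) / 36" "\<forall>\<^sub>F n in sequentially. \<exists>\<beta>. finite_open_cover (top_of_set X) \<beta> \<and>
      finer_cover \<beta> (iterated_join X T \<alpha> n) \<and> (\<forall>x\<in>X. real (card {U\<in>\<beta>. x \<in> U}) \<le> \<rho> * real n + 1)"
      using mean_dim_less_cover[OF T X md \<alpha>(1)] by blast
    obtain N where N: "\<forall>n\<ge>N. \<exists>\<beta>. finite_open_cover (top_of_set X) \<beta> \<and>
      finer_cover \<beta> (iterated_join X T \<alpha> n) \<and> (\<forall>x\<in>X. real (card {U\<in>\<beta>. x \<in> U}) \<le> \<rho> * real n + 1)"
      using \<rho>(2) unfolding eventually_sequentially by blast
    \<comment> \<open>The summands ensure \<open>n \<ge> N\<close> and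
      \<open>p \<le> n / 2 - 1\<close>. Then \<open>n - p\<close> is at least
      \<open>n / 36 + 1\<close>, which covers the multiplicity bound
      \<open>\<rho> * n + 1\<close>.\<close>
    define n where "n = N + 2 * p + 2"
    have "n \<ge> N" by (simp add: n_def)
    then obtain \<beta> where \<beta>: "finite_open_cover (top_of_set X) \<beta>" "finer_cover \<beta> (iterated_join X T \<alpha> n)"
      "\<forall>x\<in>X. real (card {U\<in>\<beta>. x \<in> U}) \<le> \<rho> * real n + 1" using N by blast
    have pn: "p \<le> n" "real p \<le> real n / 2 - 1" by (simp_all add: n_def field_simps)
    have mult: "\<forall>x\<in>X. card {U\<in>\<beta>. x \<in> U} \<le> (n - p) * CARD('d)"
    proof
      fix x assume "x \<in> X"
      then have "real (card {U\<in>\<beta>. x \<in> U}) \<le> \<rho> * real n + 1" using \<beta>(3) by blast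
      also have "\<rho> * real n \<le> real CARD('d) / 36 * real n" using \<rho>(1) by (intro mult_right_mono) auto
      also have "real CARD('d) / 36 * real n + 1 \<le> real CARD('d) / 36 * real n + real CARD('d)" by simp
      also have "\<dots> = (real n / 36 + 1) * real CARD('d)" by (simp add: field_simps)
      also have "\<dots> \<le> (real n - real p) * real CARD('d)" using pn(2) by (intro mult_right_mono) auto
      also have "\<dots> = real ((n - p) * CARD('d))" using pn(1) by (simp add: of_nat_diff)
      finally show "card {U\<in>\<beta>. x \<in> U} \<le> (n - p) * CARD('d)" by linarith
    qed
    obtain F where F: "openin (top_of_set X) F" "local_marker X T n Z W F" using mk unfolding has_local_markers_def by blast
    then obtain m where m: "Z \<union> W \<subseteq> (\<Union>i<m. (T ^^ i) ` F)" and Fd: "\<forall>i\<in>{1..<n}. F \<inter> (T ^^ i) ` F = {}"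
      unfolding local_marker_def by blast
    have "Z \<subseteq> (\<Union>i<m. (T ^^ i) ` F)" using m by blast
    then obtain \<phi> :: "'a \<Rightarrow> real" where \<phi>: "continuous_on X \<phi>" "\<forall>w\<in>X. 0 \<le> \<phi> w \<and> \<phi> w \<le> 1 \<and> (\<phi> w > 0 \<longrightarrow> w \<in> F)"
      "\<forall>z\<in>Z. \<exists>i<m. \<phi> (iter_int X T (- int i) z) = 1"
      using marker_function[OF T F(1) ZX(2)] by blast
    define C where "C = X \<inter> \<phi> -` {1}"
    have cC: "compact C"
    proof -
      have "closed C" unfolding C_def using \<phi>(1) compact_imp_closed[OF cX] by (rule continuous_closed_preimage) simp
      then show ?thesis using compact_Int_closed[OF cX, of C] by (simp add: C_def Int_absorb1)
    qed
    have CX: "C \<subseteq> X" by (simp add: C_def)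
    have CF: "C \<subseteq> F"
    proof
      fix w assume "w \<in> C"
      then have "w \<in> X" "\<phi> w > 0" by (simp_all add: C_def)
      then show "w \<in> F" using \<phi>(2) by blast
    qed
    have "\<forall>l\<in>{1..<n}. \<forall>z\<in>C. (T ^^ l) z \<notin> C" using CF Fd by blast
    note disj = tower_disjoint[OF T CX this]
    have osc: "\<forall>U\<in>\<beta>. \<forall>z\<in>U. \<forall>z'\<in>U. \<forall>j<n. \<forall>i. \<bar>f ((T ^^ j) z) $ i - f ((T ^^ j) z') $ i\<bar> \<le> e / 2"
    proof (intro ballI allI impI)
      fix U z z' j i assume *: "U \<in> \<beta>" "z \<in> U" "z' \<in> U" "j < n"
      show "\<bar>f ((T ^^ j) z) $ i - f ((T ^^ j) z') $ i\<bar> \<le> e / 2"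
        using join_oscillation[OF \<alpha>(2) \<beta>(2) *] vec_nth_dist_le[of "f ((T ^^ j) z)" i "f ((T ^^ j) z')"] by linarith
    qed
    have e2: "e / 2 > 0" using e by simp
    obtain g where g: "continuous_on X g" "g ` X \<subseteq> unit_cube" "\<forall>x\<in>X. \<forall>i. \<bar>g x $ i - f x $ i\<bar> \<le> 2 * (e / 2)"
      "\<forall>z\<in>C. \<exists>j<n - p. g ((T ^^ j) z) \<noteq> g ((T ^^ (j + p)) z)"
      using generic_aperiodic_extension[OF T cC CX compact_imp_closed[OF cX] order_refl disj f e2 \<beta>(1) mult p pn(1) osc] by blast
    have "separates_pairs X T ((\<lambda>y. (y, (T ^^ p) y)) ` Z) g"
    proof (rule separates_iterate_graph[OF T ZX(1)], rule ballI)
      fix y assume y: "y \<in> Z"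
      then have yX: "y \<in> X" using ZX by blast
      obtain i where i: "\<phi> (iter_int X T (- int i) y) = 1" using \<phi>(3) y by blast
      define z where "z = iter_int X T (- int i) y"
      have z: "z \<in> X" "z \<in> C" using i iter_int_in[OF T yX] by (simp_all add: z_def C_def)
      have "(T ^^ i) z = y"
        using iter_int_add[OF T yX, of "int i" "- int i"] by (simp add: z_def iter_int_nat iter_int_0)
      then show "\<exists>z\<in>X. \<exists>i. y = (T ^^ i) z \<and> (\<exists>j. g ((T ^^ j) z) \<noteq> g ((T ^^ (j + p)) z))"
        using z g(4) by blast
    qed
    then show "\<exists>g. continuous_on X g \<and> g ` X \<subseteq> unit_cube \<and> (\<forall>x\<in>X. \<forall>i. \<bar>g x $ i - f x $ i\<bar> \<le> e) \<and>
        separates_pairs X T ((\<lambda>y. (y, (T ^^ p) y)) ` Z) g"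
      using g(1-3) by (intro exI[of _ g] conjI) simp_all
  qed
qed

section \<open>Periodic points\<close>

text \<open>For \<open>r > 0\<close> these are points of least period exactly \<open>q\<close>, in a
  quantitative form. Having least period \<open>q\<close> is not a closed condition, while this set
  is compact, and the sets for \<open>r\<close> tending to 0 exhaust the points of least period
  \<open>q\<close>.\<close>

definition spread_periodic :: "'a::metric_space set \<Rightarrow> ('a \<Rightarrow> 'a) \<Rightarrow> nat \<Rightarrow> real \<Rightarrow> 'a set" where
  "spread_periodic X T q r = {x \<in> periodic_points_upto X T q. \<forall>i\<in>{1..<q}. r \<le> dist ((T ^^ i) x) x}"

lemma closed_periodic_points_upto:
  assumes T: "tds X T"
  shows "closed (periodic_points_upto X T q)"
proof -
  have cl: "closed X" using T by (simp add: tds_def compact_imp_closed)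
  have "closed (X \<inter> (\<lambda>x. dist ((T ^^ k) x) x) -` {0})" for k
    by (rule continuous_closed_preimage[OF _ cl]) (intro continuous_on_dist continuous_on_id tds_iterate(1)[OF T], simp)
  then have "closed (\<Union>k\<in>{1..q}. X \<inter> (\<lambda>x. dist ((T ^^ k) x) x) -` {0})" by (intro closed_UN) auto
  moreover have "(\<Union>k\<in>{1..q}. X \<inter> (\<lambda>x. dist ((T ^^ k) x) x) -` {0}) = periodic_points_upto X T q"
    by (auto simp: periodic_points_upto_def)
  ultimately show ?thesis by simp
qed

lemma compact_periodic_points_upto:
  assumes T: "tds X T"
  shows "compact (periodic_points_upto X T q)"
proof -
  have "compact (X \<inter> periodic_points_upto X T q)"
    using T closed_periodic_points_upto[OF T] by (intro compact_Int_closed) (simp_all add: tds_def)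
  moreover have "X \<inter> periodic_points_upto X T q = periodic_points_upto X T q"
    by (auto simp: periodic_points_upto_def)
  ultimately show ?thesis by simp
qed

lemma spread_periodic_subset: "spread_periodic X T q r \<subseteq> periodic_points_upto X T q" "spread_periodic X T q r \<subseteq> X"
  by (auto simp: spread_periodic_def periodic_points_upto_def)

lemma compact_spread_periodic:
  assumes T: "tds X T"
  shows "compact (spread_periodic X T q r)"
proof -
  have cl: "closed X" using T by (simp add: tds_def compact_imp_closed)
  have "closed (X \<inter> (\<lambda>x. dist ((T ^^ k) x) x) -` {r..})" for k
    by (rule continuous_closed_preimage[OF _ cl]) (intro continuous_on_dist continuous_on_id tds_iterate(1)[OF T], simp)
  then have "closed (\<Inter>k\<in>{1..<q}. X \<inter> (\<lambda>x. dist ((T ^^ k) x) x) -` {r..})" by (intro closed_INT) blast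
  then have "compact (periodic_points_upto X T q \<inter> (\<Inter>k\<in>{1..<q}. X \<inter> (\<lambda>x. dist ((T ^^ k) x) x) -` {r..}))"
    by (rule compact_Int_closed[OF compact_periodic_points_upto[OF T]])
  moreover have "periodic_points_upto X T q \<inter> (\<Inter>k\<in>{1..<q}. X \<inter> (\<lambda>x. dist ((T ^^ k) x) x) -` {r..}) = spread_periodic X T q r"
    by (auto simp: spread_periodic_def periodic_points_upto_def)
  ultimately show ?thesis by simp
qed

lemma spread_periodic_period:
  assumes "x \<in> spread_periodic X T q r" "r > 0"
  shows "(T ^^ q) x = x"
proof -
  obtain k where k: "1 \<le> k" "k \<le> q" "(T ^^ k) x = x"
    using assms(1) by (auto simp: spread_periodic_def periodic_points_upto_def)
  have "\<not> k < q"
  proof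
    assume "k < q"
    then have "k \<in> {1..<q}" using k by auto
    then have "r \<le> dist ((T ^^ k) x) x" using assms(1) unfolding spread_periodic_def by blast
    then show False using k assms(2) by simp
  qed
  then show ?thesis using k by simp
qed

text \<open>The hypothesis says \<open>2 * (k - 1) < q * d\<close> for an integer multiplicity
  \<open>k\<close>, which rounds to \<open>2 * k \<le> q * d + 1\<close>. This is exactly the count
  that general affine position of two carriers permits.\<close>

lemma perdim_cover:
  assumes pd: "perdim_less X T (real d / 2)" and q: "q \<ge> 1"
    and \<alpha>: "finite_open_cover (top_of_set (periodic_points_upto X T q)) \<alpha>"
  shows "\<exists>\<beta>. finite_open_cover (top_of_set (periodic_points_upto X T q)) \<beta> \<and> finer_cover \<beta> \<alpha> \<and>
    (\<forall>x\<in>periodic_points_upto X T q. 2 * card {U\<in>\<beta>. x \<in> U} \<le> q * d + 1)"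
proof -
  let ?P = "periodic_points_upto X T q"
  obtain \<beta> k where \<beta>: "finite_open_cover (top_of_set ?P) \<beta>" "finer_cover \<beta> \<alpha>"
    "cover_D (top_of_set ?P) \<alpha> = int k - 1" and k: "\<And>x. x \<in> topspace (top_of_set ?P) \<Longrightarrow> card {U\<in>\<beta>. x \<in> U} \<le> k"
    by (rule cover_D_refinement[OF \<alpha>], rule that)
  have "ereal (real_of_int (cover_D (top_of_set ?P) \<alpha>)) \<le> covering_dim (top_of_set ?P)"
    unfolding covering_dim_def by (rule SUP_upper) (use \<alpha> in simp)
  then have "ereal (real_of_int (cover_D (top_of_set ?P) \<alpha>)) / ereal (real q) \<le> covering_dim (top_of_set ?P) / ereal (real q)"
    using q by (intro ereal_divide_right_mono) auto
  also have "\<dots> < ereal (real d / 2)" using pd q unfolding perdim_less_def by blast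
  finally have "(real k - 1) / real q < real d / 2" using q \<beta>(3) by simp
  then have "2 * (real k - 1) < real (q * d)" using q by (simp add: field_simps)
  then have "real (2 * k) < real (q * d + 2)" by simp
  then have "2 * k \<le> q * d + 1" by (simp only: of_nat_less_iff)
  then have "2 * card {U\<in>\<beta>. x \<in> U} \<le> q * d + 1" if "x \<in> ?P" for x
    using k[of x] that by simp
  then show ?thesis using \<beta>(1,2) by (intro exI[of _ \<beta>] conjI ballI)
qed

lemma periodic_fine_cover:
  fixes f :: "'a::metric_space \<Rightarrow> real ^ 'd::finite"
  assumes T: "tds X T" and pd: "perdim_less X T (real CARD('d) / 2)" and q: "q \<ge> 1"
    and f: "continuous_on X f" and e: "e > 0" and r: "r > 0"
  shows "\<exists>\<beta>. finite_open_cover (top_of_set (periodic_points_upto X T q)) \<beta> \<and>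
    (\<forall>x\<in>periodic_points_upto X T q. 2 * card {U\<in>\<beta>. x \<in> U} \<le> q * CARD('d) + 1) \<and>
    (\<forall>U\<in>\<beta>. \<forall>z\<in>U. \<forall>z'\<in>U. dist z z' < r) \<and>
    (\<forall>U\<in>\<beta>. \<forall>z\<in>U. \<forall>z'\<in>U. \<forall>j<q. \<forall>i. \<bar>f ((T ^^ j) z) $ i - f ((T ^^ j) z') $ i\<bar> \<le> e)"
proof -
  let ?P = "periodic_points_upto X T q"
  have sub: "?P \<subseteq> X" by (auto simp: periodic_points_upto_def)
  have "continuous_on X (\<lambda>z. f ((T ^^ j) z))" for j
    by (rule continuous_on_compose2[OF f tds_iterate(1)[OF T]]) (use tds_iterate(2)[OF T] in auto)
  then have "\<forall>j<q. continuous_on ?P (\<lambda>z. f ((T ^^ j) z))" using sub continuous_on_subset by blast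
  then obtain \<alpha> where \<alpha>: "finite_open_cover (top_of_set ?P) \<alpha>"
    "\<forall>U\<in>\<alpha>. \<forall>z\<in>U. \<forall>z'\<in>U. dist z z' < r \<and> (\<forall>j<q. dist (f ((T ^^ j) z)) (f ((T ^^ j) z')) < e)"
    using fine_open_cover[OF compact_periodic_points_upto[OF T], where n = q and F = "\<lambda>j z. f ((T ^^ j) z)" and e = e and r = r] e r by blast
  obtain \<beta> where \<beta>: "finite_open_cover (top_of_set ?P) \<beta>" "finer_cover \<beta> \<alpha>"
    "\<forall>x\<in>?P. 2 * card {U\<in>\<beta>. x \<in> U} \<le> q * CARD('d) + 1"
    using perdim_cover[OF pd q \<alpha>(1)] by blast
  have *: "dist z z' < r \<and> (\<forall>j<q. dist (f ((T ^^ j) z)) (f ((T ^^ j) z')) < e)"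
    if U: "U \<in> \<beta>" "z \<in> U" "z' \<in> U" for U z z'
  proof -
    obtain A where "A \<in> \<alpha>" "U \<subseteq> A" using \<beta>(2) U(1) unfolding finer_cover_def by blast
    then show ?thesis using \<alpha>(2) U(2,3) by blast
  qed
  have **: "\<bar>f ((T ^^ j) z) $ i - f ((T ^^ j) z') $ i\<bar> \<le> e" if "U \<in> \<beta>" "z \<in> U" "z' \<in> U" "j < q" for U z z' j i
    using *[OF that(1-3)] that(4) vec_nth_dist_le[of "f ((T ^^ j) z)" i "f ((T ^^ j) z')"] by fastforce
  show ?thesis
  proof (intro exI[of _ \<beta>] conjI \<beta>(1) \<beta>(3) ballI allI impI)
    show "dist z z' < r" if "U \<in> \<beta>" "z \<in> U" "z' \<in> U" for U z z' using *[OF that] by simp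
  qed (rule **)
qed

text \<open>In a piece of diameter below \<open>r\<close>, no point returns before time
  \<open>q\<close>, so the piece is the base of a tower of height one period. The cover is taken on
  all of \<open>periodic_points_upto X T q\<close>, where the dimension is controlled.\<close>

lemma densely_separable_own_period:
  assumes T: "tds X T" and pd: "perdim_less X T (real CARD('d::finite) / 2)"
    and p: "0 < p" "2 * p \<le> q" and C: "compact C" "C \<subseteq> spread_periodic X T q r"
    and diam: "\<forall>z\<in>C. \<forall>z'\<in>C. dist z z' < r"
  shows "densely_separable TYPE('d) X T ((\<lambda>y. (y, (T ^^ p) y)) ` C)"
proof -
  let ?P = "periodic_points_upto X T q"
  have CP: "C \<subseteq> ?P" "C \<subseteq> X" using C(2) spread_periodic_subset[of X T q r] by blast+
  have PX: "?P \<subseteq> X" by (auto simp: periodic_points_upto_def)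
  have "\<forall>l\<in>{1..<q}. \<forall>z\<in>C. (T ^^ l) z \<notin> C"
  proof (intro ballI notI)
    fix l z assume l: "l \<in> {1..<q}" and z: "z \<in> C" "(T ^^ l) z \<in> C"
    have "r \<le> dist ((T ^^ l) z) z" using C(2) l z(1) unfolding spread_periodic_def by blast
    moreover have "dist ((T ^^ l) z) z < r" using diam z by blast
    ultimately show False by simp
  qed
  note disj = tower_disjoint[OF T CP(2) this]
  show ?thesis unfolding densely_separable_def
  proof (intro conjI allI impI iterate_graph_compact[OF T C(1) CP(2)])
    fix f :: "'a \<Rightarrow> real ^ 'd" and e :: real
    assume e: "e > 0" and f: "continuous_on X f" "f ` X \<subseteq> unit_cube"
    have e2: "e / 2 > 0" using e by simp
    have q1: "q \<ge> 1" "p \<le> q" using p by auto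
    obtain \<beta> where \<beta>: "finite_open_cover (top_of_set ?P) \<beta>"
      "\<forall>x\<in>?P. 2 * card {U\<in>\<beta>. x \<in> U} \<le> q * CARD('d) + 1"
      "\<forall>U\<in>\<beta>. \<forall>z\<in>U. \<forall>z'\<in>U. \<forall>j<q. \<forall>i. \<bar>f ((T ^^ j) z) $ i - f ((T ^^ j) z') $ i\<bar> \<le> e / 2"
      using periodic_fine_cover[OF T pd q1(1) f(1) e2, of 1] by auto
    have mult: "\<forall>x\<in>?P. card {U\<in>\<beta>. x \<in> U} \<le> (q - p) * CARD('d)"
    proof
      fix x assume "x \<in> ?P"
      then have k: "2 * card {U\<in>\<beta>. x \<in> U} \<le> q * CARD('d) + 1" using \<beta>(2) by blast
      show "card {U\<in>\<beta>. x \<in> U} \<le> (q - p) * CARD('d)"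
      \<comment> \<open>The bound has to lose its additive 1. For \<open>2 * p = q\<close> parity
        does this; otherwise \<open>2 * (q - p) \<ge> q + 1\<close> provides a further
        \<open>CARD('d) \<ge> 1\<close>.\<close>
      proof (cases "2 * p = q")
        case True
        then have "q * CARD('d) = 2 * ((q - p) * CARD('d))" by auto
        then show ?thesis using k by linarith
      next
        case False
        have "q * CARD('d) + 1 \<le> (q + 1) * CARD('d)" by simp
        also have "\<dots> \<le> (2 * (q - p)) * CARD('d)" using False p by (intro mult_le_mono1) linarith
        finally show ?thesis using k by linarith
      qed
    qed
    obtain g where g: "continuous_on X g" "g ` X \<subseteq> unit_cube" "\<forall>x\<in>X. \<forall>i. \<bar>g x $ i - f x $ i\<bar> \<le> 2 * (e / 2)"
      "\<forall>z\<in>C. \<exists>j<q - p. g ((T ^^ j) z) \<noteq> g ((T ^^ (j + p)) z)"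
      using generic_aperiodic_extension[OF T C(1) CP(1) closed_periodic_points_upto[OF T] PX disj f e2 \<beta>(1) mult p(1) q1(2) \<beta>(3)]
      by blast
    have "separates_pairs X T ((\<lambda>y. (y, (T ^^ p) y)) ` C) g"
    proof (rule separates_iterate_graph[OF T CP(2)], rule ballI)
      fix y assume y: "y \<in> C"
      then have "\<exists>j. g ((T ^^ j) y) \<noteq> g ((T ^^ (j + p)) y)" using g(4) by blast
      moreover have "y \<in> X" "y = (T ^^ 0) y" using y CP(2) by auto
      ultimately show "\<exists>z\<in>X. \<exists>i. y = (T ^^ i) z \<and> (\<exists>j. g ((T ^^ j) z) \<noteq> g ((T ^^ (j + p)) z))"
        by blast
    qed
    then show "\<exists>g. continuous_on X g \<and> g ` X \<subseteq> unit_cube \<and> (\<forall>x\<in>X. \<forall>i. \<bar>g x $ i - f x $ i\<bar> \<le> e) \<and>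
        separates_pairs X T ((\<lambda>y. (y, (T ^^ p) y)) ` C) g"
      using g(1-3) by (intro exI[of _ g] conjI) simp_all
  qed
qed

lemma disjoint_compact_gap:
  fixes C1 C2 :: "'a::metric_space set"
  assumes C: "compact C1" "compact C2" "C1 \<inter> C2 = {}"
  shows "\<exists>s>0. \<forall>z\<in>C1. \<forall>w\<in>C2. s \<le> dist z w"
proof (cases "C1 \<times> C2 = {}")
  case True
  then show ?thesis by (intro exI[of _ 1]) auto
next
  case False
  have "continuous_on (C1 \<times> C2) (\<lambda>p. dist (fst p) (snd p))" by (intro continuous_intros)
  then obtain p where p: "p \<in> C1 \<times> C2" "\<forall>p'\<in>C1 \<times> C2. dist (fst p) (snd p) \<le> dist (fst p') (snd p')"
    using continuous_attains_inf[OF compact_Times[OF C(1,2)] False] by blast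
  have "fst p \<noteq> snd p" using p(1) C(3) by auto
  then show ?thesis using p(2) by (intro exI[of _ "dist (fst p) (snd p)"]) auto
qed

text \<open>By \<open>sep\<close> the two pieces together form the base of a tower of height
  \<open>q\<close>. The mesh of the cover is below the gap between them, so no member meets
  both.\<close>

lemma densely_separable_equal_period:
  assumes T: "tds X T" and pd: "perdim_less X T (real CARD('d::finite) / 2)"
    and q: "q \<ge> 1" and r: "r > 0"
    and C1: "compact C1" "C1 \<subseteq> spread_periodic X T q r" "\<forall>z\<in>C1. \<forall>z'\<in>C1. dist z z' < r"
    and C2: "compact C2" "C2 \<subseteq> spread_periodic X T q r" "\<forall>z\<in>C2. \<forall>z'\<in>C2. dist z z' < r"
    and sep: "\<forall>z\<in>C1. \<forall>w\<in>C2. \<forall>l<q. (T ^^ l) z \<noteq> w"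
  shows "densely_separable TYPE('d) X T (C1 \<times> C2)"
proof -
  let ?P = "periodic_points_upto X T q"
  define C where "C = C1 \<union> C2"
  have Csub: "C1 \<subseteq> X" "C2 \<subseteq> X" "C \<subseteq> ?P" "C \<subseteq> X"
    using C1(2) C2(2) spread_periodic_subset[of X T q r] unfolding C_def by blast+
  have cC: "compact C" using C1(1) C2(1) by (simp add: C_def compact_Un)
  have PX: "?P \<subseteq> X" by (auto simp: periodic_points_upto_def)
  have own: "(T ^^ l) z \<notin> D" if l: "l \<in> {1..<q}" and z: "z \<in> D" and D: "D \<subseteq> spread_periodic X T q r" "\<forall>z\<in>D. \<forall>z'\<in>D. dist z z' < r"
    for l z D
  proof
    assume z': "(T ^^ l) z \<in> D"
    have "r \<le> dist ((T ^^ l) z) z" using D(1) l z unfolding spread_periodic_def by blast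
    moreover have "dist ((T ^^ l) z) z < r" using D(2) z z' by blast
    ultimately show False by simp
  qed
  \<comment> \<open>\<open>sep\<close> speaks about iterates of \<open>C1\<close> only; periodicity
    turns a passage from \<open>C2\<close> to \<open>C1\<close> in \<open>l\<close> steps into one
    back in \<open>q - l\<close> steps.\<close>
  have sep': "(T ^^ l) w \<noteq> z" if "z \<in> C1" "w \<in> C2" and l: "l \<in> {1..<q}" for z w l
  proof
    assume eq: "(T ^^ l) w = z"
    have "(T ^^ (q - l)) z = (T ^^ (q - l + l)) w" unfolding eq[symmetric] funpow_add by simp
    also have "\<dots> = w" using l spread_periodic_period[OF _ r, of w X T q] C2(2) that(2) by auto
    finally have "(T ^^ (q - l)) z = w" .
    moreover have "q - l < q" using l by auto
    ultimately show False using sep that by blast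
  qed
  have "\<forall>l\<in>{1..<q}. \<forall>z\<in>C. (T ^^ l) z \<notin> C"
  proof (intro ballI)
    fix l z assume l: "l \<in> {1..<q}" and z: "z \<in> C"
    have lq: "l < q" using l by simp
    show "(T ^^ l) z \<notin> C"
    proof (cases "z \<in> C1")
      case True
      have "(T ^^ l) z \<notin> C1" by (rule own[OF l True C1(2,3)])
      moreover have "(T ^^ l) z \<notin> C2" using sep True lq by blast
      ultimately show ?thesis by (simp add: C_def)
    next
      case False
      then have z2: "z \<in> C2" using z by (simp add: C_def)
      have "(T ^^ l) z \<notin> C2" by (rule own[OF l z2 C2(2,3)])
      moreover have "(T ^^ l) z \<notin> C1" using sep'[OF _ z2 l] by blast
      ultimately show ?thesis by (simp add: C_def)
    qed
  qed
  note disj = tower_disjoint[OF T Csub(4) this]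
  have "C1 \<inter> C2 = {}" using sep[rule_format, of _ _ 0] q by auto
  then obtain s where s: "s > 0" "\<forall>z\<in>C1. \<forall>w\<in>C2. s \<le> dist z w"
    using disjoint_compact_gap[OF C1(1) C2(1)] by blast
  show ?thesis unfolding densely_separable_def
  proof (intro conjI allI impI)
    show "C1 \<times> C2 \<subseteq> X \<times> X" using Csub by blast
    show "compact (C1 \<times> C2)" using C1(1) C2(1) by (rule compact_Times)
    fix f :: "'a \<Rightarrow> real ^ 'd" and e :: real
    assume e: "e > 0" and f: "continuous_on X f" "f ` X \<subseteq> unit_cube"
    have e2: "e / 2 > 0" using e by simp
    obtain \<beta> where \<beta>: "finite_open_cover (top_of_set ?P) \<beta>"
      "\<forall>x\<in>?P. 2 * card {U\<in>\<beta>. x \<in> U} \<le> q * CARD('d) + 1"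
      "\<forall>U\<in>\<beta>. \<forall>z\<in>U. \<forall>z'\<in>U. dist z z' < s"
      "\<forall>U\<in>\<beta>. \<forall>z\<in>U. \<forall>z'\<in>U. \<forall>j<q. \<forall>i. \<bar>f ((T ^^ j) z) $ i - f ((T ^^ j) z') $ i\<bar> \<le> e / 2"
      using periodic_fine_cover[OF T pd q f(1) e2 s(1)] by auto
    obtain g where g: "continuous_on X g" "g ` X \<subseteq> unit_cube" "\<forall>x\<in>X. \<forall>i. \<bar>g x $ i - f x $ i\<bar> \<le> 2 * (e / 2)"
      "\<forall>z\<in>C. \<forall>w\<in>C. (\<forall>U\<in>\<beta>. \<not> (z \<in> U \<and> w \<in> U)) \<longrightarrow> (\<exists>j<q. g ((T ^^ j) z) \<noteq> g ((T ^^ j) w))"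
      using generic_injective_extension[OF T cC Csub(3) closed_periodic_points_upto[OF T] PX disj f e2 \<beta>(1,2,4)] by blast
    have "orbit_map X T g z \<noteq> orbit_map X T g w" if zw: "z \<in> C1" "w \<in> C2" for z w
    proof
      assume eq: "orbit_map X T g z = orbit_map X T g w"
      have "\<not> (z \<in> U \<and> w \<in> U)" if "U \<in> \<beta>" for U
        using \<beta>(3) s(2) zw that by (meson not_le)
      then have "\<forall>U\<in>\<beta>. \<not> (z \<in> U \<and> w \<in> U)" by blast
      moreover have "z \<in> C" "w \<in> C" using zw by (simp_all add: C_def)
      ultimately obtain j where "g ((T ^^ j) z) \<noteq> g ((T ^^ j) w)" using g(4) by blast
      moreover have "orbit_map X T g z (int j) = orbit_map X T g w (int j)" using eq by simp
      ultimately show False by (simp add: orbit_map_def iter_int_nat)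
    qed
    then have "separates_pairs X T (C1 \<times> C2) g" by (auto simp: separates_pairs_def)
    then show "\<exists>g. continuous_on X g \<and> g ` X \<subseteq> unit_cube \<and> (\<forall>x\<in>X. \<forall>i. \<bar>g x $ i - f x $ i\<bar> \<le> e) \<and>
        separates_pairs X T (C1 \<times> C2) g"
      using g(1-3) by (intro exI[of _ g] conjI) simp_all
  qed
qed

section \<open>Phase and interpolated blocks\<close>

text \<open>A continuous form of the time since the last visit, capped at \<open>M\<close>: if
  \<phi> takes only the values 0 and 1, the \<open>k\<close>-th product tells whether there was no
  visit at the times \<open>-k, ..., 0\<close>.\<close>

definition phase :: "'a set \<Rightarrow> ('a \<Rightarrow> 'a) \<Rightarrow> ('a \<Rightarrow> real) \<Rightarrow> nat \<Rightarrow> 'a \<Rightarrow> real" where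
  "phase X T \<phi> M x = (\<Sum>k<M. \<Prod>j\<le>k. 1 - \<phi> (iter_int X T (- int j) x))"

lemma continuous_on_phase:
  assumes T: "tds X T" and \<phi>: "continuous_on X \<phi>"
  shows "continuous_on X (phase X T \<phi> M)"
proof -
  have "continuous_on X (\<lambda>x. \<phi> (iter_int X T (- int j) x))" for j
    by (rule continuous_on_compose2[OF \<phi> continuous_on_iter_int[OF T]]) (use iter_int_in[OF T] in auto)
  then show ?thesis unfolding phase_def
    by (intro continuous_on_sum continuous_on_prod continuous_on_diff continuous_on_const)
qed

lemma phase_bounds:
  assumes T: "tds X T" and \<phi>: "\<forall>w\<in>X. 0 \<le> \<phi> w \<and> \<phi> w \<le> 1" and x: "x \<in> X"
  shows "0 \<le> phase X T \<phi> M x" "phase X T \<phi> M x \<le> real M"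
proof -
  have b: "0 \<le> 1 - \<phi> (iter_int X T (- int j) x) \<and> 1 - \<phi> (iter_int X T (- int j) x) \<le> 1" for j
    using \<phi> iter_int_in[OF T x] by simp
  show "0 \<le> phase X T \<phi> M x" unfolding phase_def using b by (intro sum_nonneg prod_nonneg) auto
  have "phase X T \<phi> M x \<le> (\<Sum>k<M. 1)" unfolding phase_def using b by (intro sum_mono prod_le_1) auto
  then show "phase X T \<phi> M x \<le> real M" by simp
qed

text \<open>Without a visit at the next time the first product is 1 and the others shift by one
  place. The product that drops out at the end is 0 because of the full visit fewer than
  \<open>M\<close> steps ago, so the cap has no effect.\<close>

lemma phase_step:
  assumes T: "tds X T" and x: "x \<in> X" and v: "\<phi> (iter_int X T 1 x) = 0"
    and i: "i < M" "\<phi> (iter_int X T (- int i) x) = 1"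
  shows "phase X T \<phi> M (iter_int X T 1 x) = phase X T \<phi> M x + 1"
proof -
  define P where "P k = (\<Prod>j\<le>k. 1 - \<phi> (iter_int X T (- int j) x))" for k
  obtain M' where M: "M = Suc M'" using i(1) by (cases M) auto
  have sh: "iter_int X T (- int j) (iter_int X T 1 x) = iter_int X T (1 - int j) x" for j
    using iter_int_add[OF T x, of "- int j" 1] by simp
  have "(\<Prod>j\<le>Suc k. 1 - \<phi> (iter_int X T (1 - int j) x)) = P k" for k
    unfolding prod.atMost_Suc_shift P_def using v by simp
  then have "phase X T \<phi> M (iter_int X T 1 x) = 1 + (\<Sum>k<M'. P k)"
    unfolding phase_def sh M sum.lessThan_Suc_shift using v by simp
  moreover have "P M' = 0" unfolding P_def using i M by (intro prod_zero) auto
  ultimately show ?thesis unfolding phase_def P_def[symmetric] M by simp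
qed

text \<open>The sum of tent functions is visibly continuous in \<theta>; the right-hand side is the
  linear interpolation between adjacent integers. The range goes up to \<open>M + 1\<close> because
  the floor may be \<open>M\<close>.\<close>

lemma hat_sum:
  fixes c :: "nat \<Rightarrow> 'b::real_vector"
  assumes "0 \<le> \<theta>" "\<theta> \<le> real M"
  shows "(\<Sum>a\<le>M + 1. max 0 (1 - \<bar>\<theta> - real a\<bar>) *\<^sub>R c a) =
    (1 - frac \<theta>) *\<^sub>R c (nat \<lfloor>\<theta>\<rfloor>) + frac \<theta> *\<^sub>R c (nat \<lfloor>\<theta>\<rfloor> + 1)"
proof -
  define A where "A = nat \<lfloor>\<theta>\<rfloor>"
  have rA: "real A = of_int \<lfloor>\<theta>\<rfloor>" using assms(1) by (simp add: A_def)
  have th: "\<theta> = real A + frac \<theta>" "0 \<le> frac \<theta>" "frac \<theta> < 1" using rA by (simp_all add: frac_def) linarith+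
  have "A \<le> M" using th assms(2) by linarith
  have "(\<Sum>a\<le>M + 1. max 0 (1 - \<bar>\<theta> - real a\<bar>) *\<^sub>R c a) = (\<Sum>a\<in>{A, A + 1}. max 0 (1 - \<bar>\<theta> - real a\<bar>) *\<^sub>R c a)"
  proof (rule sum.mono_neutral_right)
    show "\<forall>a\<in>{..M + 1} - {A, A + 1}. max 0 (1 - \<bar>\<theta> - real a\<bar>) *\<^sub>R c a = 0"
    proof
      fix a assume "a \<in> {..M + 1} - {A, A + 1}"
      then have "a < A \<or> a > A + 1" by auto
      then have "real a \<le> real A - 1 \<or> real a \<ge> real A + 2" by linarith
      then have "1 - \<bar>\<theta> - real a\<bar> \<le> 0" using th by linarith
      then show "max 0 (1 - \<bar>\<theta> - real a\<bar>) *\<^sub>R c a = 0" by (simp add: max_def)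
    qed
  qed (use \<open>A \<le> M\<close> in auto)
  also have "\<dots> = max 0 (1 - \<bar>\<theta> - real A\<bar>) *\<^sub>R c A + max 0 (1 - \<bar>\<theta> - real (A + 1)\<bar>) *\<^sub>R c (A + 1)" by simp
  also have "max 0 (1 - \<bar>\<theta> - real A\<bar>) = 1 - frac \<theta>" using th by linarith
  also have "max 0 (1 - \<bar>\<theta> - real (A + 1)\<bar>) = frac \<theta>"
  proof -
    have "real (A + 1) = real A + 1" by simp
    then have "\<bar>\<theta> - real (A + 1)\<bar> = 1 - frac \<theta>" using th by linarith
    then show ?thesis using th(2) by simp
  qed
  finally show ?thesis by (simp add: A_def)
qed

text \<open>The good residues \<open>0, ..., 2 * l\<close> are more than half of the
  \<open>4 * l + 1\<close>. Wait until the first residue is 0; if the second is bad, at most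
  \<open>2 * l\<close> further steps bring it to 0, and the first is still good then.\<close>

lemma common_good_start:
  fixes A B l :: nat
  shows "\<exists>i<4 * l + 1. (A + i) mod (4 * l + 1) \<le> 2 * l \<and> (B + i) mod (4 * l + 1) \<le> 2 * l"
proof -
  define n where "n = 4 * l + 1"
  define i where "i = n - A mod n"
  have Ai: "(A + i) mod n = 0"
  proof -
    have "A mod n < n" by (simp add: n_def)
    then have "(A mod n + i) mod n = 0" by (simp add: i_def)
    then show ?thesis by (simp add: mod_simps)
  qed
  show ?thesis
  proof (cases "(B + i) mod n \<le> 2 * l")
    case True
    then show ?thesis using Ai
      by (intro exI[of _ "i mod n"]) (simp add: n_def mod_add_right_eq)
  next
    case False
    define k where "k = n - (B + i) mod n"
    have "(B + i) mod n < n" by (simp add: n_def)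
    then have "((B + i) mod n + k) mod n = 0" by (simp add: k_def)
    then have "(B + (i + k)) mod n = 0" by (simp add: mod_simps add.assoc)
    moreover have "k \<le> 2 * l" using False by (simp add: k_def n_def)
    moreover have "(A + (i + k)) mod n = k"
    proof -
      have "(A + (i + k)) mod n = ((A + i) mod n + k) mod n" by (simp add: mod_simps add.assoc)
      also have "\<dots> = k" using Ai \<open>k \<le> 2 * l\<close> by (simp add: n_def)
      finally show ?thesis .
    qed
    ultimately show ?thesis
      by (intro exI[of _ "(i + k) mod n"]) (simp add: n_def mod_add_right_eq)
  qed
qed

text \<open>Of the three disjoint windows following the times \<open>-9 * l\<close>, \<open>-3 * l\<close> and \<open>3 * l\<close>, one is free of
  visits, as each of the two points has at most one visit.\<close>

lemma common_window:
  fixes \<theta>x \<theta>y :: "int \<Rightarrow> real" and vx vy :: "int set" and l :: nat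
  assumes l: "l \<ge> 1"
    and ux: "\<forall>t\<in>vx. \<forall>t'\<in>vx. \<bar>t\<bar> \<le> 9 * int l \<longrightarrow> \<bar>t'\<bar> \<le> 9 * int l \<longrightarrow> t = t'"
    and uy: "\<forall>t\<in>vy. \<forall>t'\<in>vy. \<bar>t\<bar> \<le> 9 * int l \<longrightarrow> \<bar>t'\<bar> \<le> 9 * int l \<longrightarrow> t = t'"
    and sx: "\<forall>t. - 9 * int l \<le> t \<longrightarrow> t < 9 * int l \<longrightarrow> t + 1 \<notin> vx \<longrightarrow> \<theta>x (t + 1) = \<theta>x t + 1"
    and sy: "\<forall>t. - 9 * int l \<le> t \<longrightarrow> t < 9 * int l \<longrightarrow> t + 1 \<notin> vy \<longrightarrow> \<theta>y (t + 1) = \<theta>y t + 1"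
    and pos: "\<forall>t. 0 \<le> \<theta>x t" "\<forall>t. 0 \<le> \<theta>y t"
  shows "\<exists>s. - 9 * int l \<le> s \<and> s \<le> 7 * int l \<and>
    (\<forall>j<2 * l. \<theta>x (s + int j) = \<theta>x s + real j \<and> \<theta>y (s + int j) = \<theta>y s + real j) \<and>
    nat \<lfloor>\<theta>x s\<rfloor> mod (4 * l + 1) \<le> 2 * l \<and> nat \<lfloor>\<theta>y s\<rfloor> mod (4 * l + 1) \<le> 2 * l"
proof -
  \<comment> \<open>The length \<open>6 * l\<close> allows for at most \<open>4 * l\<close> steps of
    waiting for a common good residue and \<open>2 * l\<close> times of comparison. The starting
    time itself may be a visit, as the phase only has to advance afterwards.\<close>
  define free where "free s \<longleftrightarrow> (\<forall>t. s < t \<longrightarrow> t < s + 6 * int l \<longrightarrow> t \<notin> vx \<and> t \<notin> vy)" for s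
  have "\<exists>s0\<in>{- 9 * int l, - 3 * int l, 3 * int l}. free s0"
  proof (rule ccontr)
    assume "\<not> ?thesis"
    then have n: "\<not> free (- 9 * int l)" "\<not> free (- 3 * int l)" "\<not> free (3 * int l)" by auto
    obtain t1 where t1: "- 9 * int l < t1" "t1 < - 9 * int l + 6 * int l" "t1 \<in> vx \<or> t1 \<in> vy"
      using n(1) unfolding free_def by blast
    obtain t2 where t2: "- 3 * int l < t2" "t2 < - 3 * int l + 6 * int l" "t2 \<in> vx \<or> t2 \<in> vy"
      using n(2) unfolding free_def by blast
    obtain t3 where t3: "3 * int l < t3" "t3 < 3 * int l + 6 * int l" "t3 \<in> vx \<or> t3 \<in> vy"
      using n(3) unfolding free_def by blast
    have o: "t1 < t2" "t2 < t3" using t1 t2 t3 by auto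
    have b: "\<bar>t1\<bar> \<le> 9 * int l" "\<bar>t2\<bar> \<le> 9 * int l" "\<bar>t3\<bar> \<le> 9 * int l" using t1 t2 t3 by auto
    have "\<not> (t1 \<in> vx \<and> t2 \<in> vx)" "\<not> (t1 \<in> vx \<and> t3 \<in> vx)" "\<not> (t2 \<in> vx \<and> t3 \<in> vx)"
      using ux[rule_format, of t1 t2] ux[rule_format, of t1 t3] ux[rule_format, of t2 t3] b o by linarith+
    moreover have "\<not> (t1 \<in> vy \<and> t2 \<in> vy)" "\<not> (t1 \<in> vy \<and> t3 \<in> vy)" "\<not> (t2 \<in> vy \<and> t3 \<in> vy)"
      using uy[rule_format, of t1 t2] uy[rule_format, of t1 t3] uy[rule_format, of t2 t3] b o by linarith+
    ultimately show False using t1(3) t2(3) t3(3) by blast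
  qed
  then obtain s0 where s0': "s0 \<in> {- 9 * int l, - 3 * int l, 3 * int l}" "free s0" by blast
  have s0: "- 9 * int l \<le> s0" "s0 \<le> 3 * int l" "free s0" using s0' by auto
  have lin: "\<theta>x (s0 + int j) = \<theta>x s0 + real j \<and> \<theta>y (s0 + int j) = \<theta>y s0 + real j" if "j < 6 * l" for j
    using that
  proof (induction j)
    case (Suc j)
    have "s0 + int j + 1 \<notin> vx" "s0 + int j + 1 \<notin> vy" using s0(3) Suc.prems unfolding free_def by auto
    moreover have "- 9 * int l \<le> s0 + int j" "s0 + int j < 9 * int l" using s0 Suc.prems by auto
    ultimately have "\<theta>x (s0 + int j + 1) = \<theta>x (s0 + int j) + 1" "\<theta>y (s0 + int j + 1) = \<theta>y (s0 + int j) + 1"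
      using sx sy by blast+
    then show ?case using Suc by (simp add: algebra_simps)
  qed simp
  obtain i where i: "i < 4 * l + 1" "(nat \<lfloor>\<theta>x s0\<rfloor> + i) mod (4 * l + 1) \<le> 2 * l" "(nat \<lfloor>\<theta>y s0\<rfloor> + i) mod (4 * l + 1) \<le> 2 * l"
    using common_good_start by blast
  \<comment> \<open>\<open>s0 \<le> 3 * l\<close> and \<open>i \<le> 4 * l\<close> give the upper
    bound \<open>7 * l\<close> for \<open>s\<close>.\<close>
  define s where "s = s0 + int i"
  have i6: "i < 6 * l" using i(1) l by linarith
  have fl: "nat \<lfloor>\<theta>x s\<rfloor> = nat \<lfloor>\<theta>x s0\<rfloor> + i" "nat \<lfloor>\<theta>y s\<rfloor> = nat \<lfloor>\<theta>y s0\<rfloor> + i"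
    using lin[OF i6] pos unfolding s_def by (simp_all add: nat_add_distrib floor_add_int[symmetric])
  have "\<theta>x (s + int j) = \<theta>x s + real j \<and> \<theta>y (s + int j) = \<theta>y s + real j" if j: "j < 2 * l" for j
  proof -
    have "i + j < 6 * l" using i(1) j by linarith
    then show ?thesis using lin[of "i + j"] lin[OF i6] by (simp add: s_def add.assoc)
  qed
  then show ?thesis using i s0 fl by (intro exI[of _ s]) (simp add: s_def)
qed

text \<open>\<open>G z a\<close> is the entry at time \<open>a\<close> of the block that starts at
  \<open>z\<close>. At integer phase \<open>a\<close> the current block started
  \<open>a mod n\<close> steps ago and its entry for the present time is read; between integers two
  such readings are interpolated.\<close>

definition phased_map :: "'a set \<Rightarrow> ('a \<Rightarrow> 'a) \<Rightarrow> nat \<Rightarrow> ('a \<Rightarrow> real) \<Rightarrow> nat \<Rightarrow> ('a \<Rightarrow> nat \<Rightarrow> real ^ 'd::finite) \<Rightarrow> 'a \<Rightarrow> real ^ 'd" where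
  "phased_map X T n \<theta> M G x = (\<Sum>a\<le>M + 1. max 0 (1 - \<bar>\<theta> x - real a\<bar>) *\<^sub>R G (iter_int X T (- int (a mod n)) x) (a mod n))"

text \<open>While the phase advances by one per step its fractional part is frozen, so the window
  shows one fixed mixture of two blocks. Neither block ends within it: \<open>a + 1 + j\<close> is
  at most \<open>4 * l\<close>, the last index of a block of length
  \<open>4 * l + 1\<close>.\<close>

lemma phased_map_window:
  fixes G :: "'a::metric_space \<Rightarrow> nat \<Rightarrow> real ^ 'd::finite"
  assumes T: "tds X T" and x: "x \<in> X" and \<theta>: "\<forall>w\<in>X. 0 \<le> \<theta> w \<and> \<theta> w \<le> real M" and j: "j < 2 * l"
    and step: "\<theta> (iter_int X T (s + int j) x) = \<theta> (iter_int X T s x) + real j"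
    and a: "a = nat \<lfloor>\<theta> (iter_int X T s x)\<rfloor> mod (4 * l + 1)" "a \<le> 2 * l"
  shows "phased_map X T (4 * l + 1) \<theta> M G (iter_int X T (s + int j) x) =
    (1 - frac (\<theta> (iter_int X T s x))) *\<^sub>R G (iter_int X T (s - int a) x) (a + j) +
    frac (\<theta> (iter_int X T s x)) *\<^sub>R G (iter_int X T (s - int (a + 1)) x) (a + 1 + j)"
proof -
  define n where "n = 4 * l + 1"
  define \<theta>0 where "\<theta>0 = \<theta> (iter_int X T s x)"
  define w where "w = iter_int X T (s + int j) x"
  have wX: "w \<in> X" "iter_int X T s x \<in> X" unfolding w_def by (intro iter_int_in[OF T x])+
  have w: "\<theta> w = \<theta>0 + real j" using step by (simp add: w_def \<theta>0_def)
  have pos: "0 \<le> \<theta>0" using \<theta> wX(2) by (simp add: \<theta>0_def)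
  have fl: "nat \<lfloor>\<theta> w\<rfloor> = nat \<lfloor>\<theta>0\<rfloor> + j" and fr: "frac (\<theta> w) = frac \<theta>0"
    unfolding w using pos by (simp_all add: nat_add_distrib floor_add_int[symmetric] frac_def)
  have a': "a = nat \<lfloor>\<theta>0\<rfloor> mod n" using a(1) by (simp add: n_def \<theta>0_def)
  have m1: "(nat \<lfloor>\<theta>0\<rfloor> + j) mod n = a + j"
  proof -
    have "(nat \<lfloor>\<theta>0\<rfloor> + j) mod n = (a + j) mod n" unfolding a' by (simp add: mod_add_left_eq)
    then show ?thesis using a(2) j by (simp add: n_def)
  qed
  have m2: "(nat \<lfloor>\<theta>0\<rfloor> + j + 1) mod n = a + 1 + j"
  proof -
    have "(nat \<lfloor>\<theta>0\<rfloor> + (j + 1)) mod n = (a + (j + 1)) mod n" unfolding a' by (simp only: mod_add_left_eq)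
    then show ?thesis using a(2) j by (simp add: n_def)
  qed
  have sh: "iter_int X T (- int (c + j)) w = iter_int X T (s - int c) x" for c
    unfolding w_def iter_int_add[OF T x, symmetric] by (simp add: algebra_simps)
  have sh2: "iter_int X T (- int (a + 1 + j)) w = iter_int X T (s - int (a + 1)) x"
    using sh[of "a + 1"] by simp
  have "phased_map X T n \<theta> M G w = (1 - frac (\<theta> w)) *\<^sub>R G (iter_int X T (- int (nat \<lfloor>\<theta> w\<rfloor> mod n)) w) (nat \<lfloor>\<theta> w\<rfloor> mod n) +
    frac (\<theta> w) *\<^sub>R G (iter_int X T (- int ((nat \<lfloor>\<theta> w\<rfloor> + 1) mod n)) w) ((nat \<lfloor>\<theta> w\<rfloor> + 1) mod n)"
    unfolding phased_map_def by (rule hat_sum) (use \<theta> wX in auto)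
  also have "\<dots> = (1 - frac \<theta>0) *\<^sub>R G (iter_int X T (s - int a) x) (a + j) +
    frac \<theta>0 *\<^sub>R G (iter_int X T (s - int (a + 1)) x) (a + 1 + j)"
    unfolding fl fr m1 m2 sh[of a] sh2 ..
  finally show ?thesis unfolding n_def w_def \<theta>0_def .
qed

lemma continuous_on_phased_map:
  fixes G :: "'a::metric_space \<Rightarrow> nat \<Rightarrow> real ^ 'd::finite"
  assumes T: "tds X T" and \<theta>: "continuous_on X \<theta>" and G: "\<forall>a. continuous_on X (\<lambda>z. G z a)"
  shows "continuous_on X (phased_map X T n \<theta> M G)"
proof -
  have "continuous_on X (\<lambda>x. G (iter_int X T k x) a)" for k a
    by (rule continuous_on_compose2[OF G[rule_format] continuous_on_iter_int[OF T]]) (use iter_int_in[OF T] in auto)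
  then show ?thesis unfolding phased_map_def by (intro continuous_intros \<theta>)
qed

lemma phased_map_nth_bounds:
  fixes G :: "'a::metric_space \<Rightarrow> nat \<Rightarrow> real ^ 'd::finite"
  assumes x: "0 \<le> \<theta> x" "\<theta> x \<le> real M"
    and G: "\<forall>a<n. l \<le> G (iter_int X T (- int a) x) a $ i \<and> G (iter_int X T (- int a) x) a $ i \<le> u" and n: "n > 0"
  shows "l \<le> phased_map X T n \<theta> M G x $ i \<and> phased_map X T n \<theta> M G x $ i \<le> u"
proof -
  define c where "c a = G (iter_int X T (- int (a mod n)) x) (a mod n)" for a
  have c: "l \<le> c a $ i" "c a $ i \<le> u" for a using G n unfolding c_def by simp_all
  define A t where "A = nat \<lfloor>\<theta> x\<rfloor>" and "t = frac (\<theta> x)"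
  have t: "0 \<le> t" "t \<le> 1" unfolding t_def using frac_ge_0 frac_lt_1[of "\<theta> x"] by auto
  have "phased_map X T n \<theta> M G x = (1 - t) *\<^sub>R c A + t *\<^sub>R c (A + 1)"
    unfolding phased_map_def c_def[symmetric] A_def t_def by (rule hat_sum[OF x])
  then have e: "phased_map X T n \<theta> M G x $ i = (1 - t) * c A $ i + t * c (A + 1) $ i" by simp
  have "(1 - t) * l + t * l \<le> (1 - t) * c A $ i + t * c (A + 1) $ i"
    using t c by (intro add_mono mult_left_mono) auto
  moreover have "(1 - t) * c A $ i + t * c (A + 1) $ i \<le> (1 - t) * u + t * u"
    using t c by (intro add_mono mult_left_mono) auto
  ultimately show ?thesis unfolding e by (simp add: algebra_simps)
qed

lemma sum_two_weights:
  fixes h :: "nat \<Rightarrow> real"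
  assumes "a + 1 < n"
  shows "(\<Sum>c<n. (if c = a then 1 - t else if c = a + 1 then t else 0) * h c) = (1 - t) * h a + t * h (a + 1)"
proof -
  have "(\<Sum>c<n. (if c = a then 1 - t else if c = a + 1 then t else 0) * h c)
      = (\<Sum>c<n. (if c = a then (1 - t) * h a else 0) + (if c = a + 1 then t * h (a + 1) else 0))"
    by (rule sum.cong) auto
  also have "\<dots> = (1 - t) * h a + t * h (a + 1)"
    using assms by (simp add: sum.distrib)
  finally show ?thesis .
qed

text \<open>The equations form a vanishing combination of at most \<open>L * CARD('d)\<close>
  shifted vertices, so all coefficients are 0. At offset \<open>a\<close> this says that
  \<open>(1 - t) * \<psi> U (px a)\<close> equals a multiple of \<open>\<psi> U (py a)\<close>;
  choosing \<open>U\<close> with positive left side puts both points into \<open>U\<close>. The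
  offsets thus need not be assumed equal.\<close>

lemma block_comparison:
  fixes V :: "'a::metric_space set \<Rightarrow> nat \<Rightarrow> real"
  assumes \<psi>: "partition_subordinate X \<beta> \<psi>"
    and V: "\<forall>S\<subseteq>{..<n} \<times> \<beta>. card S \<le> L * CARD('d::finite) \<longrightarrow>
      lin_indep S (L * CARD('d)) (\<lambda>s k. V (snd s) (CARD('d) * fst s + k))"
    and mult: "\<forall>x\<in>X. 4 * card {U\<in>\<beta>. x \<in> U} \<le> L * CARD('d)"
    and p: "\<forall>c. px c \<in> X" "\<forall>c. py c \<in> X" and ab: "a + 1 < n" "b + 1 < n" and t: "t < 1"
    and eq: "\<forall>j<L. (1 - t) *\<^sub>R nerve_map \<psi> \<beta> V (px a) (a + j) + t *\<^sub>R nerve_map \<psi> \<beta> V (px (a + 1)) (a + 1 + j)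
      = (1 - u) *\<^sub>R nerve_map \<psi> \<beta> V (py b) (b + j) + u *\<^sub>R (nerve_map \<psi> \<beta> V (py (b + 1)) (b + 1 + j) :: real ^ 'd)"
  shows "\<exists>U\<in>\<beta>. px a \<in> U \<and> py a \<in> U"
proof -
  let ?D = "CARD('d)"
  have fin: "finite \<beta>" using \<psi> by (simp add: partition_subordinate_def)
  \<comment> \<open>The weights are functions of the offset because the four offsets may coincide,
    in which case rows belonging to \<open>px\<close> and \<open>py\<close> merge.\<close>
  define mx where "mx c = (if c = a then 1 - t else if c = a + 1 then t else 0)" for c
  define my where "my c = (if c = b then 1 - u else if c = b + 1 then u else 0)" for c
  define e where "e s = mx (fst s) * \<psi> (snd s) (px (fst s)) - my (fst s) * \<psi> (snd s) (py (fst s))" for s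
  define cov where "cov z = {U\<in>\<beta>. z \<in> U}" for z
  define S where "S = {a} \<times> cov (px a) \<union> {a + 1} \<times> cov (px (a + 1)) \<union> {b} \<times> cov (py b) \<union> {b + 1} \<times> cov (py (b + 1))"
  have Ssub: "S \<subseteq> {..<n} \<times> \<beta>" using ab by (auto simp: S_def cov_def)
  have pos: "0 < \<psi> U z \<longrightarrow> z \<in> U" "0 \<le> \<psi> U z" if "U \<in> \<beta>" "z \<in> X" for U z
    using \<psi> that by (simp_all add: partition_subordinate_def)
  have e0: "e s = 0" if s: "s \<in> {..<n} \<times> \<beta> - S" for s
  proof -
    obtain c U where cU: "s = (c, U)" by (cases s)
    have U: "U \<in> \<beta>" using s cU by simp
    have "mx c * \<psi> U (px c) = 0"
    proof (cases "c = a \<or> c = a + 1")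
      case True
      then have "px c \<notin> U" using s cU U by (auto simp: S_def cov_def)
      then have "\<psi> U (px c) = 0" using pos[OF U, of "px c"] p by force
      then show ?thesis by simp
    qed (simp add: mx_def)
    moreover have "my c * \<psi> U (py c) = 0"
    proof (cases "c = b \<or> c = b + 1")
      case True
      then have "py c \<notin> U" using s cU U by (auto simp: S_def cov_def)
      then have "\<psi> U (py c) = 0" using pos[OF U, of "py c"] p by force
      then show ?thesis by simp
    qed (simp add: my_def)
    ultimately show ?thesis by (simp only: e_def cU fst_conv snd_conv diff_self)
  qed
  have "card S \<le> card (cov (px a)) + card (cov (px (a + 1))) + card (cov (py b)) + card (cov (py (b + 1)))"
    unfolding S_def
    by (intro order_trans[OF card_Un_le] add_mono) (simp_all add: card_cartesian_product_singleton)
  moreover have "4 * card (cov (px c)) \<le> L * ?D" "4 * card (cov (py c)) \<le> L * ?D" for c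
    using mult p unfolding cov_def by blast+
  from this(1)[of a] this(1)[of "a + 1"] this(2)[of b] this(2)[of "b + 1"]
  have "card (cov (px a)) + card (cov (px (a + 1))) + card (cov (py b)) + card (cov (py (b + 1))) \<le> L * ?D" by linarith
  ultimately have cS: "card S \<le> L * ?D" by linarith
  have "(\<Sum>s\<in>S. e s * V (snd s) (?D * fst s + k)) = 0" if k: "k < L * ?D" for k
  proof -
    obtain j and i :: 'd where ji: "j < L" "k = ?D * j + to_nat_on (UNIV :: 'd set) i"
      by (rule flat_index_cases[OF k])
    define h where "h z c = (\<Sum>U\<in>\<beta>. \<psi> U z * V U (?D * c + k))" for z c
    have h: "(nerve_map \<psi> \<beta> V z (c + j) :: real ^ 'd) $ i = h z c" for z c
      unfolding nerve_map_nth h_def ji(2) by (simp add: algebra_simps)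
    have "(\<Sum>s\<in>S. e s * V (snd s) (?D * fst s + k)) = (\<Sum>s\<in>{..<n} \<times> \<beta>. e s * V (snd s) (?D * fst s + k))"
      by (rule sum.mono_neutral_left) (use Ssub fin e0 in auto)
    also have "\<dots> = (\<Sum>c<n. \<Sum>U\<in>\<beta>. e (c, U) * V U (?D * c + k))"
      by (simp add: sum.cartesian_product split_def)
    also have "\<dots> = (\<Sum>c<n. mx c * h (px c) c - my c * h (py c) c)"
      by (simp add: e_def h_def left_diff_distrib sum_subtractf sum_distrib_left mult.assoc)
    also have "\<dots> = ((1 - t) * h (px a) a + t * h (px (a + 1)) (a + 1)) - ((1 - u) * h (py b) b + u * h (py (b + 1)) (b + 1))"
      unfolding sum_subtractf mx_def my_def
      by (simp only: sum_two_weights[OF ab(1), of t "\<lambda>c. h (px c) c"] sum_two_weights[OF ab(2), of u "\<lambda>c. h (py c) c"])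
    also have "\<dots> = 0"
    proof -
      have "((1 - t) *\<^sub>R nerve_map \<psi> \<beta> V (px a) (a + j) + t *\<^sub>R nerve_map \<psi> \<beta> V (px (a + 1)) (a + 1 + j)) $ i
      = ((1 - u) *\<^sub>R nerve_map \<psi> \<beta> V (py b) (b + j) + u *\<^sub>R (nerve_map \<psi> \<beta> V (py (b + 1)) (b + 1 + j) :: real ^ 'd)) $ i"
        using eq ji(1) by simp
      then show ?thesis
        unfolding vector_add_component vector_scaleR_component h by simp
    qed
    finally show ?thesis .
  qed
  moreover have "lin_indep S (L * ?D) (\<lambda>s k. V (snd s) (?D * fst s + k))" using V Ssub cS by blast
  ultimately have es: "\<forall>s\<in>S. e s = 0" unfolding lin_indep_def by (elim allE[of _ e]) blast
  obtain U where U: "U \<in> \<beta>" "0 < \<psi> U (px a)" using partition_positive[OF \<psi>] p by blast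
  have "px a \<in> U" using pos(1)[OF U(1)] U(2) p by blast
  then have "(a, U) \<in> S" using U by (simp add: S_def cov_def)
  then have "e (a, U) = 0" using es by blast
  then have "(1 - t) * \<psi> U (px a) = my a * \<psi> U (py a)" by (simp add: e_def mx_def)
  moreover have "(1 - t) * \<psi> U (px a) > 0" using t U by simp
  ultimately have "\<psi> U (py a) \<noteq> 0" by auto
  then have "py a \<in> U" using pos[OF U(1), of "py a"] p by force
  then show ?thesis using U \<open>px a \<in> U\<close> by blast
qed


text \<open>The linear terms differ by \<open>l * (2 * d - 72 * \<rho>) = 72 * \<eta> * l\<close>,
  which for large \<open>l\<close> exceeds the constant \<open>12 * \<rho> + 4\<close>.\<close>

lemma large_block_length:
  fixes \<rho> d :: real
  assumes "\<rho> < d / 36"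
  shows "\<exists>l\<ge>k. l \<ge> 1 \<and> 4 * (\<rho> * real (18 * l + 3) + 1) \<le> 2 * real l * d"
proof -
  define \<eta> where "\<eta> = d / 36 - \<rho>"
  have \<eta>: "\<eta> > 0" using assms by (simp add: \<eta>_def)
  obtain l0 :: nat where l0: "real l0 \<ge> (12 * \<rho> + 4) / (72 * \<eta>)" using real_arch_simple by blast
  define l where "l = l0 + k + 1"
  have "real l0 * (72 * \<eta>) \<ge> 12 * \<rho> + 4" using l0 \<eta> by (simp add: field_simps)
  moreover have "real l * (72 * \<eta>) \<ge> real l0 * (72 * \<eta>)" using \<eta> by (intro mult_right_mono) (simp_all add: l_def)
  ultimately have "12 * \<rho> + 4 \<le> real l * (72 * \<eta>)" by linarith
  also have "real l * (72 * \<eta>) = 2 * real l * d - 72 * (real l * \<rho>)" by (simp add: \<eta>_def algebra_simps)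
  finally have "4 * (\<rho> * real (18 * l + 3) + 1) \<le> 2 * real l * d" by (simp add: algebra_simps)
  then show ?thesis by (intro exI[of _ l]) (simp add: l_def)
qed

text \<open>The map is interpolated, along a real-valued phase, between blocks read off a generic map of
  the nerve of a cover. The phase counts the time since the last visit to the marker: it advances by one at every step
  that is not a visit, and two visits in a window around time 0 are impossible. A block of length
  \<open>4 * l + 1\<close> uses a cover refining the join over \<open>18 * l + 3\<close> times, so that equality of two blocks inside the
  window still controls time 0; comparing on \<open>2 * l\<close> times costs four nerve dimensions. This is where the constant
  36 = 4 * 18 / 2 comes from.\<close>

lemma densely_separable_marked_pairs:
  assumes T: "tds X T" and X: "X \<noteq> {}" and md: "mean_dim X T < ereal (real CARD('d::finite) / 36)"
    and Z: "closedin (top_of_set X) Z" and W: "closedin (top_of_set X) W" and ZW: "Z \<inter> W = {}"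
    and mk: "has_local_markers X T Z W"
  shows "densely_separable TYPE('d) X T (Z \<times> W)"
proof -
  let ?D = "CARD('d)"
  have cX: "compact X" using T by (simp add: tds_def)
  have ZX: "Z \<subseteq> X" "compact Z" and WX: "W \<subseteq> X" "compact W"
    using Z W cX closedin_imp_subset closedin_compact by blast+
  obtain gap where gap: "gap > 0" "\<forall>z\<in>Z. \<forall>w\<in>W. gap \<le> dist z w"
    using disjoint_compact_gap[OF ZX(2) WX(2) ZW] by blast
  show ?thesis unfolding densely_separable_def
  proof (intro conjI allI impI)
    show "Z \<times> W \<subseteq> X \<times> X" using ZX WX by blast
    show "compact (Z \<times> W)" using ZX(2) WX(2) by (rule compact_Times)
    fix f :: "'a \<Rightarrow> real ^ 'd" and e :: real
    assume e: "e > 0" and f: "continuous_on X f" "f ` X \<subseteq> unit_cube"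
    have e2: "e / 2 > 0" using e by simp
    obtain \<alpha> where \<alpha>: "finite_open_cover (top_of_set X) \<alpha>"
      "\<forall>U\<in>\<alpha>. \<forall>z\<in>U. \<forall>z'\<in>U. dist z z' < gap" "\<forall>U\<in>\<alpha>. \<forall>z\<in>U. \<forall>z'\<in>U. dist (f z) (f z') < e / 2"
      using fine_open_cover[OF cX, of 1 "\<lambda>_. f" "e / 2" gap] f(1) e2 gap(1) by auto
    obtain \<rho> where \<rho>: "\<rho> < real ?D / 36" "\<forall>\<^sub>F n in sequentially. \<exists>\<beta>. finite_open_cover (top_of_set X) \<beta> \<and>
      finer_cover \<beta> (iterated_join X T \<alpha> n) \<and> (\<forall>x\<in>X. real (card {U\<in>\<beta>. x \<in> U}) \<le> \<rho> * real n + 1)"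
      using mean_dim_less_cover[OF T X md \<alpha>(1)] by blast
    obtain N0 where N0: "\<forall>n\<ge>N0. \<exists>\<beta>. finite_open_cover (top_of_set X) \<beta> \<and>
      finer_cover \<beta> (iterated_join X T \<alpha> n) \<and> (\<forall>x\<in>X. real (card {U\<in>\<beta>. x \<in> U}) \<le> \<rho> * real n + 1)"
      using \<rho>(2) unfolding eventually_sequentially by blast
    obtain l where l: "l \<ge> N0" "l \<ge> 1" "4 * (\<rho> * real (18 * l + 3) + 1) \<le> 2 * real l * real ?D"
      using large_block_length[OF \<rho>(1), of N0] by blast
    define N where "N = 18 * l + 3"
    define n where "n = 4 * l + 1"
    \<comment> \<open>Blocks are computed from the point \<open>s0\<close> steps before their start.
      With \<open>-9 * l \<le> s \<le> 7 * l\<close> and \<open>0 \<le> a \<le> 2 * l\<close>, time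
      0 is then \<open>a + s0 - s\<close> steps later, between \<open>1\<close> and
      \<open>18 * l + 1\<close>, hence within the \<open>N\<close> times of the join.\<close>
    define s0 where "s0 = 7 * l + 1"
    have "N \<ge> N0" using l(1) by (simp add: N_def)
    then obtain \<beta> where \<beta>: "finite_open_cover (top_of_set X) \<beta>" "finer_cover \<beta> (iterated_join X T \<alpha> N)"
      "\<forall>x\<in>X. real (card {U\<in>\<beta>. x \<in> U}) \<le> \<rho> * real N + 1" using N0 by blast
    have mult: "\<forall>x\<in>X. 4 * card {U\<in>\<beta>. x \<in> U} \<le> (2 * l) * ?D"
    proof
      fix x assume "x \<in> X"
      then have "real (card {U\<in>\<beta>. x \<in> U}) \<le> \<rho> * real N + 1" using \<beta>(3) by blast
      then have "4 * real (card {U\<in>\<beta>. x \<in> U}) \<le> 4 * (\<rho> * real N + 1)" by (rule mult_left_mono) simp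
      also have "\<dots> \<le> 2 * real l * real ?D" using l(3) by (simp only: N_def)
      finally have "real (4 * card {U\<in>\<beta>. x \<in> U}) \<le> real ((2 * l) * ?D)" by simp
      then show "4 * card {U\<in>\<beta>. x \<in> U} \<le> (2 * l) * ?D" by (simp only: of_nat_le_iff)
    qed
    have fin: "finite \<beta>" and subX: "\<And>U. U \<in> \<beta> \<Longrightarrow> U \<subseteq> X" using \<beta>(1) by (auto simp: finite_open_cover_def)
    obtain \<psi> where \<psi>: "partition_subordinate X \<beta> \<psi>"
      using partition_subordinate_exists[OF compact_imp_closed[OF cX] \<beta>(1)] by blast
    define F where "F j z = f ((T ^^ (j + s0)) z)" for j z
    have jN: "j + s0 < N" if "j < n" for j using that by (simp add: n_def s0_def N_def)
    have Fc: "\<forall>U\<in>\<beta>. \<forall>z\<in>U. \<forall>j<n. F j z \<in> unit_cube"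
      using f(2) subX tds_iterate(2)[OF T] unfolding F_def by (simp add: image_subset_iff subset_iff)
    have osc: "\<forall>U\<in>\<beta>. \<forall>z\<in>U. \<forall>z'\<in>U. \<forall>j<n. \<forall>i. \<bar>F j z $ i - F j z' $ i\<bar> \<le> e / 2"
    proof (intro ballI allI impI)
      fix U z z' j i assume *: "U \<in> \<beta>" "z \<in> U" "z' \<in> U" "j < n"
      show "\<bar>F j z $ i - F j z' $ i\<bar> \<le> e / 2"
        using join_oscillation[OF \<alpha>(3) \<beta>(2) *(1-3) jN[OF *(4)]] vec_nth_dist_le[of "F j z" i "F j z'"]
        unfolding F_def by linarith
    qed
    obtain V0 where V0: "\<forall>U\<in>\<beta>. \<forall>M<n * ?D. V0 U M \<in> {0..1}"
      "\<forall>U\<in>\<beta>. \<forall>z\<in>U. \<forall>j<n. \<forall>i. \<bar>V0 U (?D * j + to_nat_on (UNIV :: 'd set) i) - F j z $ i\<bar> \<le> e / 2"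
      using vertex_values[OF Fc osc] by blast
    obtain V where V: "\<forall>U\<in>\<beta>. \<forall>M<n * ?D. V U M \<in> {0..1} \<and> \<bar>V U M - V0 U M\<bar> \<le> e / 2"
      "\<forall>S\<subseteq>{..<n} \<times> \<beta>. card S \<le> (2 * l) * ?D \<longrightarrow> lin_indep S ((2 * l) * ?D) (\<lambda>s k. V (snd s) (?D * fst s + k))"
      using generic_shifts[OF fin e2 V0(1), of ?D n "(2 * l) * ?D"] by auto
    have V1: "\<forall>U\<in>\<beta>. \<forall>M<n * ?D. V U M \<in> {0..1}" using V(1) by blast
    have Vc: "\<bar>V U (?D * j + to_nat_on (UNIV :: 'd set) i) - F j z $ i\<bar> \<le> e"
      if U: "U \<in> \<beta>" and z: "z \<in> U" and j: "j < n" for U z j i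
    proof -
      let ?m = "?D * j + to_nat_on (UNIV :: 'd set) i"
      have "\<bar>V U ?m - V0 U ?m\<bar> \<le> e / 2" using V(1) U flat_index_less[OF j, of i] by blast
      moreover have "\<bar>V0 U ?m - F j z $ i\<bar> \<le> e / 2" using V0(2) U z j by blast
      ultimately show ?thesis by linarith
    qed
    define sh where "sh z = iter_int X T (- int s0) z" for z
    have shX: "sh z \<in> X" if "z \<in> X" for z unfolding sh_def by (rule iter_int_in[OF T that])
    define G where "G z a = (nerve_map \<psi> \<beta> V (sh z) a :: real ^ 'd)" for z a
    have Gcont: "\<forall>a. continuous_on X (\<lambda>z. G z a)"
    proof
      have "sh = iter_int X T (- int s0)" by (rule ext) (simp add: sh_def)
      then have shc: "continuous_on X sh" using continuous_on_iter_int[OF T] by simp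
      show "continuous_on X (\<lambda>z. G z a)" for a unfolding G_def
        by (rule continuous_on_compose2[OF continuous_on_nerve_map[OF \<psi>] shc]) (use shX in auto)
    qed
    have Gcube: "G z a \<in> unit_cube" if "z \<in> X" "a < n" for z a
      unfolding G_def by (rule nerve_map_in_unit_cube[OF \<psi> V1 shX[OF that(1)] that(2)])
    have Gclose: "\<bar>G z a $ i - f (iter_int X T (int a) z) $ i\<bar> \<le> e" if z: "z \<in> X" and a: "a < n" for z a i
    proof -
      have "(T ^^ (a + s0)) (sh z) = iter_int X T (int (a + s0) + - int s0) z"
        unfolding sh_def iter_int_add[OF T z] iter_int_nat ..
      then have "F a (sh z) = f (iter_int X T (int a) z)" by (simp add: F_def)
      moreover have "\<bar>G z a $ i - F a (sh z) $ i\<bar> \<le> e"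
        unfolding G_def using Vc a by (intro nerve_map_close[OF \<psi> shX[OF z]]) blast
      ultimately show ?thesis by simp
    qed

    \<comment> \<open>Two times of absolute value at most \<open>9 * l\<close> differ by at most
      \<open>18 * l\<close>, so a marker of this order is visited at most once between them.\<close>
    obtain F0 where F0: "openin (top_of_set X) F0" "local_marker X T (18 * l + 1) Z W F0"
      using mk unfolding has_local_markers_def by blast
    then obtain m where m: "Z \<union> W \<subseteq> (\<Union>i<m. (T ^^ i) ` F0)" and Fd: "\<forall>i\<in>{1..<18 * l + 1}. F0 \<inter> (T ^^ i) ` F0 = {}"
      unfolding local_marker_def by blast
    obtain \<phi>0 :: "'a \<Rightarrow> real" where \<phi>0: "continuous_on X \<phi>0"
      "\<forall>w\<in>X. 0 \<le> \<phi>0 w \<and> \<phi>0 w \<le> 1 \<and> (\<phi>0 w > 0 \<longrightarrow> w \<in> F0)"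
      "\<forall>z\<in>Z \<union> W. \<exists>i<m. \<phi>0 (iter_int X T (- int i) z) = 1"
      using marker_function[OF T F0(1) compact_Un[OF ZX(2) WX(2)] m] by blast
    define R where "R = 9 * l"
    \<comment> \<open>The shift by \<open>R\<close> moves the full visit at time \<open>-i\<close>
      to time \<open>-i - R\<close>, hence to or before the left end of the window.\<close>
    define \<phi> where "\<phi> w = \<phi>0 (iter_int X T (int R) w)" for w
    have \<phi>c: "continuous_on X \<phi>" unfolding \<phi>_def
      by (rule continuous_on_compose2[OF \<phi>0(1) continuous_on_iter_int[OF T]]) (use iter_int_in[OF T] in auto)
    have \<phi>b: "\<forall>w\<in>X. 0 \<le> \<phi> w \<and> \<phi> w \<le> 1" using \<phi>0(2) iter_int_in[OF T] by (simp add: \<phi>_def)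
    \<comment> \<open>At a time below \<open>R\<close>, the full visit at \<open>-i - R\<close> with
      \<open>i < m\<close> is fewer than \<open>M\<close> steps old, as \<open>phase_step\<close>
      requires.\<close>
    define M where "M = m + 2 * R + 1"
    define \<theta> where "\<theta> = phase X T \<phi> M"
    have \<theta>b: "\<forall>w\<in>X. 0 \<le> \<theta> w \<and> \<theta> w \<le> real M" unfolding \<theta>_def using phase_bounds[OF T \<phi>b] by blast
    have \<theta>c: "continuous_on X \<theta>" unfolding \<theta>_def by (rule continuous_on_phase[OF T \<phi>c])
    define g where "g = phased_map X T n \<theta> M G"
    have n0: "n > 0" by (simp add: n_def)
    have gc: "continuous_on X g" unfolding g_def by (rule continuous_on_phased_map[OF T \<theta>c Gcont])
    have gcube: "g ` X \<subseteq> unit_cube"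
    proof (rule image_subsetI)
      fix x assume x: "x \<in> X"
      have "0 \<le> g x $ i \<and> g x $ i \<le> 1" for i
        unfolding g_def
      proof (rule phased_map_nth_bounds[OF _ _ _ n0])
        show "\<forall>a<n. 0 \<le> G (iter_int X T (- int a) x) a $ i \<and> G (iter_int X T (- int a) x) a $ i \<le> 1"
          using Gcube[OF iter_int_in[OF T x]] by (simp add: unit_cube_def)
      qed (use \<theta>b x in auto)
      then show "g x \<in> unit_cube" by (simp add: unit_cube_def)
    qed
    have gclose: "\<forall>x\<in>X. \<forall>i. \<bar>g x $ i - f x $ i\<bar> \<le> e"
    proof (intro ballI allI)
      fix x i assume x: "x \<in> X"
      have "f x $ i - e \<le> g x $ i \<and> g x $ i \<le> f x $ i + e"
        unfolding g_def
      proof (rule phased_map_nth_bounds[OF _ _ _ n0])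
        show "\<forall>a<n. f x $ i - e \<le> G (iter_int X T (- int a) x) a $ i \<and> G (iter_int X T (- int a) x) a $ i \<le> f x $ i + e"
        proof (intro allI impI)
          fix a assume "a < n"
          moreover have "iter_int X T (int a) (iter_int X T (- int a) x) = x"
            using iter_int_add[OF T x, of "int a" "- int a"] by (simp add: iter_int_0)
          ultimately have "\<bar>G (iter_int X T (- int a) x) a $ i - f x $ i\<bar> \<le> e"
            using Gclose[OF iter_int_in[OF T x, of "- int a"], of a i] by simp
          then show "f x $ i - e \<le> G (iter_int X T (- int a) x) a $ i \<and> G (iter_int X T (- int a) x) a $ i \<le> f x $ i + e"
            by linarith
        qed
      qed (use \<theta>b x in auto)
      then show "\<bar>g x $ i - f x $ i\<bar> \<le> e" by linarith
    qed

    \<comment> \<open>Partial visits count as well: any positive value of \<phi> disturbs the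
      phase.\<close>
    define v where "v x = {t. \<phi> (iter_int X T t x) > 0}" for x
    have once: "\<forall>t\<in>v x. \<forall>t'\<in>v x. \<bar>t\<bar> \<le> 9 * int l \<longrightarrow> \<bar>t'\<bar> \<le> 9 * int l \<longrightarrow> t = t'" if x: "x \<in> X" for x
    proof -
      have inF: "iter_int X T (int R + t) x \<in> F0" if "t \<in> v x" for t
        using that \<phi>0(2) iter_int_in[OF T x] unfolding v_def \<phi>_def mem_Collect_eq iter_int_add[OF T x, symmetric] by blast
      have *: "\<not> t < t'" if t: "t \<in> v x" "t' \<in> v x" "\<bar>t\<bar> \<le> 9 * int l" "\<bar>t'\<bar> \<le> 9 * int l" for t t'
      proof
        assume lt: "t < t'"
        define k where "k = nat (t' - t)"
        have k: "int k = t' - t" "k \<in> {1..<18 * l + 1}" using lt t(3,4) by (auto simp: k_def)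
        have kt: "int R + t' = int k + (int R + t)" using k(1) by simp
        have "iter_int X T (int R + t') x = (T ^^ k) (iter_int X T (int R + t) x)"
          unfolding kt iter_int_add[OF T x, of "int k" "int R + t"] iter_int_nat ..
        then have "iter_int X T (int R + t') x \<in> F0 \<inter> (T ^^ k) ` F0" using inF[OF t(1)] inF[OF t(2)] by auto
        then show False using Fd k(2) by blast
      qed
      show ?thesis
      proof (intro ballI impI)
        fix t t' assume "t \<in> v x" "t' \<in> v x" "\<bar>t\<bar> \<le> 9 * int l" "\<bar>t'\<bar> \<le> 9 * int l"
        then show "t = t'" using *[of t t'] *[of t' t] by linarith
      qed
    qed
    have step: "\<forall>t. - 9 * int l \<le> t \<longrightarrow> t < 9 * int l \<longrightarrow> t + 1 \<notin> v x \<longrightarrow>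
        \<theta> (iter_int X T (t + 1) x) = \<theta> (iter_int X T t x) + 1" if x: "x \<in> Z \<union> W" for x
    proof (intro allI impI)
      fix t assume t: "- 9 * int l \<le> t" "t < 9 * int l" "t + 1 \<notin> v x"
      have xX: "x \<in> X" using x ZX WX by blast
      obtain i where i: "i < m" "\<phi>0 (iter_int X T (- int i) x) = 1" using \<phi>0(3) x by blast
      define k where "k = nat (t + int i + int R)"
      have k: "int k = t + int i + int R" using t by (simp add: k_def R_def)
      have kM: "k < M"
      proof -
        have "int k < int M" unfolding k using t i(1) by (simp add: M_def R_def)
        then show ?thesis by simp
      qed
      have 1: "\<phi> (iter_int X T (- int k) (iter_int X T t x)) = 1"
      proof -
        have "iter_int X T (int R) (iter_int X T (- int k) (iter_int X T t x)) = iter_int X T (- int i) x"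
          unfolding iter_int_add[OF T xX, symmetric] iter_int_add[OF T iter_int_in[OF T xX], symmetric] k by simp
        then show ?thesis using i(2) by (simp add: \<phi>_def)
      qed
      have e1: "iter_int X T 1 (iter_int X T t x) = iter_int X T (t + 1) x"
        using iter_int_add[OF T xX, of 1 t] by (simp add: add.commute)
      have "\<not> \<phi> (iter_int X T (t + 1) x) > 0" using t(3) by (simp add: v_def)
      then have 0: "\<phi> (iter_int X T 1 (iter_int X T t x)) = 0"
        unfolding e1 using \<phi>b iter_int_in[OF T xX, of "t + 1"] by force
      show "\<theta> (iter_int X T (t + 1) x) = \<theta> (iter_int X T t x) + 1"
        using phase_step[OF T iter_int_in[OF T xX] 0 kM 1] unfolding e1 \<theta>_def .
    qed
    have "orbit_map X T g x \<noteq> orbit_map X T g y" if xy: "x \<in> Z" "y \<in> W" for x y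
    proof
      assume eq: "orbit_map X T g x = orbit_map X T g y"
      have xX: "x \<in> X" "y \<in> X" using xy ZX WX by blast+
      have geq: "g (iter_int X T k x) = g (iter_int X T k y)" for k
        using fun_cong[OF eq, of k] by (simp add: orbit_map_def)
      have pos: "\<forall>t. 0 \<le> \<theta> (iter_int X T t x)" "\<forall>t. 0 \<le> \<theta> (iter_int X T t y)"
        using \<theta>b iter_int_in[OF T xX(1)] iter_int_in[OF T xX(2)] by blast+
      have xyU: "x \<in> Z \<union> W" "y \<in> Z \<union> W" using xy by blast+
      obtain s where s: "- 9 * int l \<le> s" "s \<le> 7 * int l"
        "\<forall>j<2 * l. \<theta> (iter_int X T (s + int j) x) = \<theta> (iter_int X T s x) + real j \<and>
          \<theta> (iter_int X T (s + int j) y) = \<theta> (iter_int X T s y) + real j"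
        "nat \<lfloor>\<theta> (iter_int X T s x)\<rfloor> mod (4 * l + 1) \<le> 2 * l" "nat \<lfloor>\<theta> (iter_int X T s y)\<rfloor> mod (4 * l + 1) \<le> 2 * l"
        using common_window[OF l(2) once[OF xX(1)] once[OF xX(2)] step[OF xyU(1)] step[OF xyU(2)] pos] by blast
      define a where "a = nat \<lfloor>\<theta> (iter_int X T s x)\<rfloor> mod (4 * l + 1)"
      define b where "b = nat \<lfloor>\<theta> (iter_int X T s y)\<rfloor> mod (4 * l + 1)"
      define t where "t = frac (\<theta> (iter_int X T s x))"
      define u where "u = frac (\<theta> (iter_int X T s y))"
      define px where "px c = sh (iter_int X T (s - int c) x)" for c
      define py where "py c = sh (iter_int X T (s - int c) y)" for c
      have ab: "a \<le> 2 * l" "b \<le> 2 * l" using s(4,5) by (simp_all add: a_def b_def)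
      have "(1 - t) *\<^sub>R nerve_map \<psi> \<beta> V (px a) (a + j) + t *\<^sub>R nerve_map \<psi> \<beta> V (px (a + 1)) (a + 1 + j)
        = (1 - u) *\<^sub>R nerve_map \<psi> \<beta> V (py b) (b + j) + u *\<^sub>R (nerve_map \<psi> \<beta> V (py (b + 1)) (b + 1 + j) :: real ^ 'd)"
        if j: "j < 2 * l" for j
      proof -
        have st: "\<theta> (iter_int X T (s + int j) x) = \<theta> (iter_int X T s x) + real j"
          "\<theta> (iter_int X T (s + int j) y) = \<theta> (iter_int X T s y) + real j" using s(3) j by blast+
        show ?thesis
          using phased_map_window[OF T xX(1) \<theta>b j st(1) a_def ab(1), of G] phased_map_window[OF T xX(2) \<theta>b j st(2) b_def ab(2), of G]
            geq[of "s + int j"]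
          unfolding g_def n_def G_def px_def py_def t_def u_def by simp
      qed
      then have E: "\<forall>j<2 * l. (1 - t) *\<^sub>R nerve_map \<psi> \<beta> V (px a) (a + j) + t *\<^sub>R nerve_map \<psi> \<beta> V (px (a + 1)) (a + 1 + j)
        = (1 - u) *\<^sub>R nerve_map \<psi> \<beta> V (py b) (b + j) + u *\<^sub>R (nerve_map \<psi> \<beta> V (py (b + 1)) (b + 1 + j) :: real ^ 'd)"
        by blast
      have pX: "\<forall>c. px c \<in> X" "\<forall>c. py c \<in> X"
        unfolding px_def py_def using shX iter_int_in[OF T xX(1)] iter_int_in[OF T xX(2)] by blast+
      have abn: "a + 1 < n" "b + 1 < n" using ab l(2) by (simp_all add: n_def)
      have "t < 1" by (simp add: t_def frac_lt_1)
      then obtain U where U: "U \<in> \<beta>" "px a \<in> U" "py a \<in> U"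
        using block_comparison[OF \<psi> V(2) mult pX abn _ E] by blast
      define k where "k = nat (int a + int s0 - s)"
      have k: "int k = int a + int s0 - s" "k < N" using s(1,2) ab(1) by (auto simp: k_def s0_def N_def)
      have origin: "(T ^^ k) (sh (iter_int X T (s - int a) z)) = z" if z: "z \<in> X" for z
      proof -
        have "(T ^^ k) (sh (iter_int X T (s - int a) z)) = iter_int X T (int k + (- int s0 + (s - int a))) z"
          unfolding sh_def iter_int_add[OF T z] iter_int_nat ..
        also have "\<dots> = z" using k(1) by (simp add: iter_int_0)
        finally show ?thesis .
      qed
      \<comment> \<open>Both base points lie in one member of \<beta>, so at each of the
        \<open>N\<close> times their iterates share a member of \<alpha>. At time \<open>k\<close>
        these iterates are \<open>x\<close> and \<open>y\<close>, and members of \<alpha> are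
        smaller than the gap.\<close>
      have "dist ((T ^^ k) (px a)) ((T ^^ k) (py a)) < gap"
        using join_oscillation[of \<alpha> "\<lambda>z. z" gap, OF \<alpha>(2) \<beta>(2) U k(2)] .
      then have "dist x y < gap" unfolding px_def py_def origin[OF xX(1)] origin[OF xX(2)] .
      moreover have "gap \<le> dist x y" using gap(2) xy by blast
      ultimately show False by simp
    qed
    then have "separates_pairs X T (Z \<times> W) g" by (auto simp: separates_pairs_def)
    then show "\<exists>g. continuous_on X g \<and> g ` X \<subseteq> unit_cube \<and> (\<forall>x\<in>X. \<forall>i. \<bar>g x $ i - f x $ i\<bar> \<le> e) \<and>
        separates_pairs X T (Z \<times> W) g"
      using gc gcube gclose by (intro exI[of _ g] conjI)
  qed
qed

section \<open>The embedding theorem\<close>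

text \<open>The pair of \<open>y\<close> and \<open>T y\<close> is itself aperiodic and therefore
  covered. So the sets \<open>Z i\<close> reach every aperiodic point, not only pairs.\<close>

lemma aperiodic_point_marked:
  fixes Z W :: "nat \<Rightarrow> 'a::metric_space set"
  assumes T: "tds X T" and y: "y \<in> X" "y \<notin> periodic_points X T"
    and cov: "aperiodic_pairs X T \<subseteq> (\<Union>i. Z i \<times> W i)"
  shows "\<exists>i. y \<in> Z i"
proof -
  have Ty: "T y \<in> X" using tds_iterate(2)[OF T y(1), of 1] by simp
  have "T y \<noteq> y" using y by (auto simp: periodic_points_def intro: exI[of _ 1])
  moreover have "T y \<notin> periodic_points X T"
  proof
    assume "T y \<in> periodic_points X T"
    then obtain k where k: "k \<ge> 1" "(T ^^ k) (T y) = T y" by (auto simp: periodic_points_def)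
    then have "(T ^^ 1) ((T ^^ k) y) = (T ^^ 1) y" by (simp add: funpow_swap1)
    then have "(T ^^ k) y = y" by (rule iterates_inj[OF T tds_iterate(2)[OF T y(1)] y(1)])
    then show False using k(1) y by (auto simp: periodic_points_def)
  qed
  ultimately have "(y, T y) \<in> aperiodic_pairs X T" using y Ty by (auto simp: aperiodic_pairs_def)
  then show ?thesis using cov by blast
qed

lemma minimal_period:
  assumes x: "x \<in> periodic_points X T"
  obtains q where "q \<ge> 1" "(T ^^ q) x = x" "\<forall>i\<in>{1..<q}. (T ^^ i) x \<noteq> x"
proof -
  let ?P = "\<lambda>k. 1 \<le> k \<and> (T ^^ k) x = x"
  define q where "q = (LEAST k. ?P k)"
  have "\<exists>k. ?P k" using x by (auto simp: periodic_points_def)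
  then have "?P q" unfolding q_def by (rule LeastI_ex)
  moreover have "\<forall>i\<in>{1..<q}. (T ^^ i) x \<noteq> x"
  proof
    fix i assume "i \<in> {1..<q}"
    then have "\<not> ?P i" "1 \<le> i" using not_less_Least[of i ?P] by (auto simp: q_def)
    then show "(T ^^ i) x \<noteq> x" by blast
  qed
  ultimately show ?thesis using that by blast
qed

lemma finite_positive_lower_bound:
  fixes a :: "'b \<Rightarrow> real"
  assumes "finite I" "\<forall>i\<in>I. a i > 0"
  shows "\<exists>k. \<forall>i\<in>I. inverse (real (Suc k)) \<le> a i"
proof (cases "I = {}")
  case False
  define m where "m = Min (a ` I)"
  have "m > 0" "\<forall>i\<in>I. m \<le> a i" using assms False by (simp_all add: m_def)
  moreover obtain k where "inverse (real (Suc k)) < m" using reals_Archimedean[OF \<open>m > 0\<close>] by blast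
  ultimately show ?thesis by (intro exI[of _ k]) force
qed simp

theorem theorem6p2:
  fixes X :: "'a::metric_space set" and T :: "'a \<Rightarrow> 'a"
  assumes "tds X T"
    and "local_marker_property X T"
    and "mean_dim X T < ereal (real CARD('d::finite) / 36)"
    and "perdim_less X T (real CARD('d) / 2)"
  shows "comeagre_in (mtopology_of (cube_maps X))
    {f \<in> mspace (cube_maps X :: ('a \<Rightarrow> real ^ 'd) metric). inj_on (orbit_map X T f) X}"
proof (cases "X = {}")
  case True
  have "nowhere_dense_in (mtopology_of (cube_maps X :: ('a \<Rightarrow> real ^ 'd) metric)) {}"
    by (simp add: nowhere_dense_in_def)
  then show ?thesis unfolding comeagre_in_def
    by (intro conjI exI[of _ "\<lambda>_. {}"]) (simp_all add: True)
next
  case False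
  note T = assms(1) and md = assms(3) and pd = assms(4)
  obtain Z W :: "nat \<Rightarrow> 'a set" where ZW: "\<forall>i. closedin (top_of_set X) (Z i) \<and> closedin (top_of_set X) (W i) \<and>
      Z i \<times> W i \<subseteq> aperiodic_pairs X T \<and> has_local_markers X T (Z i) (W i)"
    and cov: "aperiodic_pairs X T \<subseteq> (\<Union>i. Z i \<times> W i)"
    using assms(2) unfolding local_marker_property_def by blast
  have clZ: "closedin (top_of_set X) (Z i)" and clW: "closedin (top_of_set X) (W i)"
    and mk: "has_local_markers X T (Z i) (W i)" for i
    using spec[OF ZW, of i] by simp_all
  define r where "r k = inverse (real (Suc k))" for k
  have r: "r k > 0" for k by (simp add: r_def)
  define H where "H q k = spread_periodic X T q (r k)" for q k
  \<comment> \<open>The pieces are small along a whole period. With \<open>r k / 3\<close>, points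
    whose iterates stay \<open>r k\<close> apart lie in pieces that do not meet under these
    iterates.\<close>
  define good where "good q k \<C> \<longleftrightarrow> finite \<C> \<and> \<Union>\<C> = H q k \<and>
    (\<forall>C\<in>\<C>. compact C \<and> (\<forall>z\<in>C. \<forall>z'\<in>C. \<forall>j<q. dist ((T ^^ j) z) ((T ^^ j) z') < r k / 3))" for q k \<C>
  have "\<exists>\<C>. good q k \<C>" for q k
  proof -
    have "\<forall>j<q. continuous_on (H q k) (T ^^ j)"
      using continuous_on_subset[OF tds_iterate(1)[OF T]] spread_periodic_subset(2) unfolding H_def by blast
    then show ?thesis unfolding good_def
      using fine_compact_cover[where F = "\<lambda>j. T ^^ j" and n = q and e = "r k / 3", OF compact_spread_periodic[OF T], of q "r k"] r[of k]
      unfolding H_def by simp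
  qed
  then obtain \<C> where \<C>: "\<And>q k. good q k (\<C> q k)" by metis
  have \<C>1: "finite (\<C> q k)" "\<Union>(\<C> q k) = H q k" for q k using \<C>[of q k] by (simp_all add: good_def)
  have \<C>2: "compact C" "C \<subseteq> spread_periodic X T q (r k)"
    "\<forall>z\<in>C. \<forall>z'\<in>C. \<forall>j<q. dist ((T ^^ j) z) ((T ^^ j) z') < r k / 3" if "C \<in> \<C> q k" for C q k
    using \<C>[of q k] that unfolding good_def H_def by blast+
  have diam: "\<forall>z\<in>C. \<forall>z'\<in>C. dist z z' < r k" if C: "C \<in> \<C> q k" and q: "q \<ge> 1" for C q k
  proof (intro ballI)
    fix z z' assume "z \<in> C" "z' \<in> C"
    then have "dist ((T ^^ 0) z) ((T ^^ 0) z') < r k / 3" using \<C>2(3)[OF C] q by fastforce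
    then show "dist z z' < r k" using r[of k] by simp
  qed
  define sep where "sep q C1 C2 \<longleftrightarrow> (\<forall>z\<in>C1. \<forall>w\<in>C2. \<forall>l<q. (T ^^ l) z \<noteq> w)" for q C1 C2
  \<comment> \<open>Four countable families: aperiodic points against their iterates, periodic
    points against their iterates up to half the period, pairs of equal least period on different
    orbits, and pairs of aperiodic points.\<close>
  define \<K>1 where "\<K>1 = (\<Union>i. \<Union>p. if p > 0 then {(\<lambda>y. (y, (T ^^ p) y)) ` Z i} else {})"
  define \<K>2 where "\<K>2 = (\<Union>q. \<Union>k. \<Union>p. if 0 < p \<and> 2 * p \<le> q then (\<lambda>C. (\<lambda>y. (y, (T ^^ p) y)) ` C) ` \<C> q k else {})"
  define \<K>3 where "\<K>3 = (\<Union>q. \<Union>k. if q \<ge> 1 then (\<lambda>(C1, C2). C1 \<times> C2) ` {(C1, C2). C1 \<in> \<C> q k \<and> C2 \<in> \<C> q k \<and> sep q C1 C2} else {})"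
  define \<K>4 where "\<K>4 = (\<Union>i. {Z i \<times> W i})"
  have disj: "Z i \<inter> W i = {}" for i
  proof (rule ccontr)
    assume "Z i \<inter> W i \<noteq> {}"
    then obtain z where "(z, z) \<in> aperiodic_pairs X T" using ZW by blast
    then show False by (auto simp: aperiodic_pairs_def)
  qed
  have "countable (\<K>1 \<union> \<K>2 \<union> \<K>3 \<union> \<K>4)"
  proof -
    have "finite {(C1, C2). C1 \<in> \<C> q k \<and> C2 \<in> \<C> q k \<and> sep q C1 C2}" for q k
      by (rule finite_subset[of _ "\<C> q k \<times> \<C> q k"]) (use \<C>1(1) in auto)
    then show ?thesis
      unfolding \<K>1_def \<K>2_def \<K>3_def \<K>4_def using \<C>1(1)
      by (intro countable_Un countable_UN countableI_type) (auto intro: countable_finite)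
  qed
  moreover have "densely_separable TYPE('d) X T K" if "K \<in> \<K>1 \<union> \<K>2 \<union> \<K>3 \<union> \<K>4" for K
    using that
  proof (elim UnE)
    assume "K \<in> \<K>1"
    then obtain i p where ip: "p > 0" "K = (\<lambda>y. (y, (T ^^ p) y)) ` Z i" by (auto simp: \<K>1_def split: if_splits)
    show ?thesis unfolding ip(2) by (rule densely_separable_marked[OF T False md clZ mk ip(1)])
  next
    assume "K \<in> \<K>2"
    then obtain q k p C where *: "0 < p" "2 * p \<le> q" "C \<in> \<C> q k" "K = (\<lambda>y. (y, (T ^^ p) y)) ` C"
      by (auto simp: \<K>2_def split: if_splits)
    have "q \<ge> 1" using * by simp
    then show ?thesis unfolding *(4)
      by (intro densely_separable_own_period[OF T pd *(1,2) \<C>2(1,2)[OF *(3)] diam[OF *(3)]])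
  next
    assume "K \<in> \<K>3"
    then obtain q k C1 C2 where *: "q \<ge> 1" "C1 \<in> \<C> q k" "C2 \<in> \<C> q k" "sep q C1 C2" "K = C1 \<times> C2"
      by (auto simp: \<K>3_def split: if_splits)
    show ?thesis unfolding *(5)
      by (rule densely_separable_equal_period[OF T pd *(1) r[of k] \<C>2(1,2)[OF *(2)] diam[OF *(2,1)] \<C>2(1,2)[OF *(3)] diam[OF *(3,1)] *(4)[unfolded sep_def]])
  next
    assume "K \<in> \<K>4"
    then obtain i where i: "K = Z i \<times> W i" by (auto simp: \<K>4_def)
    show ?thesis unfolding i by (rule densely_separable_marked_pairs[OF T False md clZ clW disj mk])
  qed
  moreover have "inj_on (orbit_map X T f) X" if sep_f: "\<forall>K\<in>\<K>1 \<union> \<K>2 \<union> \<K>3 \<union> \<K>4. separates_pairs X T K f"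
    for f :: "'a \<Rightarrow> real ^ 'd"
  proof (rule inj_onI, rule ccontr)
    let ?I = "orbit_map X T f"
    let ?P = "periodic_points X T"
    have shift: "?I ((T ^^ p) x) k = ?I x (k + int p)" if "x \<in> X" for x p k
      by (rule orbit_map_iterate[OF T that])
    have ap: "?I y \<noteq> ?I ((T ^^ p) y)" if y: "y \<in> X" "y \<notin> ?P" and p: "p > 0" for y p
    proof -
      obtain i where i: "y \<in> Z i" using aperiodic_point_marked[OF T y cov] by blast
      have "(\<lambda>y. (y, (T ^^ p) y)) ` Z i \<in> \<K>1"
        unfolding \<K>1_def using p by (intro UN_I[of i] UN_I[of p] UNIV_I) simp
      then have "separates_pairs X T ((\<lambda>y. (y, (T ^^ p) y)) ` Z i) f" using sep_f by blast
      then show ?thesis using i by (auto simp: separates_pairs_def)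
    qed
    have per: "?I y \<noteq> ?I ((T ^^ p) y)"
      if q: "(T ^^ q) y = y" "\<forall>i\<in>{1..<q}. (T ^^ i) y \<noteq> y" and y: "y \<in> X" and p: "0 < p" "p < q" for y p q
    proof -
      obtain k where k: "\<forall>i\<in>{1..<q}. r k \<le> dist ((T ^^ i) y) y"
        using finite_positive_lower_bound[of "{1..<q}" "\<lambda>i. dist ((T ^^ i) y) y"] q(2) unfolding r_def by auto
      have "y \<in> H q k" using y q p k by (auto simp: H_def spread_periodic_def periodic_points_upto_def intro!: exI[of _ q])
      then obtain C where C: "C \<in> \<C> q k" "y \<in> C" using \<C>1(2) by blast
      have *: "?I y \<noteq> ?I ((T ^^ p') y)" if p': "0 < p'" "2 * p' \<le> q" for p'
      proof -
        have "(\<lambda>C. (\<lambda>y. (y, (T ^^ p') y)) ` C) C \<in> \<K>2"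
          unfolding \<K>2_def using p' C(1) by (intro UN_I[of q] UN_I[of k] UN_I[of p'] UNIV_I) simp
        then have "separates_pairs X T ((\<lambda>y. (y, (T ^^ p') y)) ` C) f" using sep_f by blast
        then show ?thesis using C(2) by (auto simp: separates_pairs_def)
      qed
      show ?thesis
      proof (cases "2 * p \<le> q")
        case True
        then show ?thesis using * p by blast
      next
        case False
        show ?thesis
        proof
          assume eq: "?I y = ?I ((T ^^ p) y)"
          \<comment> \<open>The orbit map of \<open>y\<close> is invariant under shifts by
            \<open>p\<close> and by \<open>q\<close>, hence by \<open>q - p\<close>, which is at
            most half the period.\<close>
          have "?I ((T ^^ (q - p)) y) = ?I y"
          proof
            fix j
            have "?I ((T ^^ (q - p)) y) j = ?I y (j + int (q - p))" by (rule shift[OF y])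
            also have "\<dots> = ?I ((T ^^ p) y) (j + int (q - p))" using eq by simp
            also have "\<dots> = ?I y (j + int (q - p) + int p)" by (rule shift[OF y])
            also have "j + int (q - p) + int p = j + int q" using p by simp
            also have "?I y (j + int q) = ?I y j" using shift[OF y, of q j] q(1) by simp
            finally show "?I ((T ^^ (q - p)) y) j = ?I y j" .
          qed
          moreover have "0 < q - p" "2 * (q - p) \<le> q" using False p by auto
          ultimately show False using *[of "q - p"] by simp
        qed
      qed
    qed
    have mixed: "?I x \<noteq> ?I y" if x: "x \<in> X" "x \<in> ?P" and y: "y \<in> X" "y \<notin> ?P" for x y
    proof
      assume eq: "?I x = ?I y"
      obtain q where q: "q \<ge> 1" "(T ^^ q) x = x" using x(2) by (auto simp: periodic_points_def)
      have "?I ((T ^^ q) y) = ?I y"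
      proof
        fix j show "?I ((T ^^ q) y) j = ?I y j"
          using shift[OF y(1), of q j] shift[OF x(1), of q j] q(2) eq by simp
      qed
      then show False using ap[OF y, of q] q(1) by simp
    qed
    have smaller: "?I x \<noteq> ?I y" if x: "x \<in> X" "(T ^^ q) x = x" "q \<ge> 1"
      and y: "y \<in> X" "(T ^^ q') y = y" "\<forall>i\<in>{1..<q'}. (T ^^ i) y \<noteq> y" and qq: "q < q'" for x y q q'
    proof
      assume eq: "?I x = ?I y"
      have "?I ((T ^^ q) y) = ?I y"
      proof
        fix j show "?I ((T ^^ q) y) j = ?I y j"
          using shift[OF y(1), of q j] shift[OF x(1), of q j] x(2) eq by simp
      qed
      then show False using per[OF y(2,3,1), of q] x(3) qq by simp
    qed
    fix x y assume x: "x \<in> X" and y: "y \<in> X" and eq: "?I x = ?I y" and ne: "x \<noteq> y"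
    show False
    proof (cases "x \<in> ?P")
      case xP: False
      show False
      proof (cases "y \<in> ?P")
        case True
        then show False using mixed[OF y True x xP] eq by simp
      next
        case yP: False
        have "(x, y) \<in> aperiodic_pairs X T" using x y xP yP ne by (auto simp: aperiodic_pairs_def)
        then obtain i where i: "(x, y) \<in> Z i \<times> W i" using cov by blast
        have "Z i \<times> W i \<in> \<K>4" by (auto simp: \<K>4_def)
        then have "separates_pairs X T (Z i \<times> W i) f" using sep_f by blast
        then show False using i eq by (auto simp: separates_pairs_def)
      qed
    next
      case xP: True
      show False
      proof (cases "y \<in> ?P")
        case False
        then show False using mixed[OF x xP y False] eq by simp
      next
        case yP: True
        obtain q where q: "q \<ge> 1" "(T ^^ q) x = x" "\<forall>i\<in>{1..<q}. (T ^^ i) x \<noteq> x" by (rule minimal_period[OF xP])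
        obtain q' where q': "q' \<ge> 1" "(T ^^ q') y = y" "\<forall>i\<in>{1..<q'}. (T ^^ i) y \<noteq> y" by (rule minimal_period[OF yP])
        have qq: "q = q'"
          using smaller[OF x q(2,1) y q'(2,3)] smaller[OF y q'(2,1) x q(2,3)] eq by (metis linorder_neqE_nat)
        show False
        proof (cases "\<exists>l<q. (T ^^ l) x = y")
          case True
          then obtain l where l: "l < q" "(T ^^ l) x = y" by blast
          then have "l > 0" using ne by (cases l) auto
          then show False using per[OF q(2,3) x _ l(1)] l(2) eq by simp
        next
          case no: False
          \<comment> \<open>The second component tags three kinds of distances, so that a single
            \<open>r k\<close> bounds all of them from below: returns of \<open>x\<close>, returns
            of \<open>y\<close>, and passages from the orbit of \<open>x\<close> to
            \<open>y\<close>.\<close>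
          define D where "D = {1..<q} \<times> {0::nat} \<union> {1..<q} \<times> {1} \<union> {..<q} \<times> {2}"
          define \<delta> where "\<delta> p = (if snd p = 0 then dist ((T ^^ fst p) x) x else if snd p = 1 then dist ((T ^^ fst p) y) y
            else dist ((T ^^ fst p) x) y)" for p :: "nat \<times> nat"
          have "finite D" by (simp add: D_def)
          moreover have "\<forall>p\<in>D. \<delta> p > 0" using no q(3) q'(3) qq by (auto simp: D_def \<delta>_def)
          ultimately obtain k where k: "\<forall>p\<in>D. r k \<le> \<delta> p" using finite_positive_lower_bound unfolding r_def by blast
          have kx: "\<forall>i\<in>{1..<q}. r k \<le> dist ((T ^^ i) x) x"
          proof
            fix i assume "i \<in> {1..<q}"
            then have "(i, 0) \<in> D" by (simp add: D_def)
            then show "r k \<le> dist ((T ^^ i) x) x" using k by (force simp: \<delta>_def)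
          qed
          have ky: "\<forall>i\<in>{1..<q}. r k \<le> dist ((T ^^ i) y) y"
          proof
            fix i assume "i \<in> {1..<q}"
            then have "(i, 1) \<in> D" by (simp add: D_def)
            then show "r k \<le> dist ((T ^^ i) y) y" using k by (force simp: \<delta>_def)
          qed
          have kxy: "r k \<le> dist ((T ^^ l) x) y" if "l < q" for l
          proof -
            have "(l, 2) \<in> D" using that by (simp add: D_def)
            then show ?thesis using k by (force simp: \<delta>_def)
          qed
          have "x \<in> H q k" "y \<in> H q k"
            using x y q q' qq kx ky by (auto simp: H_def spread_periodic_def periodic_points_upto_def intro!: exI[of _ q])
          then obtain C1 C2 where C: "C1 \<in> \<C> q k" "x \<in> C1" "C2 \<in> \<C> q k" "y \<in> C2" using \<C>1(2) by blast
          \<comment> \<open>If an iterate of \<open>C1\<close> met \<open>C2\<close>, then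
            \<open>(T ^^ l) x\<close> and \<open>y\<close> would each be within
            \<open>r k / 3\<close> of a common point, against their distance of at least
            \<open>r k\<close>.\<close>
          have "sep q C1 C2" unfolding sep_def
          proof (intro ballI allI impI notI)
            fix z w l assume zw: "z \<in> C1" "w \<in> C2" "l < q" "(T ^^ l) z = w"
            have "dist ((T ^^ l) z) ((T ^^ l) x) < r k / 3" using \<C>2(3)[OF C(1)] zw C(2) by blast
            moreover have "dist ((T ^^ 0) w) ((T ^^ 0) y) < r k / 3" using \<C>2(3)[OF C(3)] zw C(4) q(1) by force
            moreover have "dist ((T ^^ l) x) y \<le> dist ((T ^^ l) z) ((T ^^ l) x) + dist w y"
              unfolding zw(4) by (rule dist_triangle3)
            ultimately show False using kxy[OF zw(3)] r[of k] by simp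
          qed
          then have "C1 \<times> C2 \<in> \<K>3" using C q(1) unfolding \<K>3_def by (intro UN_I[of q] UN_I[of k] UNIV_I) auto
          then have "separates_pairs X T (C1 \<times> C2) f" using sep_f by blast
          then show False using C eq by (auto simp: separates_pairs_def)
        qed
      qed
    qed
  qed
  ultimately show ?thesis by (intro comeagre_in_cube_maps[OF T False]) blast+
qed

end
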